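(* Let $\nu\ge 1$, let $V_0$ be a real-valued potential on $\mathbb{R}^\nu$ such that $H_0=-\Delta+V_0$ satisfies $\inf\operatorname{spec}(H_0)=0$ and $H_0$ has a regular ground state $u_0$, and let $\beta=\beta(V_0)=\left(\sup u_0/\inf u_0\right)^2$. Then for any $V\le 0$ on $\mathbb{R}^\nu$ and all $j\ge 1$, $$|E_j(0;\beta^{-1}V)|\le |E_j(V_0;V)|\le |E_j(0;\beta V)|.$$
   Context: $H_0$ has a regular ground state if there is a function $u_0$ on $\mathbb{R}^\nu$ with $(-\Delta+V_0)u_0=0$ (in the distributional sense) and $0<c_1\le u_0(x)\le c_2<\infty$ for all $x$, for some constants $c_1,c_2$; one takes $c_1=\inf u_0$, $c_2=\sup u_0$ and $\beta(V_0)=(c_2/c_1)^2$. Standing technical convention: $u_0$ is continuous, and $H_0=-\Delta+V_0$ is the nonnegative self-adjoint operator on $L^2(\mathbb{R}^\nu)$ given by the ground state representation: its form domain is $\{gu_0 : g\in L^2(\mathbb{R}^\nu,u_0^2\,dx),\ \nabla g\in L^2(\mathbb{R}^\nu,u_0^2\,dx)\}$ ($\nabla g$ the distributional gradient), with $\langle gu_0,H_0gu_0\rangle=\int|\nabla g|^2u_0^2\,d^\nu x$. (This holds, for instance, if the positive part of $V_0$ is in $L^1_{\rm loc}$, the negative part is in the Kato class $K_\nu$, and $H_0$ is the form closure of $-\Delta+V_0$ on $C_0^\infty$.) For measurable $V\le0$, the operators $H_0+V$ and $-\Delta+tV$ ($t>0$) are form sums; it is tacitly assumed that $V$ is such that the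 quadratic forms of the operators appearing are well defined on the form domain of $H_0$, respectively $-\Delta$, closed and bounded below. For $j=1,2,\dots$, with $H=-\Delta+V_0+V$ and $P_I(H)$ its spectral projections, $$E_j(V_0;V)=\min\bigl(0,\ \inf\{\lambda:\dim \operatorname{Ran} P_{(-\infty,\lambda]}(H)\ge j\}\bigr),$$ i.e. the $j$-th negative eigenvalue (counted with multiplicity) or $0$. $E_j(0;W)$ denotes the same quantity for $-\Delta+W$. *)

theory Defs
  imports "HOL-Analysis.Analysis"
begin

section \<open>The complex Hilbert space of square integrable functions\<close>

definition sq_integrable :: "'a measure \<Rightarrow> ('a \<Rightarrow> complex) \<Rightarrow> bool" where
  "sq_integrable M f \<longleftrightarrow> f \<in> borel_measurable M \<and> integrable M (\<lambda>x. (cmod (f x))\<^sup>2)"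

lemma sq_integrable_zero: "sq_integrable M (\<lambda>x. 0)"
  by (simp add: sq_integrable_def)

lemma sq_integrable_cmult:
  assumes "sq_integrable M f" shows "sq_integrable M (\<lambda>x. c * f x)"
  using assms by (auto simp: sq_integrable_def norm_mult power_mult_distrib)

lemma sq_integrable_add:
  assumes f: "sq_integrable M f" and g: "sq_integrable M g"
  shows "sq_integrable M (\<lambda>x. f x + g x)"
proof -
  have meas [measurable]: "f \<in> borel_measurable M" "g \<in> borel_measurable M"
    using f g by (auto simp: sq_integrable_def)
  have "integrable M (\<lambda>x. (cmod (f x + g x))\<^sup>2)"
  proof (rule Bochner_Integration.integrable_bound)
    show "integrable M (\<lambda>x. 2 * (cmod (f x))\<^sup>2 + 2 * (cmod (g x))\<^sup>2)"
      using f g by (auto simp: sq_integrable_def)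
    have "(cmod (f x + g x))\<^sup>2 \<le> 2 * (cmod (f x))\<^sup>2 + 2 * (cmod (g x))\<^sup>2" for x
    proof -
      have "(cmod (f x + g x))\<^sup>2 \<le> (cmod (f x) + cmod (g x))\<^sup>2"
        by (intro power_mono norm_triangle_ineq) auto
      also have "\<dots> \<le> 2 * (cmod (f x))\<^sup>2 + 2 * (cmod (g x))\<^sup>2"
        using sum_squares_bound[of "cmod (f x)" "cmod (g x)"] by (simp add: power2_sum)
      finally show ?thesis .
    qed
    then show "AE x in M. norm ((cmod (f x + g x))\<^sup>2)
        \<le> norm (2 * (cmod (f x))\<^sup>2 + 2 * (cmod (g x))\<^sup>2)" by auto
  qed auto
  then show ?thesis by (simp add: sq_integrable_def)
qed

lemma sq_integrable_inner:
  assumes f: "sq_integrable M f" and g: "sq_integrable M g"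
  shows "integrable M (\<lambda>x. cnj (f x) * g x)"
proof (rule Bochner_Integration.integrable_bound)
  have meas [measurable]: "f \<in> borel_measurable M" "g \<in> borel_measurable M"
    using f g by (auto simp: sq_integrable_def)
  show "integrable M (\<lambda>x. (cmod (f x))\<^sup>2 + (cmod (g x))\<^sup>2)"
    using f g by (auto simp: sq_integrable_def)
  show "(\<lambda>x. cnj (f x) * g x) \<in> borel_measurable M"
    by (intro borel_measurable_times meas
        measurable_compose[OF meas(1)] borel_measurable_continuous_onI continuous_intros)
  have "cmod (f x) * cmod (g x) \<le> (cmod (f x))\<^sup>2 + (cmod (g x))\<^sup>2" for x
    using sum_squares_bound[of "cmod (f x)" "cmod (g x)"]
      mult_nonneg_nonneg[OF norm_ge_zero[of "f x"] norm_ge_zero[of "g x"]] by linarith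
  then show "AE x in M. norm (cnj (f x) * g x) \<le> norm ((cmod (f x))\<^sup>2 + (cmod (g x))\<^sup>2)"
    by (auto simp: norm_mult)
qed

definition L2_rel :: "('a::euclidean_space \<Rightarrow> complex) \<Rightarrow> ('a \<Rightarrow> complex) \<Rightarrow> bool" where
  "L2_rel f g \<longleftrightarrow>
     sq_integrable lebesgue f \<and> sq_integrable lebesgue g \<and> (AE x in lebesgue. f x = g x)"

quotient_type (overloaded) 'a L2 = "'a::euclidean_space \<Rightarrow> complex" / partial: L2_rel
proof (rule part_equivpI)
  show "\<exists>f::'a \<Rightarrow> complex. L2_rel f f"
    by (rule exI[of _ "\<lambda>x. 0"]) (simp add: L2_rel_def sq_integrable_zero)
  show "symp (L2_rel :: ('a \<Rightarrow> complex) \<Rightarrow> _)"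
    by (auto simp: symp_def L2_rel_def elim: eventually_mono)
  show "transp (L2_rel :: ('a \<Rightarrow> complex) \<Rightarrow> _)"
    unfolding transp_def L2_rel_def by (auto elim: eventually_elim2)
qed

lift_definition cscale :: "complex \<Rightarrow> 'a::euclidean_space L2 \<Rightarrow> 'a L2" (infixr "*\<^sub>C" 75)
  is "\<lambda>c f x. c * f x"
  by (auto simp: L2_rel_def sq_integrable_cmult elim: eventually_mono)

lift_definition cinner :: "'a::euclidean_space L2 \<Rightarrow> 'a L2 \<Rightarrow> complex"
  is "\<lambda>f g. LINT x|lebesgue. cnj (f x) * g x"
proof -
  fix f f' g g' :: "'a \<Rightarrow> complex"
  assume ff: "L2_rel f f'" and gg: "L2_rel g g'"
  have "integrable lebesgue (\<lambda>x. cnj (f x) * g x)" "integrable lebesgue (\<lambda>x. cnj (f' x) * g' x)"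
    using ff gg by (auto simp: L2_rel_def intro: sq_integrable_inner)
  moreover have "AE x in lebesgue. cnj (f x) * g x = cnj (f' x) * g' x"
    using ff gg unfolding L2_rel_def by (auto elim: eventually_elim2)
  ultimately show "(LINT x|lebesgue. cnj (f x) * g x) = (LINT x|lebesgue. cnj (f' x) * g' x)"
    by (intro integral_cong_AE) auto
qed

instantiation L2 :: (euclidean_space) real_inner
begin

lift_definition zero_L2 :: "'a L2" is "\<lambda>x. 0"
  by (simp add: L2_rel_def sq_integrable_zero)

lift_definition plus_L2 :: "'a L2 \<Rightarrow> 'a L2 \<Rightarrow> 'a L2" is "\<lambda>f g x. f x + g x"
  unfolding L2_rel_def by (auto intro: sq_integrable_add elim: eventually_elim2)

definition scaleR_L2 :: "real \<Rightarrow> 'a L2 \<Rightarrow> 'a L2" where "scaleR_L2 r f = complex_of_real r *\<^sub>C f"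
definition uminus_L2 :: "'a L2 \<Rightarrow> 'a L2" where "uminus_L2 f = (- 1) *\<^sub>C f"
definition minus_L2 :: "'a L2 \<Rightarrow> 'a L2 \<Rightarrow> 'a L2" where "minus_L2 f g = f + (- g)"
definition inner_L2 :: "'a L2 \<Rightarrow> 'a L2 \<Rightarrow> real" where "inner_L2 f g = Re (cinner f g)"
definition norm_L2 :: "'a L2 \<Rightarrow> real" where "norm_L2 f = sqrt (inner f f)"
definition sgn_L2 :: "'a L2 \<Rightarrow> 'a L2" where "sgn_L2 f = inverse (norm f) *\<^sub>R f"
definition dist_L2 :: "'a L2 \<Rightarrow> 'a L2 \<Rightarrow> real" where "dist_L2 f g = norm (f - g)"
definition uniformity_L2 :: "('a L2 \<times> 'a L2) filter" where
  "uniformity_L2 = (INF e\<in>{0<..}. principal {(f, g). dist f g < e})"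
definition open_L2 :: "'a L2 set \<Rightarrow> bool" where
  "open_L2 U \<longleftrightarrow> (\<forall>f\<in>U. eventually (\<lambda>(f', g). f' = f \<longrightarrow> g \<in> U) uniformity)"

instance
proof
  fix f g h :: "'a L2" and r s :: real
  show "f + g + h = f + (g + h)"
    by transfer (auto simp: L2_rel_def add.assoc intro!: sq_integrable_add)
  show "f + g = g + f"
    by transfer (auto simp: L2_rel_def add.commute intro!: sq_integrable_add)
  show "0 + f = f"
    by transfer (auto simp: L2_rel_def)
  show "- f + f = 0"
    unfolding uminus_L2_def
    by transfer (auto simp: L2_rel_def intro!: sq_integrable_add sq_integrable_cmult sq_integrable_zero
        dest: sq_integrable_cmult[where c = "- 1"])
  show "f - g = f + - g" by (rule minus_L2_def)
  show "r *\<^sub>R (f + g) = r *\<^sub>R f + r *\<^sub>R g"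
    unfolding scaleR_L2_def
    by transfer (auto simp: L2_rel_def distrib_left intro!: sq_integrable_add sq_integrable_cmult)
  show "(r + s) *\<^sub>R f = r *\<^sub>R f + s *\<^sub>R f"
    unfolding scaleR_L2_def
    by transfer (auto simp: L2_rel_def distrib_right intro!: sq_integrable_add sq_integrable_cmult)
  show "r *\<^sub>R s *\<^sub>R f = (r * s) *\<^sub>R f"
    unfolding scaleR_L2_def
    by transfer (auto simp: L2_rel_def mult.assoc intro!: sq_integrable_cmult)
  show "1 *\<^sub>R f = f"
    unfolding scaleR_L2_def by transfer (auto simp: L2_rel_def)
  show "dist f g = norm (f - g)" by (rule dist_L2_def)
  show "sgn f = inverse (norm f) *\<^sub>R f" by (rule sgn_L2_def)
  show "(uniformity :: ('a L2 \<times> 'a L2) filter)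
      = (INF e\<in>{0<..}. principal {(f, g). dist f g < e})" by (rule uniformity_L2_def)
  show "open U \<longleftrightarrow> (\<forall>f\<in>U. eventually (\<lambda>(f', g). f' = f \<longrightarrow> g \<in> U) uniformity)"
    for U :: "'a L2 set" by (rule open_L2_def)
  show "inner f g = inner g f"
    unfolding inner_L2_def
  proof transfer
    fix f g :: "'a \<Rightarrow> complex"
    assume "L2_rel f f" "L2_rel g g"
    then have "integrable lebesgue (\<lambda>x. cnj (f x) * g x)" "integrable lebesgue (\<lambda>x. cnj (g x) * f x)"
      by (auto simp: L2_rel_def intro: sq_integrable_inner)
    then show "Re (LINT x|lebesgue. cnj (f x) * g x) = Re (LINT x|lebesgue. cnj (g x) * f x)"
      by (simp add: mult.commute flip: integral_Re)
  qed
  show "inner (f + g) h = inner f h + inner g h"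
    unfolding inner_L2_def
    by transfer (simp add: L2_rel_def sq_integrable_inner distrib_right)
  show "inner (r *\<^sub>R f) g = r * inner f g"
    unfolding inner_L2_def scaleR_L2_def
    by transfer (simp add: mult.assoc)
  have sq: "cnj z * z = complex_of_real ((cmod z)\<^sup>2)" for z
    by (simp add: complex_norm_square mult.commute del: of_real_power)
  have inner_sq: "Re (LINT x|lebesgue. cnj (f x) * f x) = (LINT x|lebesgue. (cmod (f x))\<^sup>2)"
    for f :: "'a \<Rightarrow> complex"
    by (simp only: sq integral_complex_of_real Re_complex_of_real)
  show "0 \<le> inner f f"
    unfolding inner_L2_def by transfer (simp only: inner_sq, simp)
  show "inner f f = 0 \<longleftrightarrow> f = 0"
    unfolding inner_L2_def
  proof transfer
    fix f :: "'a \<Rightarrow> complex"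
    assume "L2_rel f f"
    then have f: "sq_integrable lebesgue f" by (simp add: L2_rel_def)
    then have "(LINT x|lebesgue. (cmod (f x))\<^sup>2) = 0 \<longleftrightarrow> (AE x in lebesgue. (cmod (f x))\<^sup>2 = 0)"
      by (intro integral_nonneg_eq_0_iff_AE) (auto simp: sq_integrable_def)
    then show "Re (LINT x|lebesgue. cnj (f x) * f x) = 0 \<longleftrightarrow> L2_rel f (\<lambda>x. 0)"
      using f by (simp add: inner_sq L2_rel_def sq_integrable_zero)
  qed
  show "norm f = sqrt (inner f f)" by (rule norm_L2_def)
qed

end

text \<open>Linear algebra over \<open>\<complex>\<close> in \<open>L2\<close>; the scalar multiplication of the type class is the real one.\<close>

interpretation L2: vector_space "cscale :: complex \<Rightarrow> 'a::euclidean_space L2 \<Rightarrow> 'a L2"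
proof
  fix a b :: complex and f g :: "'a L2"
  show "a *\<^sub>C (f + g) = a *\<^sub>C f + a *\<^sub>C g"
    by transfer (auto simp: L2_rel_def distrib_left intro!: sq_integrable_add sq_integrable_cmult)
  show "(a + b) *\<^sub>C f = a *\<^sub>C f + b *\<^sub>C f"
    by transfer (auto simp: L2_rel_def distrib_right intro!: sq_integrable_add sq_integrable_cmult)
  show "a *\<^sub>C b *\<^sub>C f = (a * b) *\<^sub>C f"
    by transfer (auto simp: L2_rel_def mult.assoc intro!: sq_integrable_cmult)
  show "1 *\<^sub>C f = f"
    by transfer (auto simp: L2_rel_def)
qed

text \<open>\<open>dim S \<ge> j\<close>, including the infinite-dimensional case, for which the library's \<open>dim\<close> is \<open>0\<close>.\<close>

definition cdim_ge :: "'a::euclidean_space L2 set \<Rightarrow> nat \<Rightarrow> bool" where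
  "cdim_ge S j \<longleftrightarrow> (\<exists>B\<subseteq>S. finite B \<and> card B = j \<and> L2.independent B)"


section \<open>Distributional derivatives\<close>

definition partial_deriv :: "'a::euclidean_space \<Rightarrow> ('a \<Rightarrow> real) \<Rightarrow> 'a \<Rightarrow> real" where
  "partial_deriv b f x = frechet_derivative f (at x) b"

fun C_k :: "nat \<Rightarrow> ('a::euclidean_space \<Rightarrow> real) \<Rightarrow> bool" where
  "C_k 0 f \<longleftrightarrow> continuous_on UNIV f"
| "C_k (Suc k) f \<longleftrightarrow>
     (\<forall>x. f differentiable (at x)) \<and> (\<forall>b\<in>Basis. C_k k (partial_deriv b f))"

definition test_function :: "('a::euclidean_space \<Rightarrow> real) \<Rightarrow> bool" where
  "test_function \<phi> \<longleftrightarrow> (\<forall>k. C_k k \<phi>) \<and> (\<exists>K. compact K \<and> (\<forall>x. x \<notin> K \<longrightarrow> \<phi> x = 0))"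

definition locally_integrable :: "('a::euclidean_space \<Rightarrow> 'b::euclidean_space) \<Rightarrow> bool" where
  "locally_integrable f \<longleftrightarrow> (\<forall>K. compact K \<longrightarrow> f absolutely_integrable_on K)"

definition has_weak_deriv ::
  "'a::euclidean_space \<Rightarrow> ('a \<Rightarrow> complex) \<Rightarrow> ('a \<Rightarrow> complex) \<Rightarrow> bool" where
  "has_weak_deriv b g h \<longleftrightarrow> locally_integrable g \<and> locally_integrable h \<and>
     (\<forall>\<phi>. test_function \<phi> \<longrightarrow>
        (LINT x|lebesgue. partial_deriv b \<phi> x *\<^sub>R g x) = - (LINT x|lebesgue. \<phi> x *\<^sub>R h x))"

text \<open>The weak derivative is only determined almost everywhere; this picks a representative.\<close>

definition weak_deriv :: "'a::euclidean_space \<Rightarrow> ('a \<Rightarrow> complex) \<Rightarrow> 'a \<Rightarrow> complex" where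
  "weak_deriv b g = (SOME h. has_weak_deriv b g h)"


section \<open>Quadratic forms and their operators\<close>

text \<open>
  A form is given by its domain \<open>Q\<close> and a sesquilinear \<open>q\<close>, conjugate-linear in the first argument;
  the quadratic form is \<open>q \<psi> \<psi>\<close>. Operators are represented by their graphs.
\<close>

type_synonym 'a form = "'a L2 \<Rightarrow> 'a L2 \<Rightarrow> complex"
type_synonym 'a operator = "('a L2 \<times> 'a L2) set"

definition bounded_below_form :: "'a::euclidean_space L2 set \<Rightarrow> 'a form \<Rightarrow> bool" where
  "bounded_below_form Q q \<longleftrightarrow> (\<exists>c. \<forall>\<psi>\<in>Q. - c * (norm \<psi>)\<^sup>2 \<le> Re (q \<psi> \<psi>))"

definition closed_form :: "'a::euclidean_space L2 set \<Rightarrow> 'a form \<Rightarrow> bool" where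
  "closed_form Q q \<longleftrightarrow>
     (\<forall>s \<psi>. (\<forall>n. s n \<in> Q) \<and> s \<longlonglongrightarrow> \<psi> \<and>
        (\<forall>e>0. \<exists>N. \<forall>m\<ge>N. \<forall>n\<ge>N. cmod (q (s m - s n) (s m - s n)) < e) \<longrightarrow>
        \<psi> \<in> Q \<and> (\<lambda>n. q (s n - \<psi>) (s n - \<psi>)) \<longlonglongrightarrow> 0)"

text \<open>The operator associated with a form by the first representation theorem.\<close>

definition form_operator :: "'a::euclidean_space L2 set \<Rightarrow> 'a form \<Rightarrow> 'a operator" where
  "form_operator Q q = {(\<psi>, \<eta>). \<psi> \<in> Q \<and> (\<forall>\<phi>\<in>Q. q \<phi> \<psi> = cinner \<phi> \<eta>)}"

definition add_potential :: "'a::euclidean_space form \<Rightarrow> ('a \<Rightarrow> real) \<Rightarrow> 'a form" where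
  "add_potential q V \<phi> \<psi> =
     q \<phi> \<psi> + (LINT x|lebesgue. complex_of_real (V x) * (cnj (rep_L2 \<phi> x) * rep_L2 \<psi> x))"

definition form_sum_well_defined ::
  "'a::euclidean_space L2 set \<Rightarrow> 'a form \<Rightarrow> ('a \<Rightarrow> real) \<Rightarrow> bool" where
  "form_sum_well_defined Q q V \<longleftrightarrow>
     (\<forall>\<psi>\<in>Q. integrable lebesgue (\<lambda>x. V x * (cmod (rep_L2 \<psi> x))\<^sup>2)) \<and>
     bounded_below_form Q (add_potential q V) \<and> closed_form Q (add_potential q V)"


section \<open>Spectrum and spectral projections\<close>

text \<open>\<open>z\<close> is in the resolvent set iff \<open>T - z\<close> maps its domain bijectively onto \<open>L2\<close> with bounded inverse \<open>R\<close>.\<close>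

definition spectrum :: "'a::euclidean_space operator \<Rightarrow> complex set" where
  "spectrum T =
     {z. \<nexists>R. bounded_linear R \<and> (\<forall>\<psi> \<eta>. (\<psi>, \<eta> + z *\<^sub>C \<psi>) \<in> T \<longleftrightarrow> R \<eta> = \<psi>)}"

definition inf_spec :: "'a::euclidean_space operator \<Rightarrow> ereal" where
  "inf_spec T = (INF z\<in>spectrum T. ereal (Re z))"

definition orthogonal_projection :: "('a::euclidean_space L2 \<Rightarrow> 'a L2) \<Rightarrow> bool" where
  "orthogonal_projection P \<longleftrightarrow> Vector_Spaces.linear cscale cscale P \<and>
     (\<forall>\<psi>. P (P \<psi>) = P \<psi>) \<and> (\<forall>\<phi> \<psi>. cinner \<phi> (P \<psi>) = cinner (P \<phi>) \<psi>)"

text \<open>Resolutions of the identity, normalised to be right-continuous, so that \<open>E l\<close> belongs to \<open>{..l}\<close>.\<close>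

definition resolution_of_identity :: "(real \<Rightarrow> 'a::euclidean_space L2 \<Rightarrow> 'a L2) \<Rightarrow> bool" where
  "resolution_of_identity E \<longleftrightarrow>
     (\<forall>l. orthogonal_projection (E l)) \<and>
     (\<forall>l m \<psi>. E l (E m \<psi>) = E (min l m) \<psi>) \<and>
     (\<forall>l \<psi>. ((\<lambda>m. E m \<psi>) \<longlongrightarrow> E l \<psi>) (at_right l)) \<and>
     (\<forall>\<psi>. ((\<lambda>m. E m \<psi>) \<longlongrightarrow> 0) at_bot) \<and>
     (\<forall>\<psi>. ((\<lambda>m. E m \<psi>) \<longlongrightarrow> \<psi>) at_top)"

definition spectral_measure ::
  "(real \<Rightarrow> 'a::euclidean_space L2 \<Rightarrow> 'a L2) \<Rightarrow> 'a L2 \<Rightarrow> real measure" where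
  "spectral_measure E \<psi> = interval_measure (\<lambda>l. Re (cinner \<psi> (E l \<psi>)))"

text \<open>
  \<open>T = \<integral> \<lambda> dE\<^sub>\<lambda>\<close>. By polarisation the diagonal matrix elements determine the operator
  on its domain.
\<close>

definition spectral_resolution ::
  "'a::euclidean_space operator \<Rightarrow> (real \<Rightarrow> 'a L2 \<Rightarrow> 'a L2) \<Rightarrow> bool" where
  "spectral_resolution T E \<longleftrightarrow> resolution_of_identity E \<and>
     Domain T = {\<psi>. integrable (spectral_measure E \<psi>) (\<lambda>l. l\<^sup>2)} \<and>
     (\<forall>(\<psi>, \<eta>)\<in>T. cinner \<psi> \<eta> = complex_of_real (LINT l|spectral_measure E \<psi>. l))"

text \<open>
  The projection \<open>P\<^bsub>(-\<infinity>, l]\<^esub>(T)\<close>. By the spectral theorem a self-adjoint \<open>T\<close> has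
  exactly one spectral resolution.
\<close>

definition spectral_projection :: "'a::euclidean_space operator \<Rightarrow> real \<Rightarrow> 'a L2 \<Rightarrow> 'a L2" where
  "spectral_projection T = (SOME E. spectral_resolution T E)"

definition neg_eigenvalue :: "nat \<Rightarrow> 'a::euclidean_space operator \<Rightarrow> ereal" where
  "neg_eigenvalue j T = min 0 (INF l\<in>{l. cdim_ge (range (spectral_projection T l)) j}. ereal l)"


section \<open>Regular ground states and Schroedinger operators\<close>

definition laplacian :: "('a::euclidean_space \<Rightarrow> real) \<Rightarrow> 'a \<Rightarrow> real" where
  "laplacian f x = (\<Sum>b\<in>Basis. partial_deriv b (partial_deriv b f) x)"

text \<open>For \<open>V0 u0\<close> to be a distribution it has to be locally integrable.\<close>

definition regular_ground_state ::
  "('a::euclidean_space \<Rightarrow> real) \<Rightarrow> ('a \<Rightarrow> real) \<Rightarrow> bool" where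
  "regular_ground_state V0 u0 \<longleftrightarrow>
     continuous_on UNIV u0 \<and>
     (\<exists>c1 c2. 0 < c1 \<and> (\<forall>x. c1 \<le> u0 x \<and> u0 x \<le> c2)) \<and>
     locally_integrable (\<lambda>x. V0 x * u0 x) \<and>
     (\<forall>\<phi>. test_function \<phi> \<longrightarrow>
        (LINT x|lebesgue. u0 x * (- laplacian \<phi> x) + V0 x * u0 x * \<phi> x) = 0)"

definition ground_state_ratio :: "('a::euclidean_space \<Rightarrow> real) \<Rightarrow> real" where
  "ground_state_ratio u0 = ((SUP x. u0 x) / (INF x. u0 x))\<^sup>2"

definition weighted :: "('a::euclidean_space \<Rightarrow> real) \<Rightarrow> 'a measure" where
  "weighted u0 = density lebesgue (\<lambda>x. ennreal ((u0 x)\<^sup>2))"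

text \<open>The ground state representation: \<open>\<langle>g u0, H0 g u0\<rangle> = \<integral> |\<nabla>g|\<^sup>2 u0\<^sup>2\<close>.\<close>

definition ground_domain :: "('a::euclidean_space \<Rightarrow> real) \<Rightarrow> 'a L2 set" where
  "ground_domain u0 =
     {abs_L2 (\<lambda>x. g x * complex_of_real (u0 x)) | g.
        sq_integrable (weighted u0) g \<and>
        (\<forall>b\<in>Basis. \<exists>h. has_weak_deriv b g h \<and> sq_integrable (weighted u0) h)}"

definition ground_form :: "('a::euclidean_space \<Rightarrow> real) \<Rightarrow> 'a form" where
  "ground_form u0 \<phi> \<psi> =
     (\<Sum>b\<in>Basis. LINT x|weighted u0.
        cnj (weak_deriv b (\<lambda>y. rep_L2 \<phi> y / complex_of_real (u0 y)) x) *
        weak_deriv b (\<lambda>y. rep_L2 \<psi> y / complex_of_real (u0 y)) x)"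

definition H1 :: "'a::euclidean_space L2 set" where
  "H1 = {\<psi>. \<forall>b\<in>Basis. \<exists>h. has_weak_deriv b (rep_L2 \<psi>) h \<and> sq_integrable lebesgue h}"

definition dirichlet_form :: "'a::euclidean_space form" where
  "dirichlet_form \<phi> \<psi> =
     (\<Sum>b\<in>Basis. LINT x|lebesgue. cnj (weak_deriv b (rep_L2 \<phi>) x) * weak_deriv b (rep_L2 \<psi>) x)"

text \<open>
  \<open>H0 = -\<Delta> + V0\<close> is the operator of the ground state representation, so \<open>V0\<close> enters only
  through its ground state \<open>u0\<close>.
\<close>

definition ground_hamiltonian :: "('a::euclidean_space \<Rightarrow> real) \<Rightarrow> 'a operator" where
  "ground_hamiltonian u0 = form_operator (ground_domain u0) (ground_form u0)"

definition perturbed_hamiltonian ::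
  "('a::euclidean_space \<Rightarrow> real) \<Rightarrow> ('a \<Rightarrow> real) \<Rightarrow> 'a operator" where
  "perturbed_hamiltonian u0 V =
     form_operator (ground_domain u0) (add_potential (ground_form u0) V)"

definition schroedinger :: "('a::euclidean_space \<Rightarrow> real) \<Rightarrow> 'a operator" where
  "schroedinger W = form_operator H1 (add_potential dirichlet_form W)"

end

theory Submission
  imports Defs "HOL-Probability.Helly_Selection"
begin

text \<open>
  The map \<open>J g = g u0\<close> is a bijection from \<open>H1\<close> onto the form domain of \<open>H0\<close>. With
  \<open>c1 = inf u0\<close> and \<open>c2 = sup u0\<close> the ground state representation gives
  \<open>c1\<^sup>2 \<integral>|\<nabla>g|\<^sup>2 \<le> \<langle>J g, H0 J g\<rangle> \<le> c2\<^sup>2 \<integral>|\<nabla>g|\<^sup>2\<close>, and likewise for the norms and for the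
  potential energies, the latter with \<open>c1\<close> and \<open>c2\<close> exchanged because \<open>V \<le> 0\<close>. Hence the
  forms of \<open>-\<Delta> + V / \<beta>\<close>, \<open>H0 + V\<close> and \<open>-\<Delta> + \<beta> V\<close> are comparable on negative energies, and
  the inequality between the eigenvalues is the min-max principle.

  The min-max principle needs the spectral theorem for the operator \<open>T\<close> of a closed semibounded
  form. The variational solution of \<open>T \<psi> + c \<psi> = \<eta>\<close> yields a bounded injective operator
  \<open>0 \<le> R \<le> 1\<close>. The numbers \<open>\<langle>\<psi>, R\<^sup>k \<psi>\<rangle>\<close> are the moments of a measure \<open>\<mu>\<close> on \<open>[0, 1]\<close> (Hausdorff),
  obtained as a weak limit of discrete measures with Bernstein weights. Dominated convergence for
  \<open>\<mu>\<close> extends polynomials in \<open>R\<close> to bounded pointwise limits of polynomials, among them the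
  indicators of \<open>{t. 1 \<le> t (l + c)}\<close>, which are the spectral projections \<open>E l\<close> of \<open>T = R\<^sup>-\<^sup>1 - c\<close>.
\<close>

section \<open>The Hausdorff moment problem\<close>

text \<open>A \<open>spectral_resolution\<close> is pinned down by diagonal data only: the domain of
  the operator and the numbers \<open>cinner \<psi> \<eta>\<close> for
  \<open>(\<psi>, \<eta>)\<close> in its graph. That the form splits along the spectral subspaces is
  not among these data and has to be recovered from the scalar measures, by additivity of the energy
  and polarisation. The operator domain is moreover smaller than the form domain on which the
  eigenvalues are compared; the lower bound survives the passage to the limit because the tail costs
  at most a constant times its vanishing squared norm. \<open>L2\<close> is complex, but its type
  class structure is that of a real inner product space with \<open>inner = Re cinner\<close>. The
  functional calculus uses the real structure alone; the complex one is recovered by testing with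
  \<open>\<i>\<close> and from the fact that the resolvent commutes with complex scalars. Negative
  levels are singled out because the bounds between the norms of \<open>g\<close> and
  \<open>g u0\<close>, multiplied by \<open>l\<close>, point in the required direction only for
  \<open>l < 0\<close>.\<close>

lemma borel_measurable_poly [measurable (raw)]:
  fixes f :: "'b \<Rightarrow> real"
  assumes [measurable]: "f \<in> borel_measurable M"
  shows "(\<lambda>x. poly p (f x)) \<in> borel_measurable M"
  unfolding poly_altdef by measurable

text \<open>Factorial moments of the binomial distribution: choosing \<open>i\<close> of
  \<open>n\<close> and \<open>k\<close> of these \<open>i\<close> is choosing \<open>k\<close> of
  \<open>n\<close> and \<open>i - k\<close> of the rest, so the binomial theorem with exponent
  \<open>n - k\<close> applies. The setting of a commutative ring allows \<open>x\<close> and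
  \<open>y\<close> to be the polynomials \<open>X\<close> and \<open>1 - X\<close>.\<close>

lemma binomial_moment:
  fixes x y :: "'a::comm_ring_1"
  assumes xy: "x + y = 1" and kn: "k \<le> n"
  shows "(\<Sum>i\<le>n. of_nat ((n choose i) * (i choose k)) * x ^ i * y ^ (n - i)) = of_nat (n choose k) * x ^ k"
proof -
  have "(\<Sum>i\<le>n. of_nat ((n choose i) * (i choose k)) * x ^ i * y ^ (n - i)) =
      (\<Sum>i\<in>{k..n}. of_nat ((n choose i) * (i choose k)) * x ^ i * y ^ (n - i))"
    by (rule sum.mono_neutral_right) (auto simp: not_le binomial_eq_0)
  also have "\<dots> = (\<Sum>j\<le>n - k. of_nat ((n choose k) * ((n - k) choose j)) * x ^ (j + k) * y ^ (n - k - j))"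
    by (rule sum.reindex_bij_witness[where i = "\<lambda>j. j + k" and j = "\<lambda>i. i - k"])
       (use kn in \<open>auto simp: choose_mult simp del: of_nat_mult\<close>)
  also have "\<dots> = of_nat (n choose k) * x ^ k * (\<Sum>j\<le>n - k. of_nat ((n - k) choose j) * x ^ j * y ^ (n - k - j))"
    by (simp add: sum_distrib_left power_add algebra_simps)
  also have "(\<Sum>j\<le>n - k. of_nat ((n - k) choose j) * x ^ j * y ^ (n - k - j)) = 1"
    using binomial_ring[of x y "n - k"] xy by simp
  finally show ?thesis by simp
qed

text \<open>Sampling without replacement approaches sampling with replacement, uniformly in
  \<open>i\<close>: passing from \<open>k\<close> to \<open>k + 1\<close> multiplies the ratio by
  \<open>(i - k) / (n - k)\<close>, which differs from \<open>i / n\<close> by at most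
  \<open>k / (n - k)\<close>.\<close>

lemma binomial_ratio_approx:
  fixes e :: real
  assumes "0 < e"
  shows "\<exists>N. \<forall>n\<ge>N. \<forall>i\<le>n. \<bar>real (i choose k) / real (n choose k) - (real i / real n) ^ k\<bar> < e"
  using assms
proof (induction k arbitrary: e)
  case 0
  then show ?case by simp
next
  case (Suc k)
  obtain N where N: "\<And>n i. n \<ge> N \<Longrightarrow> i \<le> n \<Longrightarrow>
      \<bar>real (i choose k) / real (n choose k) - (real i / real n) ^ k\<bar> < e/2"
    using Suc.IH[of "e/2"] Suc.prems by auto
  \<comment> \<open>Chosen so that \<open>k / (n - k) < e / 2\<close> as soon as
    \<open>n - k \<ge> N'\<close>.\<close>
  obtain N' where N': "real N' > 2 * real k / e" using reals_Archimedean2 by blast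
  show ?case
  proof (intro exI[of _ "N + N' + k + 1"] allI impI)
    fix n i assume n: "N + N' + k + 1 \<le> n" and i: "i \<le> n"
    define r where "r = real (i choose k) / real (n choose k)"
    define t where "t = real i / real n"
    \<comment> \<open>For \<open>m < k\<close> the last factor is negative, but both sides are
      zero.\<close>
    have step: "real (m choose Suc k) = real (m choose k) * (real m - real k) / real (Suc k)" for m
    proof (cases "k \<le> m")
      case True
      have "Suc k * (m choose Suc k) = (m - k) * (m choose k)"
        by (metis binomial_absorb_comp binomial_absorption mult.commute)
      then have "real (Suc k) * real (m choose Suc k) = (real m - real k) * real (m choose k)"
        using True by (metis of_nat_diff of_nat_mult)
      then show ?thesis by (simp add: field_simps)
    qed (simp add: binomial_eq_0 not_le)
    have nk: "real n - real k > 0" using n by simp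
    have Suc_eq: "real (i choose Suc k) / real (n choose Suc k) = r * ((real i - real k) / (real n - real k))"
      unfolding r_def step by (simp add: divide_simps)
    have r: "0 \<le> r" "r \<le> 1"
      using i n binomial_right_mono[of i n k] by (auto simp: r_def divide_simps)
    have t: "0 \<le> t" "t \<le> 1" using i n by (auto simp: t_def divide_simps)
    have "(real i - real k) / (real n - real k) - t = - (real k * (real n - real i) / (real n * (real n - real k)))"
      using nk n by (simp add: t_def divide_simps) (simp add: algebra_simps)
    also have "\<bar>\<dots>\<bar> = real k * (real n - real i) / (real n * (real n - real k))"
      using nk i by simp
    also have "\<dots> \<le> real k * real n / (real n * (real n - real k))"
      using nk i by (intro divide_right_mono mult_left_mono) auto
    also have "\<dots> = real k / (real n - real k)" using n by simp
    also have "\<dots> < e / 2"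
    proof -
      have "2 * real k < e * real N'" using N' Suc.prems by (simp add: field_simps)
      also have "\<dots> \<le> e * (real n - real k)" using n Suc.prems by (intro mult_left_mono) auto
      finally show ?thesis using nk by (simp add: field_simps)
    qed
    finally have B: "\<bar>(real i - real k) / (real n - real k) - t\<bar> < e/2" .
    have A: "\<bar>r - t ^ k\<bar> < e/2" using N[of n i] n i by (simp add: r_def t_def)
    have "\<bar>r * ((real i - real k) / (real n - real k)) - t ^ Suc k\<bar> =
      \<bar>r * ((real i - real k) / (real n - real k) - t) + t * (r - t ^ k)\<bar>"
      by (simp add: algebra_simps)
    also have "\<dots> \<le> r * \<bar>(real i - real k) / (real n - real k) - t\<bar> + t * \<bar>r - t ^ k\<bar>"
      using r t by (intro order_trans[OF abs_triangle_ineq]) (simp add: abs_mult)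
    also have "\<dots> \<le> 1 * \<bar>(real i - real k) / (real n - real k) - t\<bar> + 1 * \<bar>r - t ^ k\<bar>"
      using r t by (intro add_mono mult_right_mono) auto
    also have "\<dots> < e" using A B by simp
    finally show "\<bar>real (i choose Suc k) / real (n choose Suc k) - (real i / real n) ^ Suc k\<bar> < e"
      unfolding Suc_eq t_def .
  qed
qed

text \<open>\<open>L\<close> is a candidate for integration against a measure on
  \<open>[0, 1]\<close>. Nonnegativity on \<open>X^i (1 - X)^m\<close> is Hausdorff's complete
  monotonicity of the moments \<open>L (X^k)\<close>.\<close>

locale positive_poly_functional =
  fixes L :: "real poly \<Rightarrow> real"
  assumes L_add: "L (p + q) = L p + L q"
    and L_smult: "L (smult c p) = c * L p"
    and L_Bernstein_nonneg: "0 \<le> L ([:0, 1:] ^ i * [:1, - 1:] ^ m)"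
begin

lemma L_0: "L 0 = 0"
  using L_smult[of 0 0] by simp

lemma L_sum: "L (\<Sum>i\<in>I. f i) = (\<Sum>i\<in>I. L (f i))"
  by (induction I rule: infinite_finite_induct) (auto simp: L_0 L_add)

text \<open>The value of \<open>L\<close> at the Bernstein polynomial of index \<open>i\<close> and
  degree \<open>n\<close>, used as the mass at the point \<open>i / n\<close>.\<close>

definition w :: "nat \<Rightarrow> nat \<Rightarrow> real" where
  "w n i = real (n choose i) * L ([:0, 1:] ^ i * [:1, - 1:] ^ (n - i))"

lemma w_nonneg: "0 \<le> w n i"
  by (simp add: w_def L_Bernstein_nonneg)

text \<open>Applying \<open>L\<close> to the binomial identity for \<open>X\<close> and
  \<open>1 - X\<close> shows that the weights reproduce the moments exactly, with binomial ratios in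
  place of the powers \<open>(i / n)^k\<close>.\<close>

lemma L_power: "k \<le> n \<Longrightarrow> L ([:0, 1:] ^ k) = (\<Sum>i\<le>n. real (i choose k) / real (n choose k) * w n i)"
proof -
  assume k: "k \<le> n"
  have "real (n choose k) * L ([:0, 1:] ^ k) = L (of_nat (n choose k) * [:0, 1:] ^ k)"
    by (simp add: of_nat_poly L_smult)
  also have "\<dots> = L (\<Sum>i\<le>n. of_nat ((n choose i) * (i choose k)) * [:0,1:] ^ i * [:1,-1:] ^ (n - i))"
    by (subst binomial_moment) (auto simp: k one_pCons)
  also have "\<dots> = (\<Sum>i\<le>n. real (i choose k) * w n i)"
    unfolding L_sum by (intro sum.cong refl) (simp add: w_def of_nat_poly L_smult)
  finally show ?thesis
    using k by (simp add: sum_divide_distrib[symmetric] field_simps)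
qed

lemma sum_w: "(\<Sum>i\<le>n. w n i) = L 1"
  using L_power[of 0 n] by simp

lemma poly_expand: "p = (\<Sum>k\<le>degree p. smult (coeff p k) ([:0, 1:] ^ k))"
  using poly_as_sum_of_monoms[of p] by (simp add: monom_altdef)

text \<open>Replacing the exact binomial ratios by powers of \<open>i / n\<close> changes the sum by
  at most the uniform error of the ratios times the total mass \<open>L 1\<close>.\<close>

lemma Riemann_sums:
  "(\<lambda>n. \<Sum>i\<le>n. w n i * poly p (real i / real n)) \<longlonglongrightarrow> L p"
proof -
  have mono: "(\<lambda>n. \<Sum>i\<le>n. w n i * (real i / real n) ^ k) \<longlonglongrightarrow> L ([:0, 1:] ^ k)" for k
  proof (rule LIMSEQ_I)
    fix e :: real assume e: "e > 0"
    have L1: "0 \<le> L 1" using L_Bernstein_nonneg[of 0 0] by simp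
    \<comment> \<open>\<open>L 1\<close> may vanish, hence the added 1.\<close>
    define d where "d = e / (L 1 + 1)"
    have d: "d > 0" using e L1 by (auto simp: d_def)
    obtain N where N: "\<And>n i. n \<ge> N \<Longrightarrow> i \<le> n \<Longrightarrow>
        \<bar>real (i choose k) / real (n choose k) - (real i / real n) ^ k\<bar> < d"
      using binomial_ratio_approx[OF d, of k] by blast
    show "\<exists>N. \<forall>n\<ge>N. norm ((\<Sum>i\<le>n. w n i * (real i / real n) ^ k) - L ([:0, 1:] ^ k)) < e"
    proof (intro exI[of _ "N + k"] allI impI)
      fix n assume n: "N + k \<le> n"
      have "norm ((\<Sum>i\<le>n. w n i * (real i / real n) ^ k) - L ([:0, 1:] ^ k)) =
        \<bar>\<Sum>i\<le>n. w n i * ((real i / real n) ^ k - real (i choose k) / real (n choose k))\<bar>"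
        using n by (subst L_power[of k n]) (auto simp: sum_subtractf[symmetric] algebra_simps)
      also have "\<dots> \<le> (\<Sum>i\<le>n. w n i * d)"
      proof (rule order_trans[OF sum_abs sum_mono])
        fix i assume "i \<in> {..n}"
        then have "\<bar>(real i / real n) ^ k - real (i choose k) / real (n choose k)\<bar> \<le> d"
          using N[of n i] n by (simp add: abs_minus_commute less_imp_le)
        then show "\<bar>w n i * ((real i / real n) ^ k - real (i choose k) / real (n choose k))\<bar> \<le> w n i * d"
          by (simp add: abs_mult w_nonneg mult_left_mono)
      qed
      also have "\<dots> = L 1 * d" by (simp add: sum_distrib_right[symmetric] sum_w)
      also have "\<dots> < e" using L1 e by (simp add: d_def field_simps)
      finally show "norm ((\<Sum>i\<le>n. w n i * (real i / real n) ^ k) - L ([:0, 1:] ^ k)) < e" .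
    qed
  qed
  have "(\<lambda>n. \<Sum>k\<le>degree p. coeff p k * (\<Sum>i\<le>n. w n i * (real i / real n) ^ k)) \<longlonglongrightarrow>
      (\<Sum>k\<le>degree p. coeff p k * L ([:0, 1:] ^ k))"
    by (intro tendsto_intros mono)
  also have "(\<Sum>k\<le>degree p. coeff p k * L ([:0, 1:] ^ k)) = L p"
    by (subst (3) poly_expand[of p]) (simp add: L_sum L_smult)
  also have "(\<lambda>n. \<Sum>k\<le>degree p. coeff p k * (\<Sum>i\<le>n. w n i * (real i / real n) ^ k)) =
     (\<lambda>n. \<Sum>i\<le>n. w n i * poly p (real i / real n))"
  proof
    fix n
    show "(\<Sum>k\<le>degree p. coeff p k * (\<Sum>i\<le>n. w n i * (real i / real n) ^ k)) =
       (\<Sum>i\<le>n. w n i * poly p (real i / real n))"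
      unfolding poly_altdef sum_distrib_left
      by (subst sum.swap) (simp add: mult_ac)
  qed
  finally show ?thesis .
qed

lemma Hausdorff_moment_prob:
  assumes L1: "L 1 = 1"
  shows "\<exists>M. real_distribution M \<and> (AE x in M. 0 \<le> x \<and> x \<le> 1) \<and> (\<forall>p. (LINT x|M. poly p x) = L p)"
proof -
  define \<mu> where "\<mu> n = distr (point_measure {..n} (\<lambda>i. ennreal (w n i))) borel (\<lambda>i. real i / real n)" for n
  have prob0: "prob_space (point_measure {..n} (\<lambda>i. ennreal (w n i)))" for n
  proof
    show "emeasure (point_measure {..n} (\<lambda>i. ennreal (w n i))) (space (point_measure {..n} (\<lambda>i. ennreal (w n i)))) = 1"
      by (simp add: space_point_measure emeasure_point_measure_finite w_nonneg sum_ennreal sum_w L1)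
  qed
  have rd: "real_distribution (\<mu> n)" for n
    unfolding \<mu>_def by (rule prob_space.real_distribution_distr[OF prob0]) simp
  have int: "integral\<^sup>L (\<mu> n) f = (\<Sum>i\<le>n. w n i * f (real i / real n))"
    if [measurable]: "f \<in> borel_measurable borel" for f :: "real \<Rightarrow> real" and n
    unfolding \<mu>_def by (subst integral_distr) (auto simp: lebesgue_integral_point_measure_finite w_nonneg)
  \<comment> \<open>Tightness is phrased with left-open intervals, so the left end has to lie
    strictly below the possible atom at 0.\<close>
  have "measure (\<mu> n) {-1<..1} = 1" for n
  proof -
    have "measure (\<mu> n) {-1<..1} = integral\<^sup>L (\<mu> n) (indicator {-1<..1})"
      by (simp add: \<mu>_def)
    also have "\<dots> = (\<Sum>i\<le>n. w n i)"
      by (subst int) (auto intro!: sum.cong simp: indicator_def divide_simps)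
    finally show ?thesis by (simp add: sum_w L1)
  qed
  then have "tight \<mu>"
    unfolding tight_def using rd
    by (intro conjI allI impI exI[of _ "-1"] exI[of _ 1]) auto
  then obtain r M where r: "strict_mono (r :: nat \<Rightarrow> nat)" and M: "real_distribution M"
      and conv: "weak_conv_m (\<mu> \<circ> id \<circ> r) M"
    using tight_imp_convergent_subsubsequence[of \<mu> id] by (auto simp: strict_mono_id)
  interpret M: real_distribution M by fact
  \<comment> \<open>Weak convergence tests bounded continuous functions on the whole line. Clamping
    to \<open>[0, 1]\<close> turns a polynomial into such a function without changing its values at
    the points \<open>i / n\<close>. The final measure is the image of \<open>M\<close> under the
    clamp, which makes its support evident.\<close>
  define cl where "cl x = max 0 (min 1 x)" for x :: real
  have cl_cont: "isCont cl x" for x unfolding cl_def by (intro continuous_intros)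
  have [measurable]: "cl \<in> borel_measurable borel"
    unfolding cl_def by measurable
  have "(LINT x|M. poly p (cl x)) = L p" for p
  proof -
    have "compact (poly p ` {0..1})" by (intro compact_continuous_image continuous_intros) auto
    then obtain B where B: "\<And>x. x \<in> {0..1} \<Longrightarrow> norm (poly p x) \<le> B"
      by (metis bounded_iff compact_imp_bounded imageI)
    have "(\<lambda>n. integral\<^sup>L ((\<mu> \<circ> id \<circ> r) n) (\<lambda>x. poly p (cl x))) \<longlonglongrightarrow> (LINT x|M. poly p (cl x))"
    proof (rule weak_conv_imp_integral_bdd_continuous_conv[OF _ M conv])
      show "real_distribution ((\<mu> \<circ> id \<circ> r) n)" for n using rd by simp
      show "isCont (\<lambda>x. poly p (cl x)) x" for x
        by (intro continuous_intros cl_cont)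
      show "norm (poly p (cl x)) \<le> B" for x by (rule B) (auto simp: cl_def)
    qed
    moreover have "(\<lambda>n. integral\<^sup>L ((\<mu> \<circ> id \<circ> r) n) (\<lambda>x. poly p (cl x))) =
        (\<lambda>n. \<Sum>i\<le>n. w n i * poly p (real i / real n)) \<circ> r"
    proof
      fix n
      have "integral\<^sup>L (\<mu> (r n)) (\<lambda>x. poly p (cl x)) =
          (\<Sum>i\<le>r n. w (r n) i * poly p (cl (real i / real (r n))))"
        by (rule int) measurable
      also have "\<dots> = (\<Sum>i\<le>r n. w (r n) i * poly p (real i / real (r n)))"
      proof (rule sum.cong[OF refl])
        fix i assume "i \<in> {..r n}"
        then have "0 \<le> real i / real (r n)" "real i / real (r n) \<le> 1" by (auto simp: divide_simps)
        then have "cl (real i / real (r n)) = real i / real (r n)" unfolding cl_def by linarith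
        then show "w (r n) i * poly p (cl (real i / real (r n))) = w (r n) i * poly p (real i / real (r n))" by simp
      qed
      finally show "integral\<^sup>L ((\<mu> \<circ> id \<circ> r) n) (\<lambda>x. poly p (cl x)) =
        ((\<lambda>n. \<Sum>i\<le>n. w n i * poly p (real i / real n)) \<circ> r) n" by simp
    qed
    ultimately have "((\<lambda>n. \<Sum>i\<le>n. w n i * poly p (real i / real n)) \<circ> r) \<longlonglongrightarrow> (LINT x|M. poly p (cl x))"
      by simp
    then show ?thesis
      by (rule LIMSEQ_unique[OF _ LIMSEQ_subseq_LIMSEQ[OF Riemann_sums r]])
  qed
  then show ?thesis
    by (intro exI[of _ "distr M borel cl"])
       (auto simp: integral_distr AE_distr_iff cl_def intro!: M.real_distribution_distr)
qed

text \<open>Helly selection concerns probability measures, so \<open>L\<close> is normalised by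
  \<open>L 1\<close>. If \<open>L 1 = 0\<close>, then all weights vanish and with them
  \<open>L\<close>.\<close>

theorem Hausdorff_moment:
  "\<exists>M. finite_measure M \<and> sets M = sets borel \<and> (AE x in M. 0 \<le> x \<and> x \<le> 1) \<and> (\<forall>p. (LINT x|M. poly p x) = L p)"
proof (cases "L 1 = 0")
  case True
  have w0: "w n i = 0" if "i \<le> n" for n i
    using sum_w[of n] True w_nonneg that by (simp add: sum_nonneg_eq_0_iff)
  have "L ([:0,1:] ^ k) = 0" for k by (subst L_power[of k k]) (auto simp: w0)
  then have "L p = 0" for p by (subst poly_expand) (simp add: L_sum L_smult)
  moreover have "finite_measure (null_measure borel)" by (auto intro: finite_measureI)
  ultimately show ?thesis
    by (intro exI[of _ "null_measure borel"]) (auto intro!: AE_I[of _ _ UNIV])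
next
  case False
  then have L1: "L 1 > 0" using L_Bernstein_nonneg[of 0 0] by simp
  interpret L': positive_poly_functional "\<lambda>p. L p / L 1"
    using L1 by unfold_locales (auto simp: L_add L_smult add_divide_distrib L_Bernstein_nonneg)
  obtain M where M: "real_distribution M" and AE: "AE x in M. 0 \<le> x \<and> x \<le> 1"
     and eq: "\<And>p. (LINT x|M. poly p x) = L p / L 1"
    using L'.Hausdorff_moment_prob L1 by auto
  interpret M: real_distribution M by fact
  let ?M = "density M (\<lambda>_. ennreal (L 1))"
  have "finite_measure ?M"
    by (rule finite_measureI) (simp add: emeasure_density ennreal_mult_eq_top_iff M.emeasure_eq_measure)
  moreover have "(LINT x|?M. poly p x) = L p" for p
    using L1 by (subst integral_density) (auto simp: eq)
  moreover have "AE x in ?M. 0 \<le> x \<and> x \<le> 1"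
    using AE by (subst AE_density) auto
  ultimately show ?thesis by (intro exI[of _ ?M]) auto
qed

end

section \<open>Functional calculus of a positive contraction\<close>

text \<open>Serves both completeness arguments: approximation in \<open>L2\<close> of a measure,
  where \<open>e n\<close> is the squared distance to the limit function, and minimising sequences,
  where \<open>e n\<close> bounds the excess over the infimum.\<close>

lemma convergent_if_sq_dist_le:
  fixes X :: "nat \<Rightarrow> 'h::{real_normed_vector, complete_space}"
  assumes le: "\<And>m n. (norm (X m - X n))\<^sup>2 \<le> 2 * e m + 2 * e n" and e: "e \<longlonglongrightarrow> 0"
  shows "convergent X"
proof -
  have "Cauchy X"
  proof (rule CauchyI)
    fix r :: real assume r: "0 < r"
    then have "r\<^sup>2 / 4 > 0" by simp
    with e obtain N where N: "\<And>n. n \<ge> N \<Longrightarrow> \<bar>e n\<bar> < r\<^sup>2 / 4"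
      by (metis LIMSEQ_D diff_zero real_norm_def)
    show "\<exists>M. \<forall>m\<ge>M. \<forall>n\<ge>M. norm (X m - X n) < r"
    proof (intro exI[of _ N] allI impI)
      fix m n assume "N \<le> m" "N \<le> n"
      then have "(norm (X m - X n))\<^sup>2 < r\<^sup>2"
        using le[of m n] N[of m] N[of n] by (simp add: abs_less_iff)
      then show "norm (X m - X n) < r" using r by (simp add: power_less_imp_less_base)
    qed
  qed
  then show ?thesis by (rule Cauchy_convergent)
qed

lemma Weierstrass_poly:
  fixes f :: "real \<Rightarrow> real"
  assumes f: "continuous_on {0..1} f" and e: "0 < e"
  shows "\<exists>p. \<forall>x\<in>{0..1}. \<bar>f x - poly p x\<bar> < e"
proof -
  obtain n where n: "\<And>x. x \<in> {0..1} \<Longrightarrow> \<bar>f x - (\<Sum>k\<le>n. f (k / n) * Bernstein n k x)\<bar> < e"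
    using Bernstein_Weierstrass[OF f e] by blast
  let ?p = "\<Sum>k\<le>n. smult (f (k / n) * real (n choose k)) ([:0, 1:] ^ k * [:1, - 1:] ^ (n - k))"
  have "poly ?p x = (\<Sum>k\<le>n. f (k / n) * Bernstein n k x)" for x
    by (simp add: poly_sum Bernstein_def mult_ac)
  with n show ?thesis by (intro exI[of _ ?p]) simp
qed

text \<open>Carries convergence from \<open>L2\<close> of \<open>M\<close> to an abstract Hilbert
  space along an isometry. The limit \<open>g\<close> exists only as a function;
  \<open>(a - b)^2 \<le> 2 a^2 + 2 b^2\<close> and dominated convergence give the Cauchy
  property.\<close>

lemma convergent_if_L2_approx:
  fixes X :: "nat \<Rightarrow> 'h::{real_normed_vector, complete_space}" and f :: "nat \<Rightarrow> 'b \<Rightarrow> real"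
  assumes norm: "\<And>m n. (norm (X m - X n))\<^sup>2 = (LINT t|M. (f m t - f n t)\<^sup>2)"
    and int: "\<And>m n. integrable M (\<lambda>t. (f m t - f n t)\<^sup>2)" and g: "g \<in> borel_measurable M"
    and f: "\<And>n. f n \<in> borel_measurable M" and w: "integrable M w"
    and lim: "AE t in M. (\<lambda>n. f n t) \<longlonglongrightarrow> g t" and bound: "\<And>n. AE t in M. (f n t - g t)\<^sup>2 \<le> w t"
  shows "convergent X"
proof -
  define e where "e n = (LINT t|M. (f n t - g t)\<^sup>2)" for n
  have "e \<longlonglongrightarrow> (LINT t|M. 0)"
    unfolding e_def
  proof (rule integral_dominated_convergence[OF _ _ w])
    show "AE t in M. (\<lambda>n. (f n t - g t)\<^sup>2) \<longlonglongrightarrow> 0"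
      using lim
    proof eventually_elim
      case (elim t)
      then have "(\<lambda>n. (f n t - g t)\<^sup>2) \<longlonglongrightarrow> (g t - g t)\<^sup>2" by (intro tendsto_intros)
      then show ?case by simp
    qed
  qed (use f g bound in auto)
  then have e: "e \<longlonglongrightarrow> 0" by simp
  have int': "integrable M (\<lambda>t. (f n t - g t)\<^sup>2)" for n
    by (rule Bochner_Integration.integrable_bound[OF w]) (use f g bound[of n] in \<open>auto elim: eventually_mono\<close>)
  show ?thesis
  proof (rule convergent_if_sq_dist_le[OF _ e])
    fix m n
    have "(LINT t|M. (f m t - f n t)\<^sup>2) \<le> (LINT t|M. 2 * (f m t - g t)\<^sup>2 + 2 * (f n t - g t)\<^sup>2)"
    proof (rule integral_mono[OF int])
      fix t
      have "0 \<le> ((f m t - g t) + (f n t - g t))\<^sup>2" by simp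
      then show "(f m t - f n t)\<^sup>2 \<le> 2 * (f m t - g t)\<^sup>2 + 2 * (f n t - g t)\<^sup>2"
        by (simp add: power2_eq_square algebra_simps)
    qed (use int' in auto)
    then show "(norm (X m - X n))\<^sup>2 \<le> 2 * e m + 2 * e n" using int' by (simp add: norm e_def)
  qed
qed

section \<open>Bounded pointwise limits of polynomials on \<open>[0, 1]\<close>\<close>

definition poly_approx :: "(nat \<Rightarrow> real poly) \<Rightarrow> (real \<Rightarrow> real) \<Rightarrow> bool" where
  "poly_approx p f \<longleftrightarrow> f \<in> borel_measurable borel \<and>
     (\<exists>C. \<forall>n. \<forall>x\<in>{0..1}. \<bar>poly (p n) x\<bar> \<le> C) \<and> (\<forall>x\<in>{0..1}. (\<lambda>n. poly (p n) x) \<longlonglongrightarrow> f x)"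

text \<open>Bounded pointwise convergence takes the place of uniform convergence: it admits
  discontinuous limits such as indicators, and dominated convergence still applies to every finite
  measure on \<open>[0, 1]\<close>.\<close>

definition poly_limit :: "(real \<Rightarrow> real) \<Rightarrow> bool" where
  "poly_limit f \<longleftrightarrow> (\<exists>p. poly_approx p f)"

lemma poly_bounded_01: "\<exists>C. \<forall>x\<in>{0..1}. \<bar>poly p x\<bar> \<le> (C::real)"
proof -
  have "compact (poly p ` {0..1})" by (intro compact_continuous_image continuous_intros) auto
  then show ?thesis by (metis bounded_iff compact_imp_bounded imageI real_norm_def)
qed

lemma poly_approx_const: "poly_approx (\<lambda>_. p) (poly p)"
  using poly_bounded_01[of p] by (auto simp: poly_approx_def)

lemma poly_approx_mult:
  assumes "poly_approx p f" "poly_approx q g"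
  shows "poly_approx (\<lambda>n. p n * q n) (\<lambda>x. f x * g x)"
proof -
  obtain C D where C: "\<And>n x. x \<in> {0..1} \<Longrightarrow> \<bar>poly (p n) x\<bar> \<le> C" and D: "\<And>n x. x \<in> {0..1} \<Longrightarrow> \<bar>poly (q n) x\<bar> \<le> D"
    using assms unfolding poly_approx_def by blast
  have "\<bar>poly (p n * q n) x\<bar> \<le> C * D" if "x \<in> {0..1}" for n x
    unfolding poly_mult abs_mult using C[OF that] D[OF that]
    by (intro mult_mono) (auto intro: order_trans[OF abs_ge_zero])
  then have "\<exists>C. \<forall>n. \<forall>x\<in>{0..1}. \<bar>poly (p n * q n) x\<bar> \<le> C" by blast
  then show ?thesis
    using assms unfolding poly_approx_def by (simp add: tendsto_mult borel_measurable_times)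
qed

lemma poly_approx_diff:
  assumes "poly_approx p f" "poly_approx q g"
  shows "poly_approx (\<lambda>n. p n - q n) (\<lambda>x. f x - g x)"
proof -
  obtain C D where C: "\<And>n x. x \<in> {0..1} \<Longrightarrow> \<bar>poly (p n) x\<bar> \<le> C" and D: "\<And>n x. x \<in> {0..1} \<Longrightarrow> \<bar>poly (q n) x\<bar> \<le> D"
    using assms unfolding poly_approx_def by blast
  have "\<bar>poly (p n - q n) x\<bar> \<le> C + D" if "x \<in> {0..1}" for n x
    using C[OF that, of n] D[OF that, of n] by simp
  then have "\<exists>C. \<forall>n. \<forall>x\<in>{0..1}. \<bar>poly (p n - q n) x\<bar> \<le> C" by blast
  then show ?thesis
    using assms unfolding poly_approx_def by (simp add: tendsto_diff borel_measurable_diff)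
qed

lemma poly_approx_cong:
  assumes "poly_approx p f" "\<And>x. x \<in> {0..1} \<Longrightarrow> f x = g x" "g \<in> borel_measurable borel"
  shows "poly_approx p g"
  using assms unfolding poly_approx_def by auto

lemma poly_limit_cong:
  assumes "poly_limit f" "\<And>x. x \<in> {0..1} \<Longrightarrow> f x = g x" "g \<in> borel_measurable borel"
  shows "poly_limit g"
  using assms poly_approx_cong unfolding poly_limit_def by metis

lemma poly_limit_mult: "poly_limit f \<Longrightarrow> poly_limit g \<Longrightarrow> poly_limit (\<lambda>x. f x * g x)"
  unfolding poly_limit_def using poly_approx_mult by blast

lemma poly_limit_diff: "poly_limit f \<Longrightarrow> poly_limit g \<Longrightarrow> poly_limit (\<lambda>x. f x - g x)"
  unfolding poly_limit_def using poly_approx_diff by blast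

lemma poly_limit_poly: "poly_limit (poly p)"
  unfolding poly_limit_def using poly_approx_const by blast

lemma poly_limit_measurable: "poly_limit f \<Longrightarrow> f \<in> borel_measurable borel"
  by (auto simp: poly_limit_def poly_approx_def)

lemma poly_limit_bounded:
  assumes "poly_limit f" shows "\<exists>C. \<forall>x\<in>{0..1}. \<bar>f x\<bar> \<le> C"
proof -
  obtain p C where C: "\<And>n x. x \<in> {0..1} \<Longrightarrow> \<bar>poly (p n) x\<bar> \<le> C" and l: "\<And>x. x \<in> {0..1} \<Longrightarrow> (\<lambda>n. poly (p n) x) \<longlonglongrightarrow> f x"
    using assms unfolding poly_limit_def poly_approx_def by blast
  have "\<bar>f x\<bar> \<le> C" if "x \<in> {0..1}" for x
    using tendsto_rabs[OF l[OF that]] C[OF that] by (intro LIMSEQ_le_const2) auto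
  then show ?thesis by blast
qed

text \<open>Weierstrass approximation of \<open>f n\<close> with error below
  \<open>1 / (n + 1)\<close> changes neither the pointwise limit nor, up to 1, the bound.\<close>

lemma poly_limit_continuous_limit:
  assumes cont: "\<And>n::nat. continuous_on {0..1} (f n)" and bdd: "\<And>n x. x \<in> {0..1} \<Longrightarrow> \<bar>f n x\<bar> \<le> C"
    and lim: "\<And>x. x \<in> {0..1} \<Longrightarrow> (\<lambda>n. f n x) \<longlonglongrightarrow> g x" and g: "g \<in> borel_measurable borel"
  shows "poly_limit g"
proof -
  have "\<exists>p. \<forall>n. \<forall>x\<in>{0..1}. \<bar>f n x - poly (p n) x\<bar> < inverse (real (Suc n))"
    by (intro choice allI Weierstrass_poly cont) simp
  then obtain p where p: "\<And>n x. x \<in> {0..1} \<Longrightarrow> \<bar>f n x - poly (p n) x\<bar> < inverse (real (Suc n))" by blast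
  have "\<bar>poly (p n) x\<bar> \<le> C + 1" if "x \<in> {0..1}" for n x
  proof -
    have "inverse (real (Suc n)) \<le> 1" by (simp add: divide_simps)
    then show ?thesis using p[OF that, of n] bdd[OF that, of n] by linarith
  qed
  moreover have "(\<lambda>n. poly (p n) x) \<longlonglongrightarrow> g x" if "x \<in> {0..1}" for x
  proof -
    have "(\<lambda>n. f n x - poly (p n) x) \<longlonglongrightarrow> 0"
      by (rule Lim_null_comparison[OF _ LIMSEQ_inverse_real_of_nat]) (use p[OF that] in \<open>auto intro!: always_eventually less_imp_le\<close>)
    from tendsto_diff[OF lim[OF that] this] show ?thesis by simp
  qed
  ultimately show ?thesis unfolding poly_limit_def poly_approx_def using g by blast
qed

lemma poly_limit_continuous:
  assumes "continuous_on {0..1} g" "g \<in> borel_measurable borel"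
  shows "poly_limit g"
proof -
  have "compact (g ` {0..1})" by (intro compact_continuous_image assms) auto
  then obtain C where "\<And>x. x \<in> {0..1} \<Longrightarrow> \<bar>g x\<bar> \<le> C" by (metis bounded_iff compact_imp_bounded imageI real_norm_def)
  then show ?thesis using assms by (intro poly_limit_continuous_limit[of "\<lambda>_. g"]) auto
qed

text \<open>The approximating ramps equal 1 on the closed set \<open>1 \<le> t * a\<close> for every
  \<open>n\<close> and fall off outside with slope proportional to \<open>n\<close>, so the limit is
  the indicator of a closed set.\<close>

lemma poly_limit_threshold: "poly_limit (\<lambda>t. if 1 \<le> t * a then 1 else 0)"
proof (rule poly_limit_continuous_limit[where C = 1])
  fix n :: nat
  show "continuous_on {0..1} (\<lambda>t. max 0 (1 - real n * max 0 (1 - t * a)))" by (intro continuous_intros)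
next
  fix n :: nat and x :: real
  show "\<bar>max 0 (1 - real n * max 0 (1 - x * a))\<bar> \<le> 1" by (auto simp: max_def)
next
  fix x :: real
  show "(\<lambda>n. max 0 (1 - real n * max 0 (1 - x * a))) \<longlonglongrightarrow> (if 1 \<le> x * a then 1 else 0)"
  proof (cases "1 \<le> x * a")
    case True
    then show ?thesis by (simp add: max_def)
  next
    case False
    then obtain N where N: "real N > 1 / (1 - x * a)" using reals_Archimedean2 by blast
    have "max 0 (1 - real n * max 0 (1 - x * a)) = 0" if "n \<ge> N" for n
    proof -
      have "1 / (1 - x * a) < real n" using N that by simp
      then show ?thesis using False by (simp add: field_simps max_def)
    qed
    then have "\<forall>\<^sub>F n in sequentially. max 0 (1 - real n * max 0 (1 - x * a)) = 0" by (auto simp: eventually_sequentially)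
    then show ?thesis using False by (simp add: tendsto_eventually)
  qed
qed simp

section \<open>Polynomials in a positive contraction and its scalar spectral measures\<close>

locale positive_contraction =
  fixes A :: "'h::{real_inner, complete_space} \<Rightarrow> 'h"
  assumes bounded_linear_A: "bounded_linear A"
    and sym: "inner (A x) y = inner x (A y)"
    and nonneg: "0 \<le> inner x (A x)"
    and le: "inner x (A x) \<le> inner x x"
begin

sublocale A: bounded_linear A by (rule bounded_linear_A)

definition pA :: "real poly \<Rightarrow> 'h \<Rightarrow> 'h" where
  "pA p x = (\<Sum>i\<le>degree p. coeff p i *\<^sub>R (A ^^ i) x)"

lemma pA_eq: "degree p \<le> n \<Longrightarrow> pA p x = (\<Sum>i\<le>n. coeff p i *\<^sub>R (A ^^ i) x)"
  unfolding pA_def by (rule sum.mono_neutral_left) (auto simp: coeff_eq_0)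

lemma pA_add: "pA (p + q) x = pA p x + pA q x"
proof -
  let ?n = "max (degree p) (degree q)"
  have "degree (p + q) \<le> ?n" by (rule degree_add_le_max)
  then show ?thesis by (simp add: pA_eq[of _ ?n] sum.distrib scaleR_left_distrib)
qed

lemma pA_smult: "pA (smult c p) x = c *\<^sub>R pA p x"
  by (simp add: pA_eq[of "smult c p" "degree p"] pA_def scaleR_sum_right)

lemma pA_0: "pA 0 x = 0"
  by (simp add: pA_def)

lemma pA_diff: "pA (p - q) x = pA p x - pA q x"
  using pA_add[of "p - q" q x] by simp

lemma pA_pCons: "pA (pCons a p) x = a *\<^sub>R x + A (pA p x)"
proof -
  have "pA (pCons a p) x = (\<Sum>i\<le>Suc (degree p). coeff (pCons a p) i *\<^sub>R (A ^^ i) x)"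
    by (rule pA_eq) (simp add: degree_pCons_le)
  also have "\<dots> = a *\<^sub>R x + (\<Sum>i\<le>degree p. coeff p i *\<^sub>R (A ^^ Suc i) x)"
    by (subst sum.atMost_Suc_shift) simp
  also have "(\<Sum>i\<le>degree p. coeff p i *\<^sub>R (A ^^ Suc i) x) = A (pA p x)"
    by (simp add: pA_def A.sum A.scaleR)
  finally show ?thesis .
qed

lemma pA_1: "pA 1 x = x"
  using pA_pCons[of 1 0 x] by (simp add: pA_0 A.zero one_pCons)

lemma pA_X: "pA [:0, 1:] x = A x"
  by (simp add: pA_pCons pA_0 A.zero)

lemma pA_mult: "pA (p * q) x = pA p (pA q x)"
  by (induction p) (auto simp: pA_0 pA_add pA_smult pA_pCons)

lemma pA_commute_op:
  assumes "linear S" and comm: "\<And>x. S (A x) = A (S x)"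
  shows "S (pA p x) = pA p (S x)"
proof -
  interpret S: linear S by fact
  show ?thesis by (induction p) (auto simp: pA_0 pA_pCons S.zero S.add S.scale comm)
qed

lemma bounded_linear_pA: "bounded_linear (pA p)"
proof (induction p)
  case 0
  have "pA 0 = (\<lambda>x. 0)" by (auto simp: pA_0)
  then show ?case by (simp add: bounded_linear_zero)
next
  case (pCons a p)
  have "pA (pCons a p) = (\<lambda>x. a *\<^sub>R x + A (pA p x))" by (auto simp: pA_pCons)
  with pCons show ?case
    by (auto intro!: bounded_linear_add bounded_linear_compose[OF bounded_linear_A] bounded_linear_scaleR_right)
qed

lemma pA_sym: "inner (pA p x) y = inner x (pA p y)"
  by (induction p arbitrary: x y)
     (auto simp: pA_0 pA_pCons inner_add_left inner_add_right sym pA_commute_op[OF A.linear_axioms, symmetric])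

lemma inner_pA_pA: "inner (pA p x) (pA q x) = inner x (pA (p * q) x)"
  by (simp add: pA_sym pA_mult)

text \<open>
  Up to squares only the polynomials \<open>1\<close>, \<open>X\<close>, \<open>Y = 1 - X\<close> and
  \<open>X Y = X\<^sup>2 Y + Y\<^sup>2 X\<close> have to be considered.
\<close>

lemma inner_pA_Bernstein_nonneg: "0 \<le> inner x (pA ([:0, 1:] ^ i * [:1, - 1:] ^ m) x)"
proof -
  define P where "P p \<longleftrightarrow> (\<forall>x. 0 \<le> inner x (pA p x))" for p
  define X Y where "X = [:0, 1::real:]" and "Y = [:1, - 1::real:]"
  have sq: "P (q ^ 2 * p)" if "P p" for p q
  proof -
    have "inner x (pA (q ^ 2 * p) x) = inner (pA q x) (pA p (pA q x))" for x
      by (simp add: pA_sym pA_mult[symmetric] power2_eq_square mult_ac)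
    with that show ?thesis by (simp add: P_def)
  qed
  have add: "P p \<Longrightarrow> P q \<Longrightarrow> P (p + q)" for p q by (simp add: P_def pA_add inner_add_right)
  have P1: "P 1" by (simp add: P_def pA_1)
  have PX: "P X" using nonneg by (simp add: P_def X_def pA_X)
  have PY: "P Y" using le by (simp add: P_def Y_def pA_pCons pA_0 A.zero inner_add_right inner_diff_right A.neg)
  have XY: "X + Y = 1" by (simp add: X_def Y_def one_pCons)
  have "X * Y = X ^ 2 * Y + Y ^ 2 * X"
  proof -
    have "X ^ 2 * Y + Y ^ 2 * X = X * Y * (X + Y)" by (simp only: power2_eq_square algebra_simps)
    then show ?thesis by (simp add: XY)
  qed
  then have PXY: "P (X * Y)" using add sq PX PY by simp
  have "X ^ i = (X ^ (i div 2)) ^ 2 * X ^ (i mod 2)" "Y ^ m = (Y ^ (m div 2)) ^ 2 * Y ^ (m mod 2)"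
    by (simp_all add: power_mult[symmetric] power_add[symmetric])
  then have "X ^ i * Y ^ m = (X ^ (i div 2) * Y ^ (m div 2)) ^ 2 * (X ^ (i mod 2) * Y ^ (m mod 2))"
    by (simp add: power_mult_distrib mult_ac)
  moreover have "P (X ^ (i mod 2) * Y ^ (m mod 2))"
    using P1 PX PY PXY by (cases "even i"; cases "even m") (auto simp: mod_2_eq_odd)
  ultimately have "P (X ^ i * Y ^ m)" using sq by simp
  then show ?thesis by (simp add: P_def X_def Y_def)
qed

text \<open>The spectral measure of \<open>A\<close> at \<open>x\<close>, characterised by its
  moments \<open>inner x (A^k x)\<close>. The choice is harmless, since integrals of bounded limits
  of polynomials are determined by those of polynomials.\<close>

definition \<mu> :: "'h \<Rightarrow> real measure" where
  "\<mu> x = (SOME M. finite_measure M \<and> sets M = sets borel \<and> (AE t in M. 0 \<le> t \<and> t \<le> 1) \<and>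
     (\<forall>p. (LINT t|M. poly p t) = inner x (pA p x)))"

lemma \<mu>: "finite_measure (\<mu> x) \<and> sets (\<mu> x) = sets borel \<and> (AE t in \<mu> x. 0 \<le> t \<and> t \<le> 1) \<and>
     (\<forall>p. (LINT t|\<mu> x. poly p t) = inner x (pA p x))"
  unfolding \<mu>_def
proof (rule someI_ex)
  interpret positive_poly_functional "\<lambda>p. inner x (pA p x)"
    by unfold_locales (auto simp: pA_add pA_smult inner_add_right inner_pA_Bernstein_nonneg)
  show "\<exists>M. finite_measure M \<and> sets M = sets borel \<and> (AE t in M. 0 \<le> t \<and> t \<le> 1) \<and>
     (\<forall>p. (LINT t|M. poly p t) = inner x (pA p x))"
    by (rule Hausdorff_moment)
qed

sublocale \<mu>: finite_measure "\<mu> x" for x using \<mu> by simp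

lemma sets_\<mu> [simp, measurable_cong]: "sets (\<mu> x) = sets borel" using \<mu> by simp
lemma AE_\<mu>: "AE t in \<mu> x. t \<in> {0..1}" using \<mu> by simp
lemma integral_\<mu>_poly: "(LINT t|\<mu> x. poly p t) = inner x (pA p x)" using \<mu> by simp

lemma integrable_bounded_\<mu>:
  fixes f :: "real \<Rightarrow> real"
  assumes "f \<in> borel_measurable borel" "\<And>t. t \<in> {0..1} \<Longrightarrow> \<bar>f t\<bar> \<le> C"
  shows "integrable (\<mu> x) f"
proof (rule \<mu>.integrable_const_bound[where B = C])
  show "AE t in \<mu> x. norm (f t) \<le> C" using AE_\<mu>[of x] by eventually_elim (simp add: assms)
  show "f \<in> borel_measurable (\<mu> x)" using assms(1) by (subst measurable_cong_sets[OF sets_\<mu> refl])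
qed

lemma integrable_poly_limit: "poly_limit f \<Longrightarrow> integrable (\<mu> x) f"
proof -
  assume f: "poly_limit f"
  then obtain C where "\<And>t. t \<in> {0..1} \<Longrightarrow> \<bar>f t\<bar> \<le> C" using poly_limit_bounded by blast
  then show "integrable (\<mu> x) f" by (intro integrable_bounded_\<mu> poly_limit_measurable f)
qed

lemma integral_\<mu>_tendsto:
  fixes f :: "nat \<Rightarrow> real \<Rightarrow> real"
  assumes [measurable]: "\<And>n. f n \<in> borel_measurable borel" "g \<in> borel_measurable borel"
    and bdd: "\<And>n t. t \<in> {0..1} \<Longrightarrow> \<bar>f n t\<bar> \<le> C" and lim: "\<And>t. t \<in> {0..1} \<Longrightarrow> (\<lambda>n. f n t) \<longlonglongrightarrow> g t"
  shows "(\<lambda>n. LINT t|\<mu> x. f n t) \<longlonglongrightarrow> (LINT t|\<mu> x. g t)"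
proof (rule integral_dominated_convergence[where w = "\<lambda>_. C"])
  show "AE t in \<mu> x. (\<lambda>n. f n t) \<longlonglongrightarrow> g t" using AE_\<mu>[of x] by eventually_elim (rule lim)
  show "AE t in \<mu> x. norm (f n t) \<le> C" for n using AE_\<mu>[of x] by eventually_elim (use bdd in auto)
qed auto

lemma poly_approx_integral:
  assumes "poly_approx p f"
  shows "(\<lambda>n. inner x (pA (p n) x)) \<longlonglongrightarrow> (LINT t|\<mu> x. f t)"
  unfolding integral_\<mu>_poly[symmetric]
  using assms unfolding poly_approx_def by (auto intro!: integral_\<mu>_tendsto)

text \<open>\<open>p \<mapsto> pA p x\<close> is isometric for the seminorm of
  \<open>L2 (\<mu> x)\<close>, because the squared norm of \<open>pA p x\<close> is the integral of
  \<open>p^2\<close>; the limit in that space exists by dominated convergence.\<close>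

lemma poly_approx_convergent:
  assumes p: "poly_approx p f"
  shows "convergent (\<lambda>n. pA (p n) x)"
proof -
  have f: "poly_limit f" using p by (auto simp: poly_limit_def)
  have [measurable]: "f \<in> borel_measurable borel" using f by (rule poly_limit_measurable)
  obtain C where C: "\<And>n t. t \<in> {0..1} \<Longrightarrow> \<bar>poly (p n) t\<bar> \<le> C" using p unfolding poly_approx_def by blast
  obtain D where D: "\<And>t. t \<in> {0..1} \<Longrightarrow> \<bar>f t\<bar> \<le> D" using poly_limit_bounded[OF f] by blast
  show ?thesis
  proof (rule convergent_if_L2_approx[where M = "\<mu> x" and f = "\<lambda>n. poly (p n)" and g = f and w = "\<lambda>_. (C + D)\<^sup>2"])
    fix m n
    have eq: "(\<lambda>t. (poly (p m) t - poly (p n) t)\<^sup>2) = poly ((p m - p n) * (p m - p n))"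
      by (auto simp: power2_eq_square)
    show "(norm (pA (p m) x - pA (p n) x))\<^sup>2 = (LINT t|\<mu> x. (poly (p m) t - poly (p n) t)\<^sup>2)"
      unfolding eq integral_\<mu>_poly inner_pA_pA[symmetric] by (simp add: power2_norm_eq_inner pA_diff)
    show "integrable (\<mu> x) (\<lambda>t. (poly (p m) t - poly (p n) t)\<^sup>2)"
      unfolding eq by (rule integrable_poly_limit[OF poly_limit_poly])
    show "AE t in \<mu> x. (poly (p n) t - f t)\<^sup>2 \<le> (C + D)\<^sup>2"
      using AE_\<mu>[of x]
    proof eventually_elim
      case (elim t)
      have "\<bar>poly (p n) t - f t\<bar> \<le> C + D" using C[OF elim, of n] D[OF elim] by linarith
      then have "\<bar>poly (p n) t - f t\<bar>\<^sup>2 \<le> (C + D)\<^sup>2" by (rule power_mono) simp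
      then show ?case by simp
    qed
    show "AE t in \<mu> x. (\<lambda>n. poly (p n) t) \<longlonglongrightarrow> f t"
      using AE_\<mu>[of x] by eventually_elim (use p in \<open>simp add: poly_approx_def\<close>)
  qed auto
qed

section \<open>Functional calculus for bounded pointwise limits of polynomials\<close>

definition fc :: "(real \<Rightarrow> real) \<Rightarrow> 'h \<Rightarrow> 'h" where
  "fc f x = lim (\<lambda>n. pA ((SOME p. poly_approx p f) n) x)"

text \<open>Independence of the sequence chosen in \<open>fc\<close>: for two approximations
  \<open>p\<close> and \<open>q\<close> of \<open>f\<close> the squares \<open>(p n - q n)^2\<close>
  tend to 0 boundedly, and their integrals are the squared distances of the two approximating
  vectors.\<close>

lemma fc_tendsto:
  assumes p: "poly_approx p f"
  shows "(\<lambda>n. pA (p n) x) \<longlonglongrightarrow> fc f x"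
proof -
  define q where "q = (SOME p. poly_approx p f)"
  have q: "poly_approx q f" unfolding q_def by (rule someI[of "\<lambda>p. poly_approx p f", OF p])
  have qlim: "(\<lambda>n. pA (q n) x) \<longlonglongrightarrow> fc f x"
    using poly_approx_convergent[OF q] by (simp add: fc_def q_def convergent_LIMSEQ_iff)
  have "poly_approx (\<lambda>n. (p n - q n) * (p n - q n)) (\<lambda>t. (f t - f t) * (f t - f t))"
    using poly_approx_mult poly_approx_diff p q by blast
  then have "(\<lambda>n. inner x (pA ((p n - q n) * (p n - q n)) x)) \<longlonglongrightarrow> 0"
    by (auto dest: poly_approx_integral)
  then have "(\<lambda>n. (norm (pA (p n) x - pA (q n) x))\<^sup>2) \<longlonglongrightarrow> 0"
    by (simp only: inner_pA_pA[symmetric] power2_norm_eq_inner pA_diff)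
  then have "(\<lambda>n. norm (pA (p n) x - pA (q n) x)) \<longlonglongrightarrow> 0"
    using tendsto_real_sqrt[of "\<lambda>n. (norm (pA (p n) x - pA (q n) x))\<^sup>2" 0 sequentially] by simp
  then have "(\<lambda>n. pA (p n) x - pA (q n) x) \<longlonglongrightarrow> 0" by (rule tendsto_norm_zero_cancel)
  from tendsto_add[OF this qlim] show ?thesis by simp
qed

lemma inner_fc_fc:
  assumes "poly_limit f" "poly_limit g"
  shows "inner (fc f x) (fc g x) = (LINT t|\<mu> x. f t * g t)"
proof -
  obtain p q where p: "poly_approx p f" and q: "poly_approx q g" using assms by (auto simp: poly_limit_def)
  have "(\<lambda>n. inner (pA (p n) x) (pA (q n) x)) \<longlonglongrightarrow> inner (fc f x) (fc g x)"
    by (intro tendsto_inner fc_tendsto p q)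
  moreover have "(\<lambda>n. inner (pA (p n) x) (pA (q n) x)) \<longlonglongrightarrow> (LINT t|\<mu> x. f t * g t)"
    unfolding inner_pA_pA by (rule poly_approx_integral[OF poly_approx_mult[OF p q]])
  ultimately show ?thesis by (rule LIMSEQ_unique)
qed

lemma fc_poly: "fc (poly p) x = pA p x"
  using LIMSEQ_unique[OF fc_tendsto[OF poly_approx_const] tendsto_const] .

lemma fc_cong:
  assumes "poly_limit f" "\<And>t. t \<in> {0..1} \<Longrightarrow> f t = g t" "g \<in> borel_measurable borel"
  shows "fc f x = fc g x"
proof -
  obtain p where p: "poly_approx p f" using assms by (auto simp: poly_limit_def)
  then have "poly_approx p g" using assms poly_approx_cong by blast
  with p show ?thesis using fc_tendsto LIMSEQ_unique by blast
qed

lemma fc_1: "fc (\<lambda>t. 1) x = x"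
proof -
  have "fc (poly 1) x = fc (\<lambda>t. 1) x" by (rule fc_cong[OF poly_limit_poly]) auto
  then show ?thesis by (simp add: fc_poly pA_1)
qed

lemma fc_id: "fc (\<lambda>t. t) x = A x"
proof -
  have "fc (poly [:0, 1:]) x = fc (\<lambda>t. t) x" by (rule fc_cong[OF poly_limit_poly]) auto
  then show ?thesis by (simp add: fc_poly pA_X)
qed

lemma poly_limit_id: "poly_limit (\<lambda>t. t)" and poly_limit_1: "poly_limit (\<lambda>t. 1)"
  by (auto intro!: poly_limit_continuous continuous_intros)

lemma inner_fc:
  assumes "poly_limit f"
  shows "inner x (fc f x) = (LINT t|\<mu> x. f t)"
  using inner_fc_fc[OF poly_limit_1 assms, of x] by (simp add: fc_1)

lemma fc_sym:
  assumes "poly_limit f"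
  shows "inner (fc f x) y = inner x (fc f y)"
proof -
  obtain p where p: "poly_approx p f" using assms by (auto simp: poly_limit_def)
  have "(\<lambda>n. inner (pA (p n) x) y) \<longlonglongrightarrow> inner (fc f x) y" by (intro tendsto_intros fc_tendsto p)
  moreover have "(\<lambda>n. inner (pA (p n) x) y) \<longlonglongrightarrow> inner x (fc f y)"
    unfolding pA_sym by (intro tendsto_intros fc_tendsto p)
  ultimately show ?thesis by (rule LIMSEQ_unique)
qed

lemma fc_diff:
  assumes "poly_limit f" "poly_limit g"
  shows "fc (\<lambda>t. f t - g t) x = fc f x - fc g x"
proof -
  obtain p q where p: "poly_approx p f" and q: "poly_approx q g" using assms by (auto simp: poly_limit_def)
  have "(\<lambda>n. pA (p n - q n) x) \<longlonglongrightarrow> fc f x - fc g x"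
    unfolding pA_diff by (intro tendsto_intros fc_tendsto p q)
  with fc_tendsto[OF poly_approx_diff[OF p q]] show ?thesis using LIMSEQ_unique by blast
qed

text \<open>Tested against \<open>y\<close>, the product splits over the two arguments of the inner
  product by symmetry. Each factor then converges in norm, and no iterated limit arises.\<close>

lemma fc_mult:
  assumes "poly_limit f" "poly_limit g"
  shows "fc f (fc g x) = fc (\<lambda>t. f t * g t) x"
proof -
  obtain p q where p: "poly_approx p f" and q: "poly_approx q g" using assms by (auto simp: poly_limit_def)
  have "inner y (fc f (fc g x)) = inner y (fc (\<lambda>t. f t * g t) x)" for y
  proof -
    have "(\<lambda>n. inner (pA (p n) y) (pA (q n) x)) \<longlonglongrightarrow> inner (fc f y) (fc g x)"
      by (intro tendsto_intros fc_tendsto p q)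
    moreover have "(\<lambda>n. inner (pA (p n) y) (pA (q n) x)) \<longlonglongrightarrow> inner y (fc (\<lambda>t. f t * g t) x)"
      unfolding pA_sym pA_mult[symmetric] by (intro tendsto_intros fc_tendsto poly_approx_mult p q)
    ultimately show ?thesis using LIMSEQ_unique fc_sym[OF assms(1), of y "fc g x"] by fastforce
  qed
  then show ?thesis by (metis vector_eq_rdot inner_commute)
qed

text \<open>Applied to \<open>A\<close> itself and to multiplication by complex scalars; the latter
  makes the spectral projections complex linear although the calculus is real.\<close>

lemma fc_commute_op:
  assumes "poly_limit f" "bounded_linear S" and comm: "\<And>x. S (A x) = A (S x)"
  shows "S (fc f x) = fc f (S x)"
proof -
  obtain p where p: "poly_approx p f" using assms by (auto simp: poly_limit_def)
  have "(\<lambda>n. S (pA (p n) x)) \<longlonglongrightarrow> S (fc f x)" by (intro bounded_linear.tendsto[OF assms(2)] fc_tendsto p)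
  then have "(\<lambda>n. pA (p n) (S x)) \<longlonglongrightarrow> S (fc f x)"
    using pA_commute_op[OF bounded_linear.linear[OF assms(2)] comm] by simp
  with fc_tendsto[OF p] show ?thesis using LIMSEQ_unique by blast
qed

lemma linear_fc: "poly_limit f \<Longrightarrow> linear (fc f)"
proof -
  assume "poly_limit f"
  then obtain p where p: "poly_approx p f" by (auto simp: poly_limit_def)
  have lin: "linear (pA q)" for q using bounded_linear_pA bounded_linear.linear by blast
  show ?thesis
  proof (rule linearI)
    fix x y c
    have "(\<lambda>n. pA (p n) x + pA (p n) y) \<longlonglongrightarrow> fc f x + fc f y" by (intro tendsto_intros fc_tendsto p)
    then show "fc f (x + y) = fc f x + fc f y"
      using fc_tendsto[OF p, of "x + y"] LIMSEQ_unique by (simp add: linear_add[OF lin]) blast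
    have "(\<lambda>n. c *\<^sub>R pA (p n) x) \<longlonglongrightarrow> c *\<^sub>R fc f x" by (intro tendsto_intros fc_tendsto p)
    then show "fc f (c *\<^sub>R x) = c *\<^sub>R fc f x"
      using fc_tendsto[OF p, of "c *\<^sub>R x"] LIMSEQ_unique by (simp add: linear_scale[OF lin]) blast
  qed
qed

end

section \<open>Spectral family of the inverse\<close>

lemma interval_measure_cdf:
  assumes "finite_borel_measure M" shows "interval_measure (cdf M) = M"
proof (rule cdf_unique')
  interpret finite_borel_measure M by fact
  show "finite_borel_measure (interval_measure (cdf M))"
    by (rule finite_borel_measure_interval_measure[OF cdf_nondecreasing cdf_is_right_cont cdf_lim_at_bot cdf_lim_at_top]) auto
  show "cdf (interval_measure (cdf M)) = cdf M"
    by (intro cdf_interval_measure cdf_nondecreasing cdf_is_right_cont cdf_lim_at_bot)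
qed fact

text \<open>\<open>A\<close> is to be the resolvent \<open>(T + c)^-1\<close>; injectivity makes
  \<open>T = A^-1 - c\<close> single-valued.\<close>

locale injective_contraction = positive_contraction A
  for A :: "'h::{real_inner, complete_space} \<Rightarrow> 'h" +
  fixes c :: real
  assumes inj: "A x = 0 \<Longrightarrow> x = 0"
begin

text \<open>For \<open>t > 0\<close> the condition says \<open>1 / t - c \<le> l\<close>. Without
  the division it is false at \<open>t = 0\<close> for every \<open>l\<close> and fits the threshold
  functions.\<close>

definition E :: "real \<Rightarrow> 'h \<Rightarrow> 'h" where
  "E l = fc (\<lambda>t. if 1 \<le> t * (l + c) then 1 else 0)"

text \<open>At \<open>t = 0\<close> the value of \<open>1 / t\<close> is junk, but \<open>\<mu> x\<close> has no mass there since \<open>A\<close> is injective.\<close>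

definition \<nu> :: "'h \<Rightarrow> real measure" where
  "\<nu> x = distr (\<mu> x) borel (\<lambda>t. 1 / t - c)"

text \<open>The indicator of \<open>{0}\<close> is the bounded limit of \<open>(1 - t)^n\<close>,
  and \<open>t\<close> times it vanishes. So \<open>A\<close> annihilates the corresponding vector,
  which is 0 by injectivity, and the mass at 0 is its inner product with \<open>x\<close>.\<close>

lemma AE_\<mu>_pos: "AE t in \<mu> x. 0 < t \<and> t \<le> 1"
proof -
  let ?f = "\<lambda>t. if t = 0 then 1 else (0::real)"
  have "(\<lambda>n. (1 - t) ^ n) \<longlonglongrightarrow> ?f t" if "t \<in> {0..1}" for t :: real
  proof (cases "t = 0")
    case False
    then show ?thesis using that by (simp add: LIMSEQ_power_zero)
  qed simp
  moreover have "\<bar>(1 - t) ^ n\<bar> \<le> 1" if "t \<in> {0..1}" for t :: real and n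
    using that by (auto intro!: power_le_one)
  ultimately have f: "poly_limit ?f"
    by (intro poly_limit_continuous_limit[of "\<lambda>n t. (1 - t) ^ n" 1]) (auto intro!: continuous_intros)
  have "A (fc ?f x) = fc (\<lambda>t. t * ?f t) x"
    by (subst fc_mult[OF poly_limit_id f, symmetric]) (simp add: fc_id)
  also have "(\<lambda>t. t * ?f t) = poly 0" by auto
  finally have "fc ?f x = 0" by (intro inj[of "fc ?f x"]) (simp only: fc_poly pA_0)
  then have "(LINT t|\<mu> x. ?f t) = 0" using inner_fc[OF f, of x] by simp
  moreover have "?f = indicat_real {0}" by (auto simp: indicator_def)
  moreover have "integral\<^sup>L (\<mu> x) (indicat_real {0}) = measure (\<mu> x) {0}"
    using sets_eq_imp_space_eq[OF sets_\<mu>, of x] by simp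
  ultimately have "measure (\<mu> x) {0} = 0" by metis
  then have "AE t in \<mu> x. t \<noteq> 0"
    by (intro AE_I[of _ _ "{0}"]) (auto simp: \<mu>.emeasure_eq_measure)
  with AE_\<mu>[of x] show ?thesis by eventually_elim auto
qed

lemma finite_borel_measure_\<nu>: "finite_borel_measure (\<nu> x)"
proof -
  have "finite_measure (\<nu> x)" unfolding \<nu>_def by (rule \<mu>.finite_measure_distr) simp
  then show ?thesis by (simp add: finite_borel_measure_def finite_borel_measure_axioms_def \<nu>_def)
qed

sublocale \<nu>: finite_borel_measure "\<nu> x" for x by (rule finite_borel_measure_\<nu>)

lemma integrable_\<nu>:
  fixes f :: "real \<Rightarrow> real" assumes [measurable]: "f \<in> borel_measurable borel"
  shows "integrable (\<nu> x) f \<longleftrightarrow> integrable (\<mu> x) (\<lambda>t. f (1 / t - c))"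
  unfolding \<nu>_def by (subst integrable_distr_eq) auto

lemma integral_\<nu>:
  fixes f :: "real \<Rightarrow> real" assumes [measurable]: "f \<in> borel_measurable borel"
  shows "integral\<^sup>L (\<nu> x) f = (LINT t|\<mu> x. f (1 / t - c))"
  unfolding \<nu>_def by (subst integral_distr) auto

lemma poly_limit_E: "poly_limit (\<lambda>t. if 1 \<le> t * (l + c) then 1 else 0)"
  by (rule poly_limit_threshold)

lemma cdf_\<nu>: "cdf (\<nu> x) l = inner x (E l x)"
proof -
  have "cdf (\<nu> x) l = integral\<^sup>L (\<nu> x) (indicator {..l} :: real \<Rightarrow> real)" by (simp add: cdf_def \<nu>.borel_UNIV)
  also have "\<dots> = (LINT t|\<mu> x. indicator {..l} (1 / t - c))" by (rule integral_\<nu>) simp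
  also have "\<dots> = (LINT t|\<mu> x. (if 1 \<le> t * (l + c) then 1 else 0))"
  proof (rule integral_cong_AE)
    show "AE t in \<mu> x. indicator {..l} (1 / t - c) = (if 1 \<le> t * (l + c) then 1 else (0::real))"
      using AE_\<mu>_pos[of x] by eventually_elim (auto simp: indicator_def field_simps)
  qed auto
  also have "\<dots> = inner x (E l x)" by (simp add: E_def inner_fc[OF poly_limit_E])
  finally show ?thesis .
qed

lemma interval_measure_E: "interval_measure (\<lambda>l. inner x (E l x)) = \<nu> x"
proof -
  have "(\<lambda>l. inner x (E l x)) = cdf (\<nu> x)" by (simp add: cdf_\<nu> fun_eq_iff)
  then show ?thesis by (simp add: interval_measure_cdf finite_borel_measure_\<nu>)
qed

lemma E_E: "E l (E m x) = E (min l m) x"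
  unfolding E_def fc_mult[OF poly_limit_E poly_limit_E]
proof (rule fc_cong)
  show "poly_limit (\<lambda>t. (if 1 \<le> t * (l + c) then 1 else 0) * (if 1 \<le> t * (m + c) then 1 else 0))"
    by (rule poly_limit_mult[OF poly_limit_E poly_limit_E])
  fix t :: real assume t: "t \<in> {0..1}"
  then have "t * (min l m + c) = min (t * (l + c)) (t * (m + c))"
  proof (cases "l \<le> m")
    case True
    then have "t * (l + c) \<le> t * (m + c)" using t by (intro mult_left_mono) auto
    then show ?thesis using True by simp
  next
    case False
    then have "t * (m + c) \<le> t * (l + c)" using t by (intro mult_left_mono) auto
    then show ?thesis using False by simp
  qed
  then show "(if 1 \<le> t * (l + c) then 1 else 0) * (if 1 \<le> t * (m + c) then 1 else 0) =
      (if 1 \<le> t * (min l m + c) then 1 else (0::real))" by simp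
qed simp

lemma E_sym: "inner (E l x) y = inner x (E l y)"
  unfolding E_def by (rule fc_sym[OF poly_limit_E])

text \<open>Since the product of two projections is the one at the smaller level, cross terms are
  values of the distribution function. All limits of \<open>E\<close> thereby reduce to limits of
  \<open>cdf (\<nu> x)\<close>.\<close>

lemma norm_E_diff: "(norm (E l x - E m x))\<^sup>2 = \<bar>cdf (\<nu> x) l - cdf (\<nu> x) m\<bar>"
proof -
  have *: "inner (E k x) (E k' x) = cdf (\<nu> x) (min k k')" for k k'
    by (simp add: E_sym E_E cdf_\<nu>)
  have "(norm (E l x - E m x))\<^sup>2 = cdf (\<nu> x) l + cdf (\<nu> x) m - 2 * cdf (\<nu> x) (min l m)"
    by (simp add: power2_norm_eq_inner inner_diff_left inner_diff_right * min.commute)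
  also have "\<dots> = \<bar>cdf (\<nu> x) l - cdf (\<nu> x) m\<bar>"
    using \<nu>.cdf_nondecreasing[of l m x] \<nu>.cdf_nondecreasing[of m l x] by (auto simp: min_def)
  finally show ?thesis .
qed

lemma measure_\<nu>_UNIV: "measure (\<nu> x) (space (\<nu> x)) = inner x x"
proof -
  have "measure (\<nu> x) (space (\<nu> x)) = (LINT t|\<nu> x. 1)" by simp
  also have "\<dots> = inner x x" using inner_fc[OF poly_limit_1, of x]
    by (subst integral_\<nu>) (simp_all add: fc_1 del: lebesgue_integral_const)
  finally show ?thesis .
qed

lemma tendsto_if_sq_norm_tendsto:
  assumes "((\<lambda>l. (norm (f l - y))\<^sup>2) \<longlongrightarrow> 0) F" shows "(f \<longlongrightarrow> (y::'h)) F"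
proof -
  have "((\<lambda>l. norm (f l - y)) \<longlongrightarrow> 0) F" using tendsto_real_sqrt[OF assms] by simp
  then show ?thesis by (simp add: tendsto_norm_zero_iff LIM_zero_iff)
qed

lemma E_right_continuous: "((\<lambda>m. E m x) \<longlongrightarrow> E l x) (at_right l)"
proof (rule tendsto_if_sq_norm_tendsto)
  have "(cdf (\<nu> x) \<longlongrightarrow> cdf (\<nu> x) l) (at_right l)"
    using \<nu>.cdf_is_right_cont by (simp add: continuous_within)
  then have "((\<lambda>m. \<bar>cdf (\<nu> x) m - cdf (\<nu> x) l\<bar>) \<longlongrightarrow> 0) (at_right l)"
    by (simp add: LIM_zero tendsto_rabs_zero)
  then show "((\<lambda>m. (norm (E m x - E l x))\<^sup>2) \<longlongrightarrow> 0) (at_right l)" by (simp add: norm_E_diff)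
qed

lemma E_at_bot: "((\<lambda>m. E m x) \<longlongrightarrow> 0) at_bot"
proof (rule tendsto_if_sq_norm_tendsto)
  have "(norm (E m x - 0))\<^sup>2 = cdf (\<nu> x) m" for m
    by (simp add: power2_norm_eq_inner E_sym E_E cdf_\<nu>)
  then show "((\<lambda>m. (norm (E m x - 0))\<^sup>2) \<longlongrightarrow> 0) at_bot" by (simp only: \<nu>.cdf_lim_at_bot)
qed

lemma E_at_top: "((\<lambda>m. E m x) \<longlongrightarrow> x) at_top"
proof (rule tendsto_if_sq_norm_tendsto)
  have "(norm (E m x - x))\<^sup>2 = inner x x - cdf (\<nu> x) m" for m
    by (simp add: power2_norm_eq_inner inner_diff_left inner_diff_right E_sym E_E cdf_\<nu> inner_commute)
  moreover have "((\<lambda>m. inner x x - cdf (\<nu> x) m) \<longlongrightarrow> inner x x - inner x x) at_top"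
    using \<nu>.cdf_lim_at_top[of x] by (intro tendsto_intros) (simp add: measure_\<nu>_UNIV)
  ultimately show "((\<lambda>m. (norm (E m x - x))\<^sup>2) \<longlongrightarrow> 0) at_top" by simp
qed

text \<open>A truncation of \<open>1 / t\<close> that is bounded and hence belongs to the functional
  calculus; composed with \<open>A\<close> it gives a spectral cutoff that tends strongly to the
  identity.\<close>

definition inv_cut :: "nat \<Rightarrow> real \<Rightarrow> real" where
  "inv_cut n t = (if 1 \<le> t * real (Suc n) then 1 / t else 0)"

lemma poly_limit_inv_cut: "poly_limit (inv_cut n)"
proof -
  \<comment> \<open>A continuous function agreeing with \<open>1 / t\<close> where the threshold
    function is nonzero.\<close>
  have "poly_limit (\<lambda>t. 1 / max t (1 / real (Suc n)))"
    by (intro poly_limit_continuous continuous_intros) (auto simp: max_def)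
  from poly_limit_mult[OF this poly_limit_threshold[of "real (Suc n)"]] show ?thesis
  proof (rule poly_limit_cong)
    show "inv_cut n \<in> borel_measurable borel" unfolding inv_cut_def by measurable
  qed (auto simp: inv_cut_def max_def field_simps)
qed

lemma measurable_inv_cut [measurable]: "inv_cut n \<in> borel_measurable borel"
  by (rule poly_limit_measurable[OF poly_limit_inv_cut])

lemma inv_cut_tendsto: "0 \<le> t \<Longrightarrow> (\<lambda>n. inv_cut n t) \<longlonglongrightarrow> 1 / t"
proof (cases "t = 0")
  case False
  assume "0 \<le> t"
  with False have t: "0 < t" by simp
  obtain N where N: "real N > 1 / t" using reals_Archimedean2 by blast
  have "inv_cut n t = 1 / t" if "n \<ge> N" for n
  proof -
    have "1 / t < real (Suc n)" using N that by simp
    then show ?thesis using t by (simp add: inv_cut_def field_simps)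
  qed
  then show ?thesis by (intro tendsto_eventually) (auto simp: eventually_sequentially)
qed (simp add: inv_cut_def)

lemma fc_threshold_tendsto: "(\<lambda>n. fc (\<lambda>t. if 1 \<le> t * real (Suc n) then 1 else 0) x) \<longlonglongrightarrow> x"
proof -
  \<comment> \<open>At the level \<open>l = n + 1 - c\<close> the coefficient \<open>l + c\<close>
    in the threshold is \<open>Suc n\<close>.\<close>
  have "(\<lambda>n. E (real n + (1 - c)) x) \<longlonglongrightarrow> x"
  proof (rule filterlim_compose[OF E_at_top])
    show "filterlim (\<lambda>n. real n + (1 - c)) at_top sequentially"
      using filterlim_tendsto_add_at_top[OF tendsto_const[of "1 - c"] filterlim_real_sequentially]
      by (simp add: add.commute)
  qed
  then show ?thesis by (simp add: E_def algebra_simps)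
qed

lemma A_fc_inv_cut: "A (fc (inv_cut n) x) = fc (\<lambda>t. if 1 \<le> t * real (Suc n) then 1 else 0) x"
proof -
  have "A (fc (inv_cut n) x) = fc (\<lambda>t. t * inv_cut n t) x"
    using fc_mult[OF poly_limit_id poly_limit_inv_cut] by (simp add: fc_id)
  also have "\<dots> = fc (\<lambda>t. if 1 \<le> t * real (Suc n) then 1 else 0) x"
    by (rule fc_cong[OF poly_limit_mult[OF poly_limit_id poly_limit_inv_cut]]) (auto simp: inv_cut_def)
  finally show ?thesis .
qed

lemma fc_inv_cut_A_tendsto: "(\<lambda>n. fc (inv_cut n) (A x)) \<longlonglongrightarrow> x"
proof -
  have "fc (inv_cut n) (A x) = A (fc (inv_cut n) x)" for n
    by (rule fc_commute_op[OF poly_limit_inv_cut bounded_linear_A, symmetric]) simp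
  then show ?thesis using fc_threshold_tendsto by (simp add: A_fc_inv_cut)
qed

text \<open>The integrals of \<open>inv_cut n\<close> squared are the squared norms of
  \<open>fc (inv_cut n) (A x)\<close>, which converge to that of \<open>x\<close>; monotone
  convergence does the rest.\<close>

lemma integrable_inverse_sq_A: "integrable (\<mu> (A x)) (\<lambda>t. (1 / t)\<^sup>2)"
proof (rule integrable_monotone_convergence)
  show "integrable (\<mu> (A x)) (\<lambda>t. inv_cut n t * inv_cut n t)" for n
    by (intro integrable_poly_limit poly_limit_mult poly_limit_inv_cut)
  show "AE t in \<mu> (A x). mono (\<lambda>n. inv_cut n t * inv_cut n t)"
    using AE_\<mu>_pos
  proof eventually_elim
    case (elim t)
    show ?case
    proof (rule monoI)
      fix m n :: nat assume "m \<le> n"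
      then have "t * real (Suc m) \<le> t * real (Suc n)" using elim by (intro mult_left_mono) auto
      then show "inv_cut m t * inv_cut m t \<le> inv_cut n t * inv_cut n t" by (auto simp: inv_cut_def)
    qed
  qed
  show "AE t in \<mu> (A x). (\<lambda>n. inv_cut n t * inv_cut n t) \<longlonglongrightarrow> (1 / t)\<^sup>2"
    using AE_\<mu>_pos
  proof eventually_elim
    case (elim t)
    then show ?case unfolding power2_eq_square by (intro tendsto_mult inv_cut_tendsto) auto
  qed
  have "(\<lambda>n. inner (fc (inv_cut n) (A x)) (fc (inv_cut n) (A x))) \<longlonglongrightarrow> inner x x"
    by (intro tendsto_inner fc_inv_cut_A_tendsto)
  then show "(\<lambda>n. LINT t|\<mu> (A x). inv_cut n t * inv_cut n t) \<longlonglongrightarrow> inner x x"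
    by (simp add: inner_fc_fc poly_limit_inv_cut)
qed simp

lemma integrable_inverse:
  assumes "integrable (\<mu> x) (\<lambda>t. (1 / t)\<^sup>2)"
  shows "integrable (\<mu> x) (\<lambda>t. 1 / t)"
proof (rule Bochner_Integration.integrable_bound)
  show "integrable (\<mu> x) (\<lambda>t. 1 + (1 / t)\<^sup>2)" using assms by simp
  have "\<bar>s\<bar> \<le> 1 + s\<^sup>2" for s :: real
  proof -
    have "0 \<le> (1 - \<bar>s\<bar>)\<^sup>2" by simp
    then show ?thesis by (simp add: power2_eq_square algebra_simps)
  qed
  then show "AE t in \<mu> x. norm (1 / t) \<le> norm (1 + (1 / t)\<^sup>2)"
    by (intro always_eventually allI) (metis abs_of_nonneg add_nonneg_nonneg real_norm_def zero_le_one zero_le_power2)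
qed simp

lemma integrable_\<nu>_sq: "integrable (\<nu> x) (\<lambda>l. l\<^sup>2) \<longleftrightarrow> integrable (\<mu> x) (\<lambda>t. (1 / t)\<^sup>2)"
proof
  assume "integrable (\<nu> x) (\<lambda>l. l\<^sup>2)"
  then have *: "integrable (\<mu> x) (\<lambda>t. (1 / t - c)\<^sup>2)" by (simp add: integrable_\<nu>)
  show "integrable (\<mu> x) (\<lambda>t. (1 / t)\<^sup>2)"
  proof (rule Bochner_Integration.integrable_bound)
    show "integrable (\<mu> x) (\<lambda>t. 2 * (1 / t - c)\<^sup>2 + 2 * c\<^sup>2)" using * by simp
    have "s\<^sup>2 \<le> 2 * (s - c)\<^sup>2 + 2 * c\<^sup>2" for s :: real
    proof -
      have "0 \<le> ((s - c) - c)\<^sup>2" by simp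
      then show ?thesis by (simp add: power2_eq_square algebra_simps)
    qed
    then show "AE t in \<mu> x. norm ((1 / t)\<^sup>2) \<le> norm (2 * (1 / t - c)\<^sup>2 + 2 * c\<^sup>2)" by (simp add: abs_of_nonneg)
  qed simp
next
  assume *: "integrable (\<mu> x) (\<lambda>t. (1 / t)\<^sup>2)"
  then have "integrable (\<mu> x) (\<lambda>t. (1 / t)\<^sup>2 + c\<^sup>2 - 2 * c * (1 / t))"
    using integrable_inverse[OF *] by (intro Bochner_Integration.integrable_diff Bochner_Integration.integrable_add
      integrable_mult_right) auto
  then show "integrable (\<nu> x) (\<lambda>l. l\<^sup>2)"
    by (simp add: integrable_\<nu> power2_diff mult_ac)
qed

text \<open>Both sides describe the domain of \<open>A^-1 - c\<close>. If \<open>1 / t\<close> is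
  square integrable, the vectors \<open>fc (inv_cut n) x\<close> converge to some \<open>y\<close>;
  applying \<open>A\<close> turns them into cutoffs of \<open>x\<close>, so
  \<open>A y = x\<close>.\<close>

lemma domain_iff: "integrable (\<nu> x) (\<lambda>l. l\<^sup>2) \<longleftrightarrow> x \<in> range A"
proof
  assume "x \<in> range A"
  then show "integrable (\<nu> x) (\<lambda>l. l\<^sup>2)" using integrable_inverse_sq_A by (auto simp: integrable_\<nu>_sq)
next
  assume "integrable (\<nu> x) (\<lambda>l. l\<^sup>2)"
  then have int: "integrable (\<mu> x) (\<lambda>t. (1 / t)\<^sup>2)" by (simp add: integrable_\<nu>_sq)
  have "convergent (\<lambda>n. fc (inv_cut n) x)"
  proof (rule convergent_if_L2_approx[where M = "\<mu> x" and f = inv_cut and g = "\<lambda>t. 1 / t", OF _ _ _ _ int])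
    fix m n
    note lim = poly_limit_diff[OF poly_limit_inv_cut poly_limit_inv_cut]
    show "(norm (fc (inv_cut m) x - fc (inv_cut n) x))\<^sup>2 = (LINT t|\<mu> x. (inv_cut m t - inv_cut n t)\<^sup>2)"
      unfolding power2_norm_eq_inner fc_diff[OF poly_limit_inv_cut poly_limit_inv_cut, symmetric]
      unfolding power2_eq_square by (intro inner_fc_fc lim)
    show "integrable (\<mu> x) (\<lambda>t. (inv_cut m t - inv_cut n t)\<^sup>2)"
      unfolding power2_eq_square by (intro integrable_poly_limit poly_limit_mult lim)
    show "AE t in \<mu> x. (\<lambda>n. inv_cut n t) \<longlonglongrightarrow> 1 / t"
      using AE_\<mu>_pos by eventually_elim (auto intro!: inv_cut_tendsto)
  qed (auto simp: inv_cut_def)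
  then obtain y where "(\<lambda>n. fc (inv_cut n) x) \<longlonglongrightarrow> y" by (auto simp: convergent_def)
  then have "(\<lambda>n. A (fc (inv_cut n) x)) \<longlonglongrightarrow> A y" by (rule A.tendsto)
  then have "x = A y" using fc_threshold_tendsto LIMSEQ_unique by (simp add: A_fc_inv_cut) blast
  then show "x \<in> range A" by blast
qed

text \<open>This is the energy of \<open>\<psi> = A x\<close>, since \<open>A^-1 - c\<close> maps
  \<open>A x\<close> to \<open>x - c *\<^sub>R A x\<close>.\<close>

lemma integral_\<nu>_A: "(LINT l|\<nu> (A x). l) = inner (A x) (x - c *\<^sub>R A x)"
proof -
  note int = integrable_inverse[OF integrable_inverse_sq_A, of x]
  have "(\<lambda>n. LINT t|\<mu> (A x). inv_cut n t) \<longlonglongrightarrow> (LINT t|\<mu> (A x). 1 / t)"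
  proof (rule integral_dominated_convergence[OF _ _ int])
    show "AE t in \<mu> (A x). (\<lambda>n. inv_cut n t) \<longlonglongrightarrow> 1 / t"
      using AE_\<mu>_pos by eventually_elim (auto intro!: inv_cut_tendsto)
    show "AE t in \<mu> (A x). norm (inv_cut n t) \<le> 1 / t" for n
      using AE_\<mu>_pos by eventually_elim (auto simp: inv_cut_def)
  qed auto
  moreover have "(\<lambda>n. LINT t|\<mu> (A x). inv_cut n t) \<longlonglongrightarrow> inner (A x) x"
    unfolding inner_fc[OF poly_limit_inv_cut, symmetric]
    by (intro tendsto_inner tendsto_const fc_inv_cut_A_tendsto)
  ultimately have *: "(LINT t|\<mu> (A x). 1 / t) = inner (A x) x" by (rule LIMSEQ_unique)
  have "(LINT l|\<nu> (A x). l) = (LINT t|\<mu> (A x). 1 / t - c)" by (rule integral_\<nu>) simp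
  also have "\<dots> = inner (A x) x - c * inner (A x) (A x)"
    using int inner_fc[OF poly_limit_1, of "A x"] by (simp add: * fc_1)
  finally show ?thesis by (simp add: inner_diff_right)
qed

end

section \<open>Completeness of \<open>L2\<close>\<close>

lemma L2_rel_rep: "L2_rel (rep_L2 f) (rep_L2 f)"
  by (rule Quotient_rep_reflp[OF Quotient_L2])

lemma sq_integrable_rep: "sq_integrable lebesgue (rep_L2 f)"
  using L2_rel_rep[of f] by (simp add: L2_rel_def)

lemma rep_abs_L2: "sq_integrable lebesgue f \<Longrightarrow> AE x in lebesgue. rep_L2 (abs_L2 f) x = f x"
proof -
  assume f: "sq_integrable lebesgue f"
  then have "L2_rel f f" by (simp add: L2_rel_def)
  then have "L2_rel (rep_L2 (abs_L2 f)) f" by (rule Quotient3_rep_abs[OF Quotient3_L2])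
  then show ?thesis by (simp add: L2_rel_def)
qed

lemma abs_L2_eqI: "sq_integrable lebesgue f \<Longrightarrow> sq_integrable lebesgue g \<Longrightarrow> AE x in lebesgue. f x = g x \<Longrightarrow> abs_L2 f = abs_L2 g"
  by (rule Quotient3_rel_abs[OF Quotient3_L2]) (simp add: L2_rel_def)

lemma abs_rep_L2: "abs_L2 (rep_L2 f) = f"
  by (rule Quotient3_abs_rep[OF Quotient3_L2])

lemma L2_eqI: "AE x in lebesgue. rep_L2 f x = rep_L2 g x \<Longrightarrow> f = g"
  using abs_L2_eqI[OF sq_integrable_rep sq_integrable_rep] by (metis abs_rep_L2)

lemma rep_plus: "AE x in lebesgue. rep_L2 (f + g) x = rep_L2 f x + rep_L2 g x"
proof -
  have "f + g = abs_L2 (\<lambda>x. rep_L2 f x + rep_L2 g x)" by (simp add: plus_L2_def)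
  then show ?thesis by (simp add: rep_abs_L2 sq_integrable_add sq_integrable_rep)
qed

lemma rep_cscale: "AE x in lebesgue. rep_L2 (c *\<^sub>C f) x = c * rep_L2 f x"
proof -
  have "c *\<^sub>C f = abs_L2 (\<lambda>x. c * rep_L2 f x)" by (simp add: cscale_def)
  then show ?thesis by (simp add: rep_abs_L2 sq_integrable_cmult sq_integrable_rep)
qed

lemma rep_zero: "AE x in lebesgue. rep_L2 0 x = 0"
  by (simp add: zero_L2_def rep_abs_L2 sq_integrable_zero)

lemma rep_minus: "AE x in lebesgue. rep_L2 (f - g) x = rep_L2 f x - rep_L2 g x"
proof -
  have "f - g = f + (-1) *\<^sub>C g" unfolding minus_L2_def uminus_L2_def ..
  then have "AE x in lebesgue. rep_L2 (f - g) x = rep_L2 f x + rep_L2 ((-1) *\<^sub>C g) x"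
    using rep_plus[of f "(-1) *\<^sub>C g"] by simp
  with rep_cscale[of "-1" g] show ?thesis by eventually_elim simp
qed

lemma cinner_eq: "cinner f g = (LINT x|lebesgue. cnj (rep_L2 f x) * rep_L2 g x)"
  by (simp add: cinner_def)

lemma norm_L2_sq: "(norm f)\<^sup>2 = (LINT x|lebesgue. (cmod (rep_L2 f x))\<^sup>2)"
proof -
  have sq: "cnj z * z = complex_of_real ((cmod z)\<^sup>2)" for z
    by (simp add: complex_norm_square mult.commute del: of_real_power)
  show ?thesis
    by (simp only: power2_norm_eq_inner inner_L2_def cinner_eq sq integral_complex_of_real Re_complex_of_real)
qed

lemma norm_L2_eq: "AE x in lebesgue. rep_L2 f x = g x \<Longrightarrow> g \<in> borel_measurable lebesgue \<Longrightarrow> (norm f)\<^sup>2 = (LINT x|lebesgue. (cmod (g x))\<^sup>2)"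
  unfolding norm_L2_sq using sq_integrable_rep[of f]
  by (intro integral_cong_AE) (auto simp: sq_integrable_def elim: eventually_mono)

lemma measurable_rep [measurable]: "rep_L2 f \<in> borel_measurable lebesgue"
  using sq_integrable_rep by (auto simp: sq_integrable_def)

lemma integrable_rep_sq: "integrable lebesgue (\<lambda>x. (cmod (rep_L2 f x))\<^sup>2)"
  using sq_integrable_rep by (auto simp: sq_integrable_def)

lemma L2_weight_exists:
  obtains w :: "'a::euclidean_space \<Rightarrow> real" where "w \<in> borel_measurable lebesgue" "\<And>x. 0 < w x"
    "integrable lebesgue (\<lambda>x. (w x)\<^sup>2)"
proof -
  obtain h :: "'a \<Rightarrow> ennreal" where [measurable]: "h \<in> borel_measurable lborel" and fin: "integral\<^sup>N lborel h \<noteq> \<infinity>"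
    and pos: "\<And>x. 0 < h x" "\<And>x. h x < \<infinity>"
    using sigma_finite_measure.Ex_finite_integrable_function[OF sigma_finite_lborel] by auto
  have "integrable lborel (\<lambda>x. enn2real (h x))"
    using fin pos by (intro integrableI_nonneg) (auto simp: less_top)
  then have "integrable lebesgue (\<lambda>x. (sqrt (enn2real (h x)))\<^sup>2)"
    by (simp add: integrable_completion)
  moreover have "0 < sqrt (enn2real (h x))" for x using pos[of x] by (simp add: enn2real_positive_iff)
  moreover have "(\<lambda>x. sqrt (enn2real (h x))) \<in> borel_measurable lebesgue"
    by (intro measurable_completion) measurable
  ultimately show ?thesis using that by blast
qed

text \<open>Multiplication by a square integrable weight turns Cauchy sequences in \<open>L2\<close> into Cauchy sequences in \<open>L1\<close>.\<close>

lemma L2_Cauchy_convergent: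
  fixes s :: "nat \<Rightarrow> 'a::euclidean_space L2"
  assumes "Cauchy s" shows "convergent s"
proof -
  obtain w :: "'a \<Rightarrow> real" where [measurable]: "w \<in> borel_measurable lebesgue" and w: "\<And>x. 0 < w x"
    and wi: "integrable lebesgue (\<lambda>x. (w x)\<^sup>2)" by (rule L2_weight_exists) blast
  define W where "W = abs_L2 (\<lambda>x. complex_of_real (w x))"
  have Wsq: "sq_integrable lebesgue (\<lambda>x. complex_of_real (w x))"
    using wi by (simp add: sq_integrable_def)
  have W: "AE x in lebesgue. rep_L2 W x = complex_of_real (w x)" unfolding W_def by (rule rep_abs_L2[OF Wsq])
  have int: "integrable lebesgue (\<lambda>x. complex_of_real (w x) * rep_L2 f x)" for f
    using sq_integrable_inner[OF Wsq sq_integrable_rep[of f]] by simp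
  have CS: "(LINT x|lebesgue. cmod (complex_of_real (w x) * rep_L2 f x)) \<le> norm W * norm f" for f
  proof -
    \<comment> \<open>The modulus of \<open>f\<close> as an element of \<open>L2\<close> with the
      same norm: the Cauchy-Schwarz inequality for \<open>W\<close> and \<open>g\<close> bounds the
      integral of the modulus.\<close>
    define g where "g = abs_L2 (\<lambda>x. complex_of_real (cmod (rep_L2 f x)))"
    have gsq: "sq_integrable lebesgue (\<lambda>x. complex_of_real (cmod (rep_L2 f x)))"
      using integrable_rep_sq[of f] by (simp add: sq_integrable_def)
    have g: "AE x in lebesgue. rep_L2 g x = complex_of_real (cmod (rep_L2 f x))"
      unfolding g_def by (rule rep_abs_L2[OF gsq])
    have "(norm g)\<^sup>2 = (norm f)\<^sup>2"
      by (subst norm_L2_eq[OF g]) (simp_all add: norm_L2_sq)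
    then have ng: "norm g = norm f" by simp
    have "cinner W g = (LINT x|lebesgue. complex_of_real (cmod (complex_of_real (w x) * rep_L2 f x)))"
      unfolding cinner_eq
    proof (rule integral_cong_AE)
      show "AE x in lebesgue. cnj (rep_L2 W x) * rep_L2 g x = complex_of_real (cmod (complex_of_real (w x) * rep_L2 f x))"
        using W g by eventually_elim (use w in \<open>simp add: norm_mult less_imp_le\<close>)
      show "(\<lambda>x. cnj (rep_L2 W x) * rep_L2 g x) \<in> borel_measurable lebesgue"
        by (rule borel_measurable_integrable[OF sq_integrable_inner[OF sq_integrable_rep sq_integrable_rep]])
    qed measurable
    then have "(LINT x|lebesgue. cmod (complex_of_real (w x) * rep_L2 f x)) = inner W g"
      by (simp add: inner_L2_def)
    also have "\<dots> \<le> norm W * norm g" by (rule norm_cauchy_schwarz)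
    finally show ?thesis by (simp add: ng)
  qed
  define t where "t n x = complex_of_real (w x) * rep_L2 (s n) x" for n x
  have "\<exists>N. \<forall>i\<ge>N. \<forall>j\<ge>N. (LINT x|lebesgue. norm (t i x - t j x)) < e" if e: "0 < e" for e
  proof -
    have "0 < e / (norm W + 1)" using e by (simp add: add_nonneg_pos)
    then obtain N where N: "\<And>i j. i \<ge> N \<Longrightarrow> j \<ge> N \<Longrightarrow> norm (s i - s j) < e / (norm W + 1)"
      using CauchyD[OF assms] by blast
    have "(LINT x|lebesgue. norm (t i x - t j x)) < e" if "i \<ge> N" "j \<ge> N" for i j
    proof -
      have "(LINT x|lebesgue. norm (t i x - t j x)) = (LINT x|lebesgue. cmod (complex_of_real (w x) * rep_L2 (s i - s j) x))"
      proof (rule integral_cong_AE)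
        show "AE x in lebesgue. norm (t i x - t j x) = cmod (complex_of_real (w x) * rep_L2 (s i - s j) x)"
          using rep_minus[of "s i" "s j"] by eventually_elim (simp add: t_def right_diff_distrib)
      qed (auto simp: t_def)
      also have "\<dots> \<le> norm W * norm (s i - s j)" by (rule CS)
      also have "\<dots> \<le> (norm W + 1) * norm (s i - s j)" by (simp add: mult_right_mono)
      also have "\<dots> < e" using N[OF that] by (simp add: pos_less_divide_eq add_nonneg_pos mult.commute)
      finally show ?thesis .
    qed
    then show ?thesis by blast
  qed
  then obtain r where r: "strict_mono r" and C: "AE x in lebesgue. Cauchy (\<lambda>i. t (r i) x)"
    using cauchy_L1_AE_cauchy_subseq[of lebesgue t] int unfolding t_def by blast
  define f where "f x = lim (\<lambda>i. rep_L2 (s (r i)) x)" for x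
  have [measurable]: "f \<in> borel_measurable lebesgue" unfolding f_def by measurable
  have lim: "AE x in lebesgue. (\<lambda>i. rep_L2 (s (r i)) x) \<longlonglongrightarrow> f x"
    using C
  proof eventually_elim
    case (elim x)
    then obtain l where "(\<lambda>i. t (r i) x) \<longlonglongrightarrow> l" using Cauchy_convergent by (auto simp: convergent_def)
    then have "(\<lambda>i. t (r i) x / complex_of_real (w x)) \<longlonglongrightarrow> l / complex_of_real (w x)"
      using w[of x] by (intro tendsto_intros) auto
    then have "(\<lambda>i. rep_L2 (s (r i)) x) \<longlonglongrightarrow> l / complex_of_real (w x)"
      using w[of x] by (simp add: t_def)
    then show ?case by (simp add: f_def limI)
  qed
  \<comment> \<open>Almost everywhere convergence holds only along a subsequence. Fatou's lemma
    turns the Cauchy estimate into an estimate of the distance from \<open>f\<close> for the full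
    sequence.\<close>
  have Fatou: "(\<integral>\<^sup>+x. ennreal ((cmod (f x - rep_L2 (s m) x))\<^sup>2) \<partial>lebesgue) \<le> ennreal (e\<^sup>2)"
    if N: "\<And>i j. i \<ge> N \<Longrightarrow> j \<ge> N \<Longrightarrow> norm (s i - s j) \<le> e" and m: "m \<ge> N" for N m e
  proof -
    have "(\<integral>\<^sup>+x. ennreal ((cmod (f x - rep_L2 (s m) x))\<^sup>2) \<partial>lebesgue) =
       (\<integral>\<^sup>+x. liminf (\<lambda>i. ennreal ((cmod (rep_L2 (s (r i)) x - rep_L2 (s m) x))\<^sup>2)) \<partial>lebesgue)"
    proof (rule nn_integral_cong_AE)
      show "AE x in lebesgue. ennreal ((cmod (f x - rep_L2 (s m) x))\<^sup>2) =
         liminf (\<lambda>i. ennreal ((cmod (rep_L2 (s (r i)) x - rep_L2 (s m) x))\<^sup>2))"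
        using lim
      proof eventually_elim
        case (elim x)
        then have "(\<lambda>i. ennreal ((cmod (rep_L2 (s (r i)) x - rep_L2 (s m) x))\<^sup>2)) \<longlonglongrightarrow> ennreal ((cmod (f x - rep_L2 (s m) x))\<^sup>2)"
          by (intro tendsto_ennrealI tendsto_intros)
        then show ?case by (intro lim_imp_Liminf[symmetric]) auto
      qed
    qed
    also have "\<dots> \<le> liminf (\<lambda>i. \<integral>\<^sup>+x. ennreal ((cmod (rep_L2 (s (r i)) x - rep_L2 (s m) x))\<^sup>2) \<partial>lebesgue)"
      by (rule nn_integral_liminf) measurable
    also have "\<dots> \<le> liminf (\<lambda>i. ennreal (e\<^sup>2))"
    proof (rule Liminf_mono)
      have "(\<integral>\<^sup>+x. ennreal ((cmod (rep_L2 (s (r i)) x - rep_L2 (s m) x))\<^sup>2) \<partial>lebesgue) \<le> ennreal (e\<^sup>2)" if "i \<ge> N" for i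
      proof -
        have ri: "r i \<ge> N" using seq_suble[OF r, of i] that by linarith
        have "(\<integral>\<^sup>+x. ennreal ((cmod (rep_L2 (s (r i)) x - rep_L2 (s m) x))\<^sup>2) \<partial>lebesgue) =
           (\<integral>\<^sup>+x. ennreal ((cmod (rep_L2 (s (r i) - s m) x))\<^sup>2) \<partial>lebesgue)"
          by (rule nn_integral_cong_AE) (use rep_minus[of "s (r i)" "s m"] in \<open>auto elim: eventually_mono\<close>)
        also have "\<dots> = ennreal ((norm (s (r i) - s m))\<^sup>2)"
          unfolding norm_L2_sq by (rule nn_integral_eq_integral[OF integrable_rep_sq]) auto
        also have "\<dots> \<le> ennreal (e\<^sup>2)"
          using N[OF ri m] by (intro ennreal_leI power_mono) auto
        finally show ?thesis .
      qed
      then show "\<forall>\<^sub>F i in sequentially. (\<integral>\<^sup>+x. ennreal ((cmod (rep_L2 (s (r i)) x - rep_L2 (s m) x))\<^sup>2) \<partial>lebesgue) \<le> ennreal (e\<^sup>2)"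
        by (auto simp: eventually_sequentially)
    qed
    also have "\<dots> = ennreal (e\<^sup>2)" by (simp add: Liminf_const)
    finally show ?thesis .
  qed
  obtain N1 where N1: "\<And>i j. i \<ge> N1 \<Longrightarrow> j \<ge> N1 \<Longrightarrow> norm (s i - s j) \<le> 1"
    using CauchyD[OF assms, of 1] by (auto intro: less_imp_le)
  \<comment> \<open>The case \<open>e = 1\<close> of the estimate shows that \<open>f\<close>
    differs from a member of the sequence by a square integrable function.\<close>
  have "sq_integrable lebesgue (\<lambda>x. f x - rep_L2 (s N1) x)"
    unfolding sq_integrable_def
  proof
    show "integrable lebesgue (\<lambda>x. (cmod (f x - rep_L2 (s N1) x))\<^sup>2)"
      using Fatou[OF N1, of N1 N1] by (intro integrableI_nonneg) (auto simp: less_top[symmetric] top_unique)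
  qed measurable
  from sq_integrable_add[OF this sq_integrable_rep[of "s N1"]] have fsq: "sq_integrable lebesgue f" by simp
  define F where "F = abs_L2 f"
  have F: "AE x in lebesgue. rep_L2 F x = f x" unfolding F_def by (rule rep_abs_L2[OF fsq])
  have "s \<longlonglongrightarrow> F"
  proof (rule LIMSEQ_I)
    fix e :: real assume e: "0 < e"
    then obtain N where N: "\<And>i j. i \<ge> N \<Longrightarrow> j \<ge> N \<Longrightarrow> norm (s i - s j) \<le> e / 2"
      using CauchyD[OF assms, of "e / 2"] by (auto intro: less_imp_le)
    have "norm (s m - F) < e" if m: "m \<ge> N" for m
    proof -
      have "ennreal ((norm (F - s m))\<^sup>2) = (\<integral>\<^sup>+x. ennreal ((cmod (rep_L2 (F - s m) x))\<^sup>2) \<partial>lebesgue)"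
        unfolding norm_L2_sq by (rule nn_integral_eq_integral[OF integrable_rep_sq, symmetric]) auto
      also have "\<dots> = (\<integral>\<^sup>+x. ennreal ((cmod (f x - rep_L2 (s m) x))\<^sup>2) \<partial>lebesgue)"
      proof (rule nn_integral_cong_AE)
        show "AE x in lebesgue. ennreal ((cmod (rep_L2 (F - s m) x))\<^sup>2) = ennreal ((cmod (f x - rep_L2 (s m) x))\<^sup>2)"
          using rep_minus[of F "s m"] F by eventually_elim (simp only:)
      qed
      also have "\<dots> \<le> ennreal ((e / 2)\<^sup>2)" by (rule Fatou[OF N m])
      finally have "(norm (F - s m))\<^sup>2 \<le> (e / 2)\<^sup>2" by (subst (asm) ennreal_le_iff) simp_all
      then have "norm (F - s m) \<le> e / 2" by (rule power2_le_imp_le) (use e in simp)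
      then show ?thesis using e by (simp add: norm_minus_commute[of "s m" F])
    qed
    then show "\<exists>N. \<forall>m\<ge>N. norm (s m - F) < e" by blast
  qed
  then show ?thesis by (auto simp: convergent_def)
qed

instance L2 :: (euclidean_space) complete_space
  by standard (rule L2_Cauchy_convergent)

section \<open>Operators of closed semibounded forms\<close>

lemma cinner_plus_right: "cinner f (g + h) = cinner f g + cinner f h"
  by transfer (simp add: L2_rel_def sq_integrable_inner distrib_left)

lemma cinner_plus_left: "cinner (f + g) h = cinner f h + cinner g h"
  by transfer (simp add: L2_rel_def sq_integrable_inner distrib_right)

lemma cinner_cscale_right: "cinner f (z *\<^sub>C g) = z * cinner f g"
  by transfer (simp add: mult.left_commute)

lemma cinner_cscale_left: "cinner (z *\<^sub>C f) g = cnj z * cinner f g"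
  by transfer (simp add: mult.assoc)

lemma cinner_zero_left [simp]: "cinner 0 g = 0" and cinner_zero_right [simp]: "cinner g 0 = 0"
  using cinner_cscale_left[of 0 0 g] cinner_cscale_right[of g 0 0] by simp_all

text \<open>The bridge from the real to the complex inner product: an identity for
  \<open>inner\<close> gives the real part of one for \<open>cinner\<close>, and the same identity
  at \<open>\<i> *\<^sub>C f\<close> gives the imaginary part.\<close>

lemma inner_cscale_i: "inner (\<i> *\<^sub>C f) g = Im (cinner f g)"
  by (simp add: inner_L2_def cinner_cscale_left)

lemma cinner_commute: "cinner g f = cnj (cinner f g)"
proof (rule complex_eqI)
  show "Re (cinner g f) = Re (cnj (cinner f g))" using inner_commute[of g f] by (simp add: inner_L2_def)
  have "Im (cinner g f) = inner (\<i> *\<^sub>C g) f" by (simp add: inner_cscale_i)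
  also have "\<dots> = inner f (\<i> *\<^sub>C g)" by (rule inner_commute)
  also have "\<dots> = - Im (cinner f g)" by (simp add: inner_L2_def cinner_cscale_right)
  finally show "Im (cinner g f) = Im (cnj (cinner f g))" by simp
qed

lemma cinner_self: "cinner f f = complex_of_real ((norm f)\<^sup>2)"
proof (rule complex_eqI)
  show "Re (cinner f f) = Re (complex_of_real ((norm f)\<^sup>2))" by (simp add: power2_norm_eq_inner inner_L2_def del: of_real_power)
  show "Im (cinner f f) = Im (complex_of_real ((norm f)\<^sup>2))" using cinner_commute[of f f] by (simp add: complex_eq_iff del: of_real_power)
qed

lemma scaleR_cscale: "r *\<^sub>R f = complex_of_real r *\<^sub>C f"
  by (rule scaleR_L2_def)

lemma norm_cscale: "norm (z *\<^sub>C f) = cmod z * norm f"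
proof -
  have "cinner (z *\<^sub>C f) (z *\<^sub>C f) = complex_of_real ((cmod z)\<^sup>2) * cinner f f"
    by (simp add: cinner_cscale_left cinner_cscale_right complex_norm_square mult_ac del: of_real_power)
  then have "(norm (z *\<^sub>C f))\<^sup>2 = (cmod z * norm f)\<^sup>2"
    unfolding cinner_self of_real_mult[symmetric] of_real_eq_iff by (simp add: power_mult_distrib)
  then show ?thesis by (simp add: power2_eq_iff_nonneg)
qed

lemma bounded_linear_cscale: "bounded_linear (cscale z)"
  by (rule bounded_linear_intro[of _ "cmod z"])
     (simp_all add: L2.scale_right_distrib scaleR_cscale norm_cscale mult.commute L2.scale_left_commute)

lemma linear_cscaleI:
  assumes "\<And>x y. P (x + y) = P x + P y" "\<And>z x. P (z *\<^sub>C x) = z *\<^sub>C P x"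
  shows "Vector_Spaces.linear cscale cscale P"
  using assms by unfold_locales auto

text \<open>The graph is that of \<open>R^-1 - c\<close> without an inverse: with
  \<open>\<eta> = \<zeta> + c *\<^sub>R \<psi>\<close> its condition reads
  \<open>R \<eta> = \<psi>\<close>.\<close>

theorem spectral_resolution_exists:
  fixes R :: "'a::euclidean_space L2 \<Rightarrow> 'a L2"
  assumes bl: "bounded_linear R" and Rscale: "\<And>z f. R (z *\<^sub>C f) = z *\<^sub>C R f"
    and sym: "\<And>f g. inner (R f) g = inner f (R g)" and nonneg: "\<And>f. 0 \<le> inner f (R f)"
    and le: "\<And>f. inner f (R f) \<le> inner f f" and inj: "\<And>f. R f = 0 \<Longrightarrow> f = 0"
  shows "\<exists>E. spectral_resolution {(\<psi>, \<zeta>). R (\<zeta> + c *\<^sub>R \<psi>) = \<psi>} E"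
proof
  interpret injective_contraction R c
    by (intro injective_contraction.intro positive_contraction.intro injective_contraction_axioms.intro) (fact assms)+
  have E_scale: "E l (z *\<^sub>C f) = z *\<^sub>C E l f" for l z f
    unfolding E_def by (rule fc_commute_op[OF poly_limit_E bounded_linear_cscale, symmetric]) (simp add: Rscale)
  have E_add: "E l (f + g) = E l f + E l g" for l f g
    unfolding E_def by (rule linear_add[OF linear_fc[OF poly_limit_E]])
  have E_cinner: "cinner f (E l g) = cinner (E l f) g" for f g l
  proof (rule complex_eqI)
    show "Re (cinner f (E l g)) = Re (cinner (E l f) g)" using E_sym[of l f g] by (simp add: inner_L2_def)
    show "Im (cinner f (E l g)) = Im (cinner (E l f) g)"
      using E_sym[of l "\<i> *\<^sub>C f" g] by (simp add: inner_cscale_i[symmetric] E_scale)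
  qed
  have "orthogonal_projection (E l)" for l
    unfolding orthogonal_projection_def
    by (intro conjI allI linear_cscaleI E_add E_scale E_cinner) (simp add: E_E)
  then have res: "resolution_of_identity E"
    unfolding resolution_of_identity_def using E_E E_right_continuous E_at_bot E_at_top by blast
  have nu: "spectral_measure E \<psi> = \<nu> \<psi>" for \<psi>
    unfolding spectral_measure_def interval_measure_E[symmetric] inner_L2_def ..
  let ?T = "{(\<psi>, \<zeta>). R (\<zeta> + c *\<^sub>R \<psi>) = \<psi>}"
  have T_iff: "(R \<eta>, \<eta> - c *\<^sub>R R \<eta>) \<in> ?T" for \<eta> by simp
  have "Domain ?T = range R"
  proof (intro equalityI subsetI)
    fix \<psi> assume "\<psi> \<in> range R"
    then show "\<psi> \<in> Domain ?T" using T_iff by blast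
  qed (auto, metis rangeI)
  moreover have "cinner \<psi> \<zeta> = complex_of_real (LINT l|\<nu> \<psi>. l)" if "(\<psi>, \<zeta>) \<in> ?T" for \<psi> \<zeta>
  proof -
    define \<eta> where "\<eta> = \<zeta> + c *\<^sub>R \<psi>"
    have \<psi>: "\<psi> = R \<eta>" and \<zeta>: "\<zeta> = \<eta> - c *\<^sub>R R \<eta>" using that by (auto simp: \<eta>_def)
    have eq: "(LINT l|\<nu> \<psi>. l) = Re (cinner \<psi> \<zeta>)"
      unfolding \<psi> \<zeta> integral_\<nu>_A inner_L2_def ..
    \<comment> \<open>The real calculus determines only the real part of
      \<open>cinner \<psi> \<zeta>\<close>. The imaginary part vanishes because \<open>R\<close> is
      symmetric and commutes with \<open>\<i>\<close>.\<close>
    have "inner (\<i> *\<^sub>C R \<eta>) \<eta> = inner (R (\<i> *\<^sub>C \<eta>)) \<eta>" by (simp add: Rscale)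
    also have "\<dots> = inner (\<i> *\<^sub>C \<eta>) (R \<eta>)" by (rule sym)
    finally have "Im (cinner (R \<eta>) \<eta>) = Im (cinner \<eta> (R \<eta>))" by (simp add: inner_cscale_i)
    then have "Im (cinner (R \<eta>) \<eta>) = 0" using cinner_commute[of "R \<eta>" \<eta>] by simp
    moreover have "cinner \<psi> \<eta> = cinner \<psi> \<zeta> + complex_of_real c * cinner \<psi> \<psi>"
      unfolding \<eta>_def by (simp add: cinner_plus_right scaleR_cscale cinner_cscale_right)
    ultimately have "Im (cinner \<psi> \<zeta>) = 0" by (simp add: \<psi> cinner_self)
    then show ?thesis by (simp add: eq complex_eq_iff)
  qed
  moreover have "{\<psi>. integrable (\<nu> \<psi>) (\<lambda>l. l\<^sup>2)} = range R" by (simp add: domain_iff)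
  ultimately show "spectral_resolution ?T E"
    unfolding spectral_resolution_def nu using res by blast
qed

section \<open>Sesquilinear forms on a subspace and the variational resolvent\<close>

locale sesquilinear_form =
  fixes Q :: "'a::euclidean_space L2 set" and q :: "'a form"
  assumes zero_Q: "0 \<in> Q"
    and add_Q: "\<phi> \<in> Q \<Longrightarrow> \<psi> \<in> Q \<Longrightarrow> \<phi> + \<psi> \<in> Q"
    and scale_Q: "\<phi> \<in> Q \<Longrightarrow> z *\<^sub>C \<phi> \<in> Q"
    and q_add_right: "\<xi> \<in> Q \<Longrightarrow> \<phi> \<in> Q \<Longrightarrow> \<psi> \<in> Q \<Longrightarrow> q \<xi> (\<phi> + \<psi>) = q \<xi> \<phi> + q \<xi> \<psi>"
    and q_scale_right: "\<xi> \<in> Q \<Longrightarrow> \<phi> \<in> Q \<Longrightarrow> q \<xi> (z *\<^sub>C \<phi>) = z * q \<xi> \<phi>"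
    and q_commute: "\<phi> \<in> Q \<Longrightarrow> \<psi> \<in> Q \<Longrightarrow> q \<psi> \<phi> = cnj (q \<phi> \<psi>)"
begin

lemma q_add_left: "\<xi> \<in> Q \<Longrightarrow> \<phi> \<in> Q \<Longrightarrow> \<psi> \<in> Q \<Longrightarrow> q (\<phi> + \<psi>) \<xi> = q \<phi> \<xi> + q \<psi> \<xi>"
  by (simp add: q_commute[of \<xi>] q_add_right add_Q)

lemma q_scale_left: "\<xi> \<in> Q \<Longrightarrow> \<phi> \<in> Q \<Longrightarrow> q (z *\<^sub>C \<phi>) \<xi> = cnj z * q \<phi> \<xi>"
  by (simp add: q_commute[of \<xi>] q_scale_right scale_Q)

lemma diff_eq: "\<phi> - \<psi> = \<phi> + (- 1) *\<^sub>C (\<psi> :: 'a L2)"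
  unfolding minus_L2_def uminus_L2_def ..

lemma diff_Q: "\<phi> \<in> Q \<Longrightarrow> \<psi> \<in> Q \<Longrightarrow> \<phi> - \<psi> \<in> Q"
  unfolding diff_eq by (intro add_Q scale_Q)

lemma q_diff_right: "\<xi> \<in> Q \<Longrightarrow> \<phi> \<in> Q \<Longrightarrow> \<psi> \<in> Q \<Longrightarrow> q \<xi> (\<phi> - \<psi>) = q \<xi> \<phi> - q \<xi> \<psi>"
proof -
  assume *: "\<xi> \<in> Q" "\<phi> \<in> Q" "\<psi> \<in> Q"
  have "q \<xi> (\<phi> - \<psi>) = q \<xi> \<phi> + (- 1) * q \<xi> \<psi>"
    unfolding diff_eq by (simp only: q_add_right q_scale_right scale_Q *)
  then show ?thesis by simp
qed

lemma q_diff_left: "\<xi> \<in> Q \<Longrightarrow> \<phi> \<in> Q \<Longrightarrow> \<psi> \<in> Q \<Longrightarrow> q (\<phi> - \<psi>) \<xi> = q \<phi> \<xi> - q \<psi> \<xi>"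
  by (simp add: q_commute[of \<xi>] q_diff_right diff_Q)

lemma Im_q_self: "\<phi> \<in> Q \<Longrightarrow> Im (q \<phi> \<phi>) = 0"
  using q_commute[of \<phi> \<phi>] by (simp add: complex_eq_iff)

end

text \<open>\<open>total\<close> is density of the form domain, expressed by a trivial orthogonal
  complement; this is the shape in which it yields injectivity of the resolvent.\<close>

locale closed_semibounded_form = sesquilinear_form +
  assumes bounded_below: "bounded_below_form Q q"
    and closed: "closed_form Q q"
    and total: "(\<And>\<phi>. \<phi> \<in> Q \<Longrightarrow> cinner \<phi> f = 0) \<Longrightarrow> f = 0"
begin

text \<open>The added 1 makes the shifted form dominate the squared norm with constant 1, whence the
  resolvent is a contraction.\<close>

definition c :: real where
  "c = (SOME c. \<forall>\<psi>\<in>Q. - c * (norm \<psi>)\<^sup>2 \<le> Re (q \<psi> \<psi>)) + 1"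

definition a :: "'a L2 \<Rightarrow> 'a L2 \<Rightarrow> complex" where
  "a \<phi> \<psi> = q \<phi> \<psi> + complex_of_real c * cinner \<phi> \<psi>"

lemma a_ge: assumes "\<psi> \<in> Q" shows "(norm \<psi>)\<^sup>2 \<le> Re (a \<psi> \<psi>)"
proof -
  have "\<forall>\<psi>\<in>Q. - (SOME c. \<forall>\<psi>\<in>Q. - c * (norm \<psi>)\<^sup>2 \<le> Re (q \<psi> \<psi>)) * (norm \<psi>)\<^sup>2 \<le> Re (q \<psi> \<psi>)"
    using bounded_below unfolding bounded_below_form_def by (rule someI_ex)
  then have "- (c - 1) * (norm \<psi>)\<^sup>2 \<le> Re (q \<psi> \<psi>)" using assms by (simp add: c_def)
  then show ?thesis by (simp add: a_def cinner_self algebra_simps del: of_real_power)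
qed

sublocale a: sesquilinear_form Q a
proof
  fix \<phi> \<psi> assume "\<phi> \<in> Q" "\<psi> \<in> Q"
  then show "a \<psi> \<phi> = cnj (a \<phi> \<psi>)"
    using q_commute[of \<phi> \<psi>] cinner_commute[of \<psi> \<phi>] by (simp add: a_def)
qed (auto simp: a_def zero_Q add_Q scale_Q q_add_right q_scale_right cinner_plus_right cinner_cscale_right
       distrib_left mult_ac)

lemma a_Cauchy_Schwarz:
  assumes "\<phi> \<in> Q" "\<psi> \<in> Q"
  shows "(Re (a \<phi> \<psi>))\<^sup>2 \<le> Re (a \<phi> \<phi>) * Re (a \<psi> \<psi>)"
proof -
  have *: "0 \<le> Re (a \<phi> \<phi>) + 2 * t * Re (a \<phi> \<psi>) + t\<^sup>2 * Re (a \<psi> \<psi>)" for t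
  proof -
    have "0 \<le> Re (a (\<phi> + complex_of_real t *\<^sub>C \<psi>) (\<phi> + complex_of_real t *\<^sub>C \<psi>))"
      by (rule order_trans[OF zero_le_power2 a_ge]) (intro add_Q scale_Q assms)
    also have "\<dots> = Re (a \<phi> \<phi>) + 2 * t * Re (a \<phi> \<psi>) + t\<^sup>2 * Re (a \<psi> \<psi>)"
      using a.q_commute[OF assms]
      by (simp add: a.q_add_left a.q_add_right a.q_scale_left a.q_scale_right assms add_Q scale_Q power2_eq_square algebra_simps)
    finally show ?thesis .
  qed
  show ?thesis
  proof (cases "\<psi> = 0")
    case True
    have "a \<phi> 0 = 0" using a.q_scale_right[of \<phi> 0 0] assms zero_Q by simp
    then show ?thesis using True a.q_scale_right[of 0 0 0] zero_Q by simp
  next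
    case False
    then have pos: "0 < Re (a \<psi> \<psi>)" using a_ge[OF assms(2)] by (smt (verit) zero_less_norm_iff zero_less_power)
    show ?thesis
      using *[of "- Re (a \<phi> \<psi>) / Re (a \<psi> \<psi>)"] pos by (simp add: field_simps power2_eq_square)
  qed
qed

text \<open>The direct method: \<open>J\<close> is bounded below, the parallelogram identity makes a
  minimising sequence Cauchy for \<open>a\<close>, closedness keeps the limit in \<open>Q\<close>,
  and the desired equation is the vanishing of the first variation of \<open>J\<close>.\<close>

lemma representation_exists: "\<exists>\<psi>\<in>Q. \<forall>\<phi>\<in>Q. Re (a \<phi> \<psi>) = inner \<phi> \<eta>"
proof -
  define J where "J \<phi> = Re (a \<phi> \<phi>) - 2 * inner \<phi> \<eta>" for \<phi>
  have J_ge: "- (norm \<eta>)\<^sup>2 \<le> J \<phi>" if "\<phi> \<in> Q" for \<phi>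
  proof -
    have "0 \<le> (norm (\<phi> - \<eta>))\<^sup>2" by simp
    also have "\<dots> = (norm \<phi>)\<^sup>2 - 2 * inner \<phi> \<eta> + (norm \<eta>)\<^sup>2"
      by (simp add: power2_norm_eq_inner inner_diff_left inner_diff_right inner_commute)
    finally show ?thesis using a_ge[OF that] by (simp add: J_def)
  qed
  have bdd: "bdd_below (J ` Q)" by (rule bdd_belowI2[OF J_ge])
  define m where "m = Inf (J ` Q)"
  have m_le: "m \<le> J \<phi>" if "\<phi> \<in> Q" for \<phi> unfolding m_def using that bdd by (auto intro: cInf_lower)
  have "\<exists>\<phi>\<in>Q. J \<phi> < m + inverse (real (Suc n))" for n
  proof -
    have "Inf (J ` Q) < m + inverse (real (Suc n))" unfolding m_def by simp
    then show ?thesis using zero_Q by (subst (asm) cInf_less_iff) (auto intro: bdd)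
  qed
  then obtain s where s: "\<And>n. s n \<in> Q" and sJ: "\<And>n. J (s n) < m + inverse (real (Suc n))" by metis
  define e where "e n = inverse (real (Suc n))" for n
  have e0: "e \<longlonglongrightarrow> 0" unfolding e_def by (rule LIMSEQ_inverse_real_of_nat)
  have ineq: "Re (a (s k - s n) (s k - s n)) \<le> 2 * e k + 2 * e n" for k n
  proof -
    \<comment> \<open>The midpoint competes with \<open>s k\<close> and \<open>s n\<close>: as its
      value is at least \<open>m\<close>, the parallelogram identity forces the two vectors to be
      close.\<close>
    define h where "h = (1/2) *\<^sub>C (s k + s n)"
    have hQ: "h \<in> Q" unfolding h_def by (intro scale_Q add_Q s)
    have "4 * J h = Re (a (s k) (s k)) + 2 * Re (a (s k) (s n)) + Re (a (s n) (s n)) - 4 * inner (s k) \<eta> - 4 * inner (s n) \<eta>"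
      using a.q_commute[OF s s, of k n]
      by (simp add: J_def h_def a.q_add_left a.q_add_right a.q_scale_left a.q_scale_right s add_Q scale_Q inner_L2_def
        cinner_plus_left cinner_cscale_left algebra_simps)
    moreover have "Re (a (s k - s n) (s k - s n)) = Re (a (s k) (s k)) - 2 * Re (a (s k) (s n)) + Re (a (s n) (s n))"
      using a.q_commute[OF s s, of k n] by (simp add: a.q_diff_left a.q_diff_right s a.diff_Q)
    ultimately have "Re (a (s k - s n) (s k - s n)) = 2 * J (s k) + 2 * J (s n) - 4 * J h"
      by (simp add: J_def)
    then show ?thesis using m_le[OF hQ] sJ[of k] sJ[of n] by (simp add: e_def)
  qed
  have "convergent s"
  proof (rule convergent_if_sq_dist_le[OF _ e0])
    show "(norm (s k - s n))\<^sup>2 \<le> 2 * e k + 2 * e n" for k n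
      using a_ge[OF diff_Q[OF s s]] ineq order_trans by blast
  qed
  then obtain \<psi> where lim: "s \<longlonglongrightarrow> \<psi>" by (auto simp: convergent_def)
  \<comment> \<open>The sequence is Cauchy for \<open>a\<close>, whereas \<open>closed_form\<close>
    asks for the Cauchy property of \<open>q\<close>.\<close>
  have q_le: "cmod (q \<xi> \<xi>) \<le> (1 + \<bar>c\<bar>) * Re (a \<xi> \<xi>)" if "\<xi> \<in> Q" for \<xi>
  proof -
    have "cmod (q \<xi> \<xi>) = \<bar>Re (q \<xi> \<xi>)\<bar>" using Im_q_self[OF that] by (simp add: cmod_eq_Re)
    also have "\<dots> = \<bar>Re (a \<xi> \<xi>) - c * (norm \<xi>)\<^sup>2\<bar>" by (simp add: a_def cinner_self del: of_real_power)
    also have "\<dots> \<le> \<bar>Re (a \<xi> \<xi>)\<bar> + \<bar>c\<bar> * (norm \<xi>)\<^sup>2"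
      by (rule order_trans[OF abs_triangle_ineq4]) (simp add: abs_mult)
    also have "\<dots> \<le> Re (a \<xi> \<xi>) + \<bar>c\<bar> * Re (a \<xi> \<xi>)"
      using a_ge[OF that] by (intro add_mono mult_left_mono) (auto intro: order_trans[OF zero_le_power2])
    finally show ?thesis by (simp add: algebra_simps)
  qed
  have "\<exists>N. \<forall>k\<ge>N. \<forall>n\<ge>N. cmod (q (s k - s n) (s k - s n)) < r" if r: "0 < r" for r
  proof -
    define d where "d = r / (4 * (1 + \<bar>c\<bar>))"
    have d: "0 < d" using r by (simp add: d_def)
    then obtain N where N: "\<And>n. n \<ge> N \<Longrightarrow> \<bar>e n\<bar> < d" using e0 by (metis LIMSEQ_D diff_zero real_norm_def)
    have "cmod (q (s k - s n) (s k - s n)) < r" if "k \<ge> N" "n \<ge> N" for k n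
    proof -
      have "cmod (q (s k - s n) (s k - s n)) \<le> (1 + \<bar>c\<bar>) * (2 * e k + 2 * e n)"
        by (rule order_trans[OF q_le[OF diff_Q[OF s s]] mult_left_mono[OF ineq]]) simp
      also have "\<dots> < (1 + \<bar>c\<bar>) * (4 * d)"
        using N[OF that(1)] N[OF that(2)] by (intro mult_strict_left_mono) auto
      also have "\<dots> = r"
      proof -
        have "C * (4 * (r / (4 * C))) = r" if "C \<noteq> 0" for C :: real using that by simp
        moreover have "1 + \<bar>c\<bar> \<noteq> 0" by linarith
        ultimately show ?thesis unfolding d_def by blast
      qed
      finally show ?thesis .
    qed
    then show ?thesis by blast
  qed
  then have \<psi>: "\<psi> \<in> Q" and q0: "(\<lambda>n. q (s n - \<psi>) (s n - \<psi>)) \<longlonglongrightarrow> 0"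
    using closed s lim unfolding closed_form_def by blast+
  have "(\<lambda>n. Re (q (s n - \<psi>) (s n - \<psi>)) + c * (norm (s n - \<psi>))\<^sup>2) \<longlonglongrightarrow> Re 0 + c * (norm (\<psi> - \<psi>))\<^sup>2"
    by (intro tendsto_intros q0 lim)
  then have a0: "(\<lambda>n. Re (a (s n - \<psi>) (s n - \<psi>))) \<longlonglongrightarrow> 0"
    by (simp add: a_def cinner_self del: of_real_power)
  show ?thesis
  proof (intro bexI[OF _ \<psi>] ballI)
    fix \<phi> assume \<phi>: "\<phi> \<in> Q"
    have "(\<lambda>n. sqrt (Re (a \<phi> \<phi>) * Re (a (s n - \<psi>) (s n - \<psi>)))) \<longlonglongrightarrow> sqrt (Re (a \<phi> \<phi>) * 0)"
      by (intro tendsto_intros a0)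
    then have sqrt0: "(\<lambda>n. sqrt (Re (a \<phi> \<phi>) * Re (a (s n - \<psi>) (s n - \<psi>)))) \<longlonglongrightarrow> 0" by simp
    have "(\<lambda>n. Re (a \<phi> (s n - \<psi>))) \<longlonglongrightarrow> 0"
    proof (rule Lim_null_comparison[OF _ sqrt0])
      show "\<forall>\<^sub>F n in sequentially. norm (Re (a \<phi> (s n - \<psi>))) \<le> sqrt (Re (a \<phi> \<phi>) * Re (a (s n - \<psi>) (s n - \<psi>)))"
        using a_Cauchy_Schwarz[OF \<phi> diff_Q[OF s \<psi>]] by (intro always_eventually allI real_le_rsqrt) simp
    qed
    then have "(\<lambda>n. Re (a \<phi> (s n - \<psi>)) + Re (a \<phi> \<psi>)) \<longlonglongrightarrow> 0 + Re (a \<phi> \<psi>)" by (intro tendsto_intros)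
    then have alim: "(\<lambda>n. Re (a \<phi> (s n))) \<longlonglongrightarrow> Re (a \<phi> \<psi>)" by (simp add: a.q_diff_right \<phi> \<psi> s)
    define d where "d = Re (a \<phi> \<psi>) - inner \<phi> \<eta>"
    \<comment> \<open>The approximate minimality of \<open>s n\<close> in the direction
      \<open>\<phi>\<close>, with error \<open>e n\<close>, passes to the limit.\<close>
    have quad: "0 \<le> 2 * t * d + t\<^sup>2 * Re (a \<phi> \<phi>)" for t
    proof -
      have "0 \<le> e n + 2 * t * (Re (a \<phi> (s n)) - inner \<phi> \<eta>) + t\<^sup>2 * Re (a \<phi> \<phi>)" for n
      proof -
        have "m \<le> J (s n + complex_of_real t *\<^sub>C \<phi>)" by (intro m_le add_Q scale_Q s \<phi>)
        also have "\<dots> = J (s n) + 2 * t * (Re (a \<phi> (s n)) - inner \<phi> \<eta>) + t\<^sup>2 * Re (a \<phi> \<phi>)"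
          using a.q_commute[OF \<phi> s, of n]
          by (simp add: J_def a.q_add_left a.q_add_right a.q_scale_left a.q_scale_right s \<phi> add_Q scale_Q inner_L2_def
            cinner_plus_left cinner_cscale_left power2_eq_square algebra_simps)
        finally show ?thesis using sJ[of n] by (simp add: e_def)
      qed
      moreover have "(\<lambda>n. e n + 2 * t * (Re (a \<phi> (s n)) - inner \<phi> \<eta>) + t\<^sup>2 * Re (a \<phi> \<phi>)) \<longlonglongrightarrow> 0 + 2 * t * d + t\<^sup>2 * Re (a \<phi> \<phi>)"
        unfolding d_def by (intro tendsto_intros e0 alim)
      ultimately have "0 \<le> 0 + 2 * t * d + t\<^sup>2 * Re (a \<phi> \<phi>)" by (intro LIMSEQ_le_const) auto
      then show ?thesis by simp
    qed
    have "d = 0"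
    proof (rule ccontr)
      assume "d \<noteq> 0"
      \<comment> \<open>A positive upper bound for the quadratic coefficient, also when
        \<open>\<phi> = 0\<close>. At \<open>t = - d / A\<close> the quadratic is then at most
        \<open>- d^2 / A\<close>.\<close>
      define A where "A = Re (a \<phi> \<phi>) + 1"
      have A: "A > 0" using a_ge[OF \<phi>] by (simp add: A_def) (smt (verit) zero_le_power2)
      have "0 \<le> 2 * (- d / A) * d + (- d / A)\<^sup>2 * (A - 1)" using quad[of "- d / A"] by (simp add: A_def)
      also have "\<dots> \<le> 2 * (- d / A) * d + (- d / A)\<^sup>2 * A" by (intro add_left_mono mult_left_mono) auto
      also have "\<dots> = - (d\<^sup>2 / A)" using A by (simp add: field_simps power2_eq_square)
      also have "\<dots> < 0" using A \<open>d \<noteq> 0\<close> by simp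
      finally show False by simp
    qed
    then show "Re (a \<phi> \<psi>) = inner \<phi> \<eta>" by (simp add: d_def)
  qed
qed

lemma representation_exists_complex: "\<exists>\<psi>\<in>Q. \<forall>\<phi>\<in>Q. a \<phi> \<psi> = cinner \<phi> \<eta>"
proof -
  obtain \<psi> where \<psi>: "\<psi> \<in> Q" and eq: "\<And>\<phi>. \<phi> \<in> Q \<Longrightarrow> Re (a \<phi> \<psi>) = inner \<phi> \<eta>"
    using representation_exists by blast
  have "a \<phi> \<psi> = cinner \<phi> \<eta>" if \<phi>: "\<phi> \<in> Q" for \<phi>
  proof (rule complex_eqI)
    show "Re (a \<phi> \<psi>) = Re (cinner \<phi> \<eta>)" using eq[OF \<phi>] by (simp add: inner_L2_def)
    show "Im (a \<phi> \<psi>) = Im (cinner \<phi> \<eta>)"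
      using eq[OF scale_Q[OF \<phi>, of \<i>]] by (simp add: inner_cscale_i a.q_scale_left \<phi> \<psi>)
  qed
  with \<psi> show ?thesis by blast
qed

lemma representation_unique:
  assumes "\<psi> \<in> Q" "\<psi>' \<in> Q" "\<And>\<phi>. \<phi> \<in> Q \<Longrightarrow> a \<phi> \<psi> = a \<phi> \<psi>'"
  shows "\<psi> = \<psi>'"
proof -
  have d: "\<psi> - \<psi>' \<in> Q" by (intro diff_Q assms)
  have "a (\<psi> - \<psi>') (\<psi> - \<psi>') = 0" using assms d by (simp add: a.q_diff_right)
  then have "(norm (\<psi> - \<psi>'))\<^sup>2 \<le> 0" using a_ge[OF d] by simp
  then show ?thesis by simp
qed

text \<open>The resolvent \<open>(T + c)^-1\<close> of the form operator \<open>T\<close>.\<close>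

definition R :: "'a L2 \<Rightarrow> 'a L2" where
  "R \<eta> = (THE \<psi>. \<psi> \<in> Q \<and> (\<forall>\<phi>\<in>Q. a \<phi> \<psi> = cinner \<phi> \<eta>))"

lemma R: "R \<eta> \<in> Q \<and> (\<forall>\<phi>\<in>Q. a \<phi> (R \<eta>) = cinner \<phi> \<eta>)"
  unfolding R_def
proof (rule theI')
  show "\<exists>!\<psi>. \<psi> \<in> Q \<and> (\<forall>\<phi>\<in>Q. a \<phi> \<psi> = cinner \<phi> \<eta>)"
    using representation_exists_complex[of \<eta>] representation_unique by (metis (full_types))
qed

lemma R_eq_iff: "R \<eta> = \<psi> \<longleftrightarrow> \<psi> \<in> Q \<and> (\<forall>\<phi>\<in>Q. a \<phi> \<psi> = cinner \<phi> \<eta>)"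
  using R[of \<eta>] representation_unique[of \<psi> "R \<eta>"] by auto

theorem form_operator_has_spectral_resolution: "\<exists>E. spectral_resolution (form_operator Q q) E"
proof -
  have R_add: "R (f + g) = R f + R g" for f g
    unfolding R_eq_iff using R by (simp add: a.q_add_right add_Q cinner_plus_right)
  have R_scale: "R (z *\<^sub>C f) = z *\<^sub>C R f" for z f
    unfolding R_eq_iff using R by (simp add: a.q_scale_right scale_Q cinner_cscale_right)
  have Raa: "a (R f) (R g) = cinner (R f) g" for f g using R by simp
  have R_sym: "inner (R f) g = inner f (R g)" for f g
  proof -
    have "cinner (R f) g = cnj (cinner (R g) f)" using a.q_commute[of "R g" "R f"] R by (simp add: Raa)
    then show ?thesis by (simp add: inner_L2_def cinner_commute[of f])
  qed
  have inner_R: "inner f (R f) = Re (a (R f) (R f))" for f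
    using R_sym[of f f] by (simp add: Raa inner_L2_def)
  have norm_R: "norm (R f) \<le> norm f" for f
  proof -
    have "(norm (R f))\<^sup>2 \<le> inner f (R f)" unfolding inner_R using a_ge R by blast
    also have "\<dots> \<le> norm f * norm (R f)" by (rule norm_cauchy_schwarz)
    finally show ?thesis
      by (cases "R f = 0") (simp_all add: power2_eq_square)
  qed
  \<comment> \<open>Adding \<open>c\<close> times \<open>cinner \<phi> \<psi>\<close> to both sides
    of the form equation turns it into the equation that defines \<open>R\<close>.\<close>
  have "form_operator Q q = {(\<psi>, \<zeta>). R (\<zeta> + c *\<^sub>R \<psi>) = \<psi>}"
    unfolding form_operator_def R_eq_iff a_def
    by (auto simp: cinner_plus_right scaleR_cscale cinner_cscale_right)
  moreover have "\<exists>E. spectral_resolution {(\<psi>, \<zeta>). R (\<zeta> + c *\<^sub>R \<psi>) = \<psi>} E"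
  proof (rule spectral_resolution_exists[OF _ R_scale R_sym])
    show "bounded_linear R"
      by (rule bounded_linear_intro[of _ 1]) (simp_all add: R_add scaleR_cscale R_scale norm_R)
    show "0 \<le> inner f (R f)" for f
      unfolding inner_R using a_ge[of "R f"] R by (meson order_trans zero_le_power2)
    show "inner f (R f) \<le> inner f f" for f
    proof -
      have "inner f (R f) \<le> norm f * norm (R f)" by (rule norm_cauchy_schwarz)
      also have "\<dots> \<le> norm f * norm f" using norm_R by (intro mult_left_mono) auto
      finally show ?thesis by (simp add: dot_square_norm power2_eq_square)
    qed
    show "f = 0" if "R f = 0" for f
    proof (rule total)
      fix \<phi> assume "\<phi> \<in> Q"
      then have "cinner \<phi> f = a \<phi> 0" using R[of f] that by simp
      also have "\<dots> = 0" using a.q_scale_right[of \<phi> 0 0] \<open>\<phi> \<in> Q\<close> zero_Q by simp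
      finally show "cinner \<phi> f = 0" .
    qed
  qed
  ultimately show ?thesis by simp
qed

end

section \<open>The min-max principle\<close>

text \<open>
  \<open>spectral_projection\<close> chooses among all spectral resolutions, so the min-max principle is
  derived for an arbitrary one rather than for the resolution constructed above.
\<close>

locale form_resolution = sesquilinear_form Q q for Q :: "'a::euclidean_space L2 set" and q +
  fixes E :: "real \<Rightarrow> 'a L2 \<Rightarrow> 'a L2"
  assumes bounded_below: "bounded_below_form Q q"
    and resolution: "spectral_resolution (form_operator Q q) E"
begin

lemma projection_E: "orthogonal_projection (E l)"
  and E_E: "E l (E m \<psi>) = E (min l m) \<psi>"
  and E_right_continuous: "((\<lambda>m. E m \<psi>) \<longlongrightarrow> E l \<psi>) (at_right l)"
  and E_at_bot: "((\<lambda>m. E m \<psi>) \<longlongrightarrow> 0) at_bot"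
  and E_at_top: "((\<lambda>m. E m \<psi>) \<longlongrightarrow> \<psi>) at_top"
  using resolution unfolding spectral_resolution_def resolution_of_identity_def by blast+

lemma linear_E: "Vector_Spaces.linear cscale cscale (E l)"
  using projection_E unfolding orthogonal_projection_def by blast

sublocale E: Vector_Spaces.linear cscale cscale "E l" for l by (rule linear_E)

lemma E_cinner: "cinner \<phi> (E l \<psi>) = cinner (E l \<phi>) \<psi>"
  using projection_E unfolding orthogonal_projection_def by blast

definition F :: "'a L2 \<Rightarrow> real \<Rightarrow> real" where
  "F \<psi> l = (norm (E l \<psi>))\<^sup>2"

lemma F_eq: "Re (cinner \<psi> (E l \<psi>)) = F \<psi> l"
proof -
  have "cinner \<psi> (E l \<psi>) = cinner \<psi> (E l (E l \<psi>))" by (simp add: E_E)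
  also have "\<dots> = cinner (E l \<psi>) (E l \<psi>)" by (rule E_cinner)
  finally show ?thesis by (simp add: F_def cinner_self del: of_real_power)
qed

lemma norm_E_le: "norm (E l \<psi>) \<le> norm \<psi>"
proof -
  have "(norm (E l \<psi>))\<^sup>2 = inner \<psi> (E l \<psi>)" using F_eq[of \<psi> l] by (simp add: F_def inner_L2_def)
  also have "\<dots> \<le> norm \<psi> * norm (E l \<psi>)" by (rule norm_cauchy_schwarz)
  finally show ?thesis by (cases "E l \<psi> = 0") (simp_all add: power2_eq_square)
qed

lemma F_mono: "l \<le> m \<Longrightarrow> F \<psi> l \<le> F \<psi> m"
  using norm_E_le[of l "E m \<psi>"] by (simp add: E_E F_def power_mono)

lemma F_right_continuous: "continuous (at_right l) (F \<psi>)"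
  unfolding continuous_within F_def by (intro tendsto_intros E_right_continuous)

lemma F_at_bot: "(F \<psi> \<longlongrightarrow> 0) at_bot"
proof -
  have "(F \<psi> \<longlongrightarrow> (norm (0::'a L2))\<^sup>2) at_bot" unfolding F_def by (intro tendsto_intros E_at_bot)
  then show ?thesis by simp
qed

lemma F_at_top: "(F \<psi> \<longlongrightarrow> (norm \<psi>)\<^sup>2) at_top"
  unfolding F_def by (intro tendsto_intros E_at_top)

definition sm :: "'a L2 \<Rightarrow> real measure" where
  "sm \<psi> = spectral_measure E \<psi>"

lemma sm_eq: "sm \<psi> = interval_measure (F \<psi>)"
  by (simp add: sm_def spectral_measure_def F_eq)

lemma finite_borel_sm: "finite_borel_measure (sm \<psi>)"
  unfolding sm_eq by (rule finite_borel_measure_interval_measure[OF F_mono F_right_continuous F_at_bot F_at_top]) auto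

sublocale sm: finite_borel_measure "sm \<psi>" for \<psi> by (rule finite_borel_sm)

lemma sets_sm [simp, measurable_cong]: "sets (sm \<psi>) = sets borel"
  by (simp add: sm_eq)

lemma space_sm [simp]: "space (sm \<psi>) = UNIV"
  by (simp add: sm_eq)

lemma cdf_sm: "cdf (sm \<psi>) = F \<psi>"
  unfolding sm_eq by (intro cdf_interval_measure F_mono F_right_continuous F_at_bot)

lemma measure_sm_UNIV: "measure (sm \<psi>) UNIV = (norm \<psi>)\<^sup>2"
  unfolding measure_def sm_eq
  by (subst interval_measure_UNIV[OF F_mono F_right_continuous F_at_bot F_at_top]) auto

lemma AE_sm_upper:
  assumes "E n \<psi> = \<psi>" shows "AE l in sm \<psi>. l \<le> n"
proof -
  have "measure (sm \<psi>) (UNIV - {..n}) = measure (sm \<psi>) UNIV - measure (sm \<psi>) {..n}"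
    using sm.finite_measure_compl[of "{..n}" \<psi>] by simp
  also have "measure (sm \<psi>) {..n} = (norm \<psi>)\<^sup>2"
    using fun_cong[OF cdf_sm, of \<psi> n] assms by (simp add: cdf_def F_def)
  finally have "measure (sm \<psi>) (UNIV - {..n}) = 0" by (simp add: measure_sm_UNIV)
  then show ?thesis by (intro AE_I[of _ _ "UNIV - {..n}"]) (auto simp: sm.emeasure_eq_measure)
qed

lemma AE_sm_lower:
  assumes "E m \<psi> = 0" shows "AE l in sm \<psi>. m < l"
proof -
  have "measure (sm \<psi>) {..m} = 0"
    using fun_cong[OF cdf_sm, of \<psi> m] assms by (simp add: cdf_def F_def)
  then show ?thesis by (intro AE_I[of _ _ "{..m}"]) (auto simp: sm.emeasure_eq_measure)
qed

lemma Domain_eq: "Domain (form_operator Q q) = {\<psi>. integrable (sm \<psi>) (\<lambda>l. l\<^sup>2)}"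
  using resolution unfolding spectral_resolution_def sm_def by blast

lemma DomainD:
  assumes "\<psi> \<in> Domain (form_operator Q q)"
  shows "\<psi> \<in> Q" "q \<psi> \<psi> = complex_of_real (LINT l|sm \<psi>. l)" "integrable (sm \<psi>) (\<lambda>l. l)"
    "\<exists>\<zeta>. \<forall>\<phi>\<in>Q. q \<phi> \<psi> = cinner \<phi> \<zeta>"
proof -
  obtain \<zeta> where \<zeta>: "(\<psi>, \<zeta>) \<in> form_operator Q q" using assms by blast
  then show Q: "\<psi> \<in> Q" and "\<exists>\<zeta>. \<forall>\<phi>\<in>Q. q \<phi> \<psi> = cinner \<phi> \<zeta>" by (auto simp: form_operator_def)
  have "q \<psi> \<psi> = cinner \<psi> \<zeta>" using \<zeta> Q by (auto simp: form_operator_def)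
  also have "\<dots> = complex_of_real (LINT l|sm \<psi>. l)"
    using resolution \<zeta> unfolding spectral_resolution_def sm_def by blast
  finally show "q \<psi> \<psi> = complex_of_real (LINT l|sm \<psi>. l)" .
  show "integrable (sm \<psi>) (\<lambda>l. l)"
  proof (rule Bochner_Integration.integrable_bound)
    show "integrable (sm \<psi>) (\<lambda>l. 1 + l\<^sup>2)" using assms by (simp add: Domain_eq)
    have "\<bar>l\<bar> \<le> 1 + l\<^sup>2" for l :: real
    proof -
      have "0 \<le> (1 - \<bar>l\<bar>)\<^sup>2" by simp
      then show ?thesis by (simp add: power2_eq_square algebra_simps)
    qed
    then show "AE l in sm \<psi>. norm l \<le> norm (1 + l\<^sup>2)"
      by (intro always_eventually allI) (simp add: abs_of_nonneg)
  qed simp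
qed

text \<open>The spectral measure of such a vector lives on the bounded interval
  \<open>{m<..n}\<close>.\<close>

lemma Domain_if_bounded:
  assumes "E n \<psi> = \<psi>" "E m \<psi> = 0" shows "\<psi> \<in> Domain (form_operator Q q)"
proof -
  have "integrable (sm \<psi>) (\<lambda>l. l\<^sup>2)"
  proof (rule sm.integrable_const_bound[where B = "(\<bar>m\<bar> + \<bar>n\<bar>)\<^sup>2"])
    show "AE l in sm \<psi>. norm (l\<^sup>2) \<le> (\<bar>m\<bar> + \<bar>n\<bar>)\<^sup>2"
      using AE_sm_upper[OF assms(1)] AE_sm_lower[OF assms(2)]
    proof eventually_elim
      case (elim l)
      then have "\<bar>l\<bar> \<le> \<bar>m\<bar> + \<bar>n\<bar>" by linarith
      then have "\<bar>l\<bar>\<^sup>2 \<le> (\<bar>m\<bar> + \<bar>n\<bar>)\<^sup>2" by (rule power_mono) simp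
      then show ?case by simp
    qed
  qed simp
  then show ?thesis by (simp add: Domain_eq)
qed

lemma q_le_Domain:
  assumes "\<psi> \<in> Domain (form_operator Q q)" "E n \<psi> = \<psi>"
  shows "Re (q \<psi> \<psi>) \<le> n * (norm \<psi>)\<^sup>2"
proof -
  have "(LINT l|sm \<psi>. l) \<le> (LINT l|sm \<psi>. n)"
    by (rule integral_mono_AE) (use DomainD(3)[OF assms(1)] AE_sm_upper[OF assms(2)] in auto)
  then show ?thesis by (simp add: DomainD(2)[OF assms(1)] measure_sm_UNIV mult.commute)
qed

lemma q_ge_Domain:
  assumes "\<psi> \<in> Domain (form_operator Q q)" "E m \<psi> = 0"
  shows "m * (norm \<psi>)\<^sup>2 \<le> Re (q \<psi> \<psi>)"
proof -
  have "(LINT l|sm \<psi>. m) \<le> (LINT l|sm \<psi>. l)"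
    by (rule integral_mono_AE)
      (use DomainD(3)[OF assms(1)] AE_sm_lower[OF assms(2)] in \<open>auto elim!: eventually_mono\<close>)
  then show ?thesis by (simp add: DomainD(2)[OF assms(1)] measure_sm_UNIV mult.commute)
qed

text \<open>For \<open>m < n \<le> - c - 1\<close> the energy of
  \<open>E n \<psi> - E m \<psi>\<close> is at most \<open>n\<close> times its squared norm, below
  what the form allows for a nonzero vector. Hence \<open>E\<close> is constant down there and equal
  to its limit 0.\<close>

lemma E_eventually_0: "\<exists>b. \<forall>m\<le>b. \<forall>\<psi>. E m \<psi> = 0"
proof -
  obtain c where c: "\<And>\<psi>. \<psi> \<in> Q \<Longrightarrow> - c * (norm \<psi>)\<^sup>2 \<le> Re (q \<psi> \<psi>)"
    using bounded_below unfolding bounded_below_form_def by blast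
  have "E n \<psi> = 0" if n: "n \<le> - c - 1" for n \<psi>
  proof -
    have eq: "E n \<psi> = E m \<psi>" if "m < n" for m
    proof -
      define \<phi> where "\<phi> = E n \<psi> - E m \<psi>"
      have 1: "E n \<phi> = \<phi>" and 2: "E m \<phi> = 0" using that by (simp_all add: \<phi>_def E.diff E_E min_def)
      note D = Domain_if_bounded[OF 1 2]
      have "- c * (norm \<phi>)\<^sup>2 \<le> n * (norm \<phi>)\<^sup>2"
        using c[OF DomainD(1)[OF D]] q_le_Domain[OF D 1] by linarith
      also have "\<dots> \<le> (- c - 1) * (norm \<phi>)\<^sup>2" using n by (intro mult_right_mono) auto
      finally have "(norm \<phi>)\<^sup>2 \<le> 0" by (simp add: algebra_simps)
      then show ?thesis by (simp add: \<phi>_def)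
    qed
    have "((\<lambda>m. E m \<psi>) \<longlongrightarrow> E n \<psi>) at_bot"
    proof (rule tendsto_eventually)
      show "\<forall>\<^sub>F m in at_bot. E m \<psi> = E n \<psi>"
        unfolding eventually_at_bot_dense using eq by metis
    qed
    from tendsto_unique[OF _ this E_at_bot] show ?thesis by simp
  qed
  then show ?thesis by blast
qed

lemma Domain_if_upper:
  assumes "E l \<psi> = \<psi>" shows "\<psi> \<in> Domain (form_operator Q q)"
  using E_eventually_0 Domain_if_bounded[OF assms] by blast

lemma q_le:
  assumes "E l \<psi> = \<psi>" shows "\<psi> \<in> Q" "Re (q \<psi> \<psi>) \<le> l * (norm \<psi>)\<^sup>2"
  using DomainD(1) q_le_Domain Domain_if_upper[OF assms] assms by blast+

text \<open>
  The restrictions of the spectral measure of \<open>\<phi> + \<xi>\<close> to \<open>{..n}\<close> and \<open>{n<..}\<close> have the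
  distribution functions of \<open>\<xi>\<close> and \<open>\<phi>\<close>.
\<close>

lemma q_orthogonal_sum:
  assumes \<phi>: "E k \<phi> = \<phi>" "E n \<phi> = 0" and \<xi>: "E n \<xi> = \<xi>"
  shows "q (\<phi> + \<xi>) (\<phi> + \<xi>) = q \<phi> \<phi> + q \<xi> \<xi>"
proof -
  let ?M = "sm (\<phi> + \<xi>)"
  have E\<phi>: "E l \<phi> = 0" if "l \<le> n" for l
  proof -
    have "E l \<phi> = E l (E n \<phi>)" using that by (simp add: E_E min_def)
    then show ?thesis using \<phi> by (simp add: E.zero)
  qed
  have E\<xi>: "E l \<xi> = \<xi>" if "n \<le> l" for l
  proof -
    have "E l \<xi> = E l (E n \<xi>)" by (simp only: \<xi>)
    also have "\<dots> = E (min l n) \<xi>" by (rule E_E)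
    also have "\<dots> = \<xi>" using that by (simp add: min_absorb2 \<xi>)
    finally show ?thesis .
  qed
  have F_low: "F (\<phi> + \<xi>) l = F \<xi> l" if "l \<le> n" for l
    using that by (simp add: F_def E.add E\<phi>)
  have F_high: "F (\<phi> + \<xi>) l = F \<phi> l + (norm \<xi>)\<^sup>2" if "n \<le> l" for l
  proof -
    have "cinner (E l \<phi>) \<xi> = cinner (E l \<phi>) (E n \<xi>)" by (simp add: \<xi>)
    also have "\<dots> = cinner (E n (E l \<phi>)) \<xi>" by (rule E_cinner)
    also have "\<dots> = 0" using that by (simp add: E_E min_def \<phi>)
    finally have "inner (E l \<phi>) \<xi> = 0" by (simp add: inner_L2_def)
    moreover have "inner \<xi> (E l \<phi>) = inner (E l \<phi>) \<xi>" by (rule inner_commute)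
    ultimately show ?thesis using that
      by (simp add: F_def E.add E\<xi> power2_norm_eq_inner inner_add_left inner_add_right)
  qed
  have fin: "finite_borel_measure (density ?M (\<lambda>x. ennreal (indicator A x)))" if [measurable]: "A \<in> sets borel" for A
  proof -
    have "emeasure (density ?M (\<lambda>x. ennreal (indicator A x))) (space (density ?M (\<lambda>x. ennreal (indicator A x)))) = emeasure ?M A"
      by (simp add: emeasure_density ennreal_indicator)
    then have "finite_measure (density ?M (\<lambda>x. ennreal (indicator A x)))"
      by (intro finite_measureI) (simp add: sm.emeasure_eq_measure)
    then show ?thesis by (simp add: finite_borel_measure_def finite_borel_measure_axioms_def)
  qed
  have cdf_dens: "cdf (density ?M (\<lambda>x. ennreal (indicator A x))) l = measure ?M (A \<inter> {..l})" if [measurable]: "A \<in> sets borel" for A l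
    unfolding cdf_def measure_def
    by (simp add: emeasure_density ennreal_indicator nn_integral_multc[symmetric] flip: indicator_inter_arith)
  have m\<xi>: "density ?M (\<lambda>x. ennreal (indicator {..n} x)) = sm \<xi>"
  proof (rule cdf_unique'[OF fin finite_borel_sm])
    show "cdf (density ?M (\<lambda>x. ennreal (indicator {..n} x))) = cdf (sm \<xi>)"
    proof
      fix l
      have "measure ?M ({..n} \<inter> {..l}) = F (\<phi> + \<xi>) (min n l)"
        using fun_cong[OF cdf_sm, of "\<phi> + \<xi>" "min n l"] by (simp add: cdf_def)
      also have "\<dots> = F \<xi> l"
      proof (cases "n \<le> l")
        case True
        then show ?thesis using F_low[of n] by (simp add: F_def \<xi> E\<xi>)
      qed (simp add: F_low)
      finally show "cdf (density ?M (\<lambda>x. ennreal (indicator {..n} x))) l = cdf (sm \<xi>) l"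
        by (simp add: cdf_dens cdf_sm)
    qed
  qed simp
  have m\<phi>: "density ?M (\<lambda>x. ennreal (indicator {n<..} x)) = sm \<phi>"
  proof (rule cdf_unique'[OF fin finite_borel_sm])
    show "cdf (density ?M (\<lambda>x. ennreal (indicator {n<..} x))) = cdf (sm \<phi>)"
    proof
      fix l
      have "measure ?M ({n<..} \<inter> {..l}) = F \<phi> l"
      proof (cases "n < l")
        case True
        then have "{n<..} \<inter> {..l} = {n<..l}" by auto
        then have "measure ?M ({n<..} \<inter> {..l}) = F (\<phi> + \<xi>) l - F (\<phi> + \<xi>) n"
          using sm.cdf_diff_eq[OF True] by (simp add: cdf_sm)
        moreover have "F (\<phi> + \<xi>) n = (norm \<xi>)\<^sup>2" using F_low[of n] by (simp add: F_def \<xi>)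
        ultimately show ?thesis using True F_high[of l] by simp
      next
        case False
        then have "{n<..} \<inter> {..l} = {}" by auto
        then show ?thesis using False by (simp add: F_def E\<phi>)
      qed
      then show "cdf (density ?M (\<lambda>x. ennreal (indicator {n<..} x))) l = cdf (sm \<phi>) l"
        by (simp add: cdf_dens cdf_sm)
    qed
  qed simp
  \<comment> \<open>A common level for both summands puts the sum into the operator domain, where
    the energy is a spectral integral.\<close>
  define K where "K = max k n"
  have "E K (E k \<phi>) = E k \<phi>" "E K (E n \<xi>) = E n \<xi>" by (simp_all add: E_E K_def min_def)
  then have K: "E K (\<phi> + \<xi>) = \<phi> + \<xi>" by (simp add: E.add \<phi> \<xi>)
  note D = Domain_if_upper[OF K] and D\<phi> = Domain_if_upper[OF \<phi>(1)] and D\<xi> = Domain_if_upper[OF \<xi>]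
  have int: "integrable ?M (\<lambda>l. indicator A l * l)" if "A \<in> sets borel" for A
    using integrable_mult_indicator[OF _ DomainD(3)[OF D], of A] that by simp
  have "(LINT l|?M. l) = (LINT l|?M. indicator {n<..} l * l + indicator {..n} l * l)"
    by (rule Bochner_Integration.integral_cong) (auto simp: indicator_def)
  also have "\<dots> = (LINT l|?M. indicator {n<..} l * l) + (LINT l|?M. indicator {..n} l * l)"
    by (intro Bochner_Integration.integral_add int) auto
  also have "(LINT l|?M. indicator {n<..} l * l) = (LINT l|sm \<phi>. l)"
    unfolding m\<phi>[symmetric] by (subst integral_density) auto
  also have "(LINT l|?M. indicator {..n} l * l) = (LINT l|sm \<xi>. l)"
    unfolding m\<xi>[symmetric] by (subst integral_density) auto
  finally show ?thesis by (simp add: DomainD(2) D D\<phi> D\<xi>)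
qed

text \<open>Polarisation: additivity of the energy for \<open>\<phi> + z *\<^sub>C \<xi>\<close>
  removes the real part of the cross term for \<open>z = 1\<close> and the imaginary part for
  \<open>z = \<i>\<close>.\<close>

lemma q_orthogonal:
  assumes \<phi>: "E k \<phi> = \<phi>" "E n \<phi> = 0" and \<xi>: "E n \<xi> = \<xi>"
  shows "q \<phi> \<xi> = 0"
proof -
  note Q\<phi> = q_le(1)[OF \<phi>(1)] and Q\<xi> = q_le(1)[OF \<xi>]
  have *: "Re (z * q \<phi> \<xi>) = 0" for z
  proof -
    have "E n (z *\<^sub>C \<xi>) = z *\<^sub>C \<xi>" by (simp add: E.scale \<xi>)
    from q_orthogonal_sum[OF \<phi> this]
    have "q \<phi> (z *\<^sub>C \<xi>) + q (z *\<^sub>C \<xi>) \<phi> = 0"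
      by (simp add: q_add_left q_add_right Q\<phi> Q\<xi> scale_Q add_Q) (simp add: add.commute)
    then have "Re (q \<phi> (z *\<^sub>C \<xi>)) + Re (q (z *\<^sub>C \<xi>) \<phi>) = 0" by (metis plus_complex.sel(1) zero_complex.sel(1))
    then show ?thesis
      using q_commute[of \<phi> "z *\<^sub>C \<xi>"] by (simp add: Q\<phi> Q\<xi> scale_Q q_scale_right)
  qed
  from *[of 1] *[of "\<i>"] show ?thesis by (simp add: complex_eq_iff)
qed

text \<open>As \<open>\<xi>\<close> lies in the operator domain, \<open>q\<close> with second
  argument \<open>\<xi>\<close> is an \<open>L2\<close> inner product with a fixed vector and so
  passes to the limit \<open>E k \<phi> \<longlonglongrightarrow> \<phi>\<close>. For
  \<open>\<phi>\<close> itself only membership in the form domain is known.\<close>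

lemma q_orthogonal_Q:
  assumes \<phi>: "\<phi> \<in> Q" "E n \<phi> = 0" and \<xi>: "E n \<xi> = \<xi>"
  shows "q \<phi> \<xi> = 0"
proof -
  obtain \<zeta> where \<zeta>: "\<And>\<phi>. \<phi> \<in> Q \<Longrightarrow> q \<phi> \<xi> = cinner \<phi> \<zeta>" using DomainD(4)[OF Domain_if_upper[OF \<xi>]] by blast
  have 0: "cinner (E k \<phi>) \<zeta> = 0" for k
  proof -
    have 1: "E k (E k \<phi>) = E k \<phi>" by (simp add: E_E)
    have "E n (E k \<phi>) = E k (E n \<phi>)" by (simp add: E_E min.commute)
    then have "E n (E k \<phi>) = 0" by (simp add: \<phi> E.zero)
    from q_orthogonal[OF 1 this \<xi>] show ?thesis using \<zeta>[OF q_le(1)[OF 1]] by simp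
  qed
  have *: "inner \<phi> f = 0" if "\<And>k. inner (E k \<phi>) f = 0" for f
  proof -
    have "((\<lambda>k. inner (E k \<phi>) f) \<longlongrightarrow> inner \<phi> f) at_top" by (intro tendsto_intros E_at_top)
    then show ?thesis by (simp add: that tendsto_const_iff)
  qed
  have "cinner \<phi> \<zeta> = 0"
  proof (rule complex_eqI)
    show "Re (cinner \<phi> \<zeta>) = Re 0" using *[of \<zeta>] 0 by (simp add: inner_L2_def)
    have "inner \<phi> (\<i> *\<^sub>C \<zeta>) = 0" by (rule *) (simp add: inner_L2_def cinner_cscale_right 0)
    then show "Im (cinner \<phi> \<zeta>) = Im 0" by (simp add: inner_L2_def cinner_cscale_right)
  qed
  then show ?thesis by (simp add: \<zeta> \<phi>)
qed

text \<open>Split \<open>\<psi>\<close> at the level \<open>n\<close>. The cross terms vanish, the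
  low part obeys the spectral bound, and the high part obeys the crude lower bound of the form,
  whose contribution disappears as \<open>n\<close> grows.\<close>

lemma q_ge:
  assumes \<psi>: "\<psi> \<in> Q" "E l \<psi> = 0" shows "l * (norm \<psi>)\<^sup>2 \<le> Re (q \<psi> \<psi>)"
proof -
  obtain c where c: "\<And>\<psi>. \<psi> \<in> Q \<Longrightarrow> - c * (norm \<psi>)\<^sup>2 \<le> Re (q \<psi> \<psi>)"
    using bounded_below unfolding bounded_below_form_def by blast
  have "l * (norm (E n \<psi>))\<^sup>2 - c * (norm (\<psi> - E n \<psi>))\<^sup>2 \<le> Re (q \<psi> \<psi>)" for n
  proof -
    define \<xi> \<phi> where "\<xi> = E n \<psi>" and "\<phi> = \<psi> - E n \<psi>"
    have \<xi>: "E n \<xi> = \<xi>" and \<phi>: "E n \<phi> = 0" by (simp_all add: \<xi>_def \<phi>_def E.diff E_E)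
    have \<xi>Q: "\<xi> \<in> Q" by (rule q_le(1)[OF \<xi>])
    have \<phi>Q: "\<phi> \<in> Q" using \<psi>(1) \<xi>Q unfolding \<phi>_def \<xi>_def by (rule diff_Q)
    have "E l \<xi> = E n (E l \<psi>)" by (simp add: \<xi>_def E_E min.commute)
    then have "E l \<xi> = 0" by (simp add: \<psi> E.zero)
    then have 1: "l * (norm \<xi>)\<^sup>2 \<le> Re (q \<xi> \<xi>)" by (rule q_ge_Domain[OF Domain_if_upper[OF \<xi>]])
    have "\<psi> = \<phi> + \<xi>" by (simp add: \<phi>_def \<xi>_def)
    then have "q \<psi> \<psi> = q \<phi> \<phi> + q \<xi> \<xi>"
      using q_orthogonal_Q[OF \<phi>Q \<phi> \<xi>] q_commute[OF \<phi>Q \<xi>Q] by (simp add: q_add_left q_add_right \<phi>Q \<xi>Q add_Q)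
    then show ?thesis using 1 c[OF \<phi>Q] by (simp add: \<xi>_def \<phi>_def)
  qed
  moreover have "((\<lambda>n. l * (norm (E n \<psi>))\<^sup>2 - c * (norm (\<psi> - E n \<psi>))\<^sup>2) \<longlongrightarrow> l * (norm \<psi>)\<^sup>2 - c * (norm (\<psi> - \<psi>))\<^sup>2) at_top"
    by (intro tendsto_intros E_at_top)
  ultimately have "l * (norm \<psi>)\<^sup>2 - c * (norm (\<psi> - \<psi>))\<^sup>2 \<le> Re (q \<psi> \<psi>)"
    by (intro tendsto_upperbound) auto
  then show ?thesis by simp
qed

end

text \<open>\<open>E2 l' \<circ> J\<close> is injective on the range of \<open>E1 l\<close>: if it
  annihilates \<open>\<psi>\<close>, then the energy of \<open>J \<psi>\<close> is at most
  \<open>l\<close> and at least \<open>l'\<close> times its squared norm, and the gap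
  \<open>l < l'\<close> forces \<open>J \<psi> = 0\<close>.\<close>

lemma cdim_ge_transfer:
  assumes 1: "form_resolution Q1 q1 E1" and 2: "form_resolution Q2 q2 E2"
    and J: "Vector_Spaces.linear cscale cscale J" and inj: "\<And>\<phi>. J \<phi> = 0 \<Longrightarrow> \<phi> = 0"
    and JQ: "\<And>\<phi>. \<phi> \<in> Q1 \<Longrightarrow> J \<phi> \<in> Q2"
    and le: "\<And>\<phi>. \<phi> \<in> Q1 \<Longrightarrow> Re (q1 \<phi> \<phi>) \<le> l * (norm \<phi>)\<^sup>2 \<Longrightarrow> Re (q2 (J \<phi>) (J \<phi>)) \<le> l * (norm (J \<phi>))\<^sup>2"
    and less: "l < l'" and dim: "cdim_ge (range (E1 l)) j"
  shows "cdim_ge (range (E2 l')) j"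
proof -
  interpret r1: form_resolution Q1 q1 E1 by (rule 1)
  interpret r2: form_resolution Q2 q2 E2 by (rule 2)
  obtain B where B: "B \<subseteq> range (E1 l)" "finite B" "card B = j" "L2.independent B"
    using dim unfolding cdim_ge_def by blast
  define g where "g = E2 l' \<circ> J"
  have g: "Vector_Spaces.linear cscale cscale g"
    unfolding g_def by (rule Vector_Spaces.linear_compose[OF J r2.linear_E])
  interpret g: Vector_Spaces.linear cscale cscale g by (rule g)
  have sub: "L2.subspace (range (E1 l))"
    by (rule r1.E.subspace_image[OF L2.subspace_UNIV])
  have ker: "\<psi> = 0" if \<psi>: "\<psi> \<in> L2.span B" and 0: "g \<psi> = 0" for \<psi>
  proof -
    have "\<psi> \<in> range (E1 l)" using L2.span_minimal[OF B(1) sub] \<psi> by blast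
    then have "E1 l \<psi> = \<psi>" by (auto simp: r1.E_E)
    then have Q: "\<psi> \<in> Q1" and "Re (q1 \<psi> \<psi>) \<le> l * (norm \<psi>)\<^sup>2" by (rule r1.q_le)+
    then have "Re (q2 (J \<psi>) (J \<psi>)) \<le> l * (norm (J \<psi>))\<^sup>2" by (rule le)
    moreover have "l' * (norm (J \<psi>))\<^sup>2 \<le> Re (q2 (J \<psi>) (J \<psi>))"
      using 0 by (intro r2.q_ge JQ Q) (simp add: g_def)
    ultimately have "(l' - l) * (norm (J \<psi>))\<^sup>2 \<le> 0" by (simp add: algebra_simps)
    then have "J \<psi> = 0" using less by (simp add: mult_le_0_iff)
    then show ?thesis by (rule inj)
  qed
  have inj_g: "inj_on g (L2.span B)"
  proof (rule inj_onI)
    fix x y assume "x \<in> L2.span B" "y \<in> L2.span B" "g x = g y"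
    then have "x - y = 0" by (intro ker) (auto simp: g.diff L2.span_diff)
    then show "x = y" by simp
  qed
  have "L2.independent (g ` B)"
    by (rule g.independent_injective_image[OF B(4) inj_g])
  moreover have "card (g ` B) = j"
    using card_image[OF inj_on_subset[OF inj_g L2.span_superset]] B(3) by simp
  moreover have "g ` B \<subseteq> range (E2 l')" by (auto simp: g_def)
  ultimately show ?thesis unfolding cdim_ge_def using B(2) by blast
qed

lemma neg_eigenvalue_nonpos: "neg_eigenvalue j T \<le> 0"
  by (simp add: neg_eigenvalue_def)

lemma abs_neg_eigenvalue: "\<bar>neg_eigenvalue j T\<bar> = - neg_eigenvalue j T"
  using neg_eigenvalue_nonpos[of j T] by (cases "neg_eigenvalue j T") auto

text \<open>Levels \<open>l \<ge> 0\<close> are absorbed by the minimum with 0, which is why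
  \<open>le\<close> is asked only for negative levels. The gap required to transfer dimensions
  vanishes in the infimum.\<close>

theorem neg_eigenvalue_le:
  assumes 1: "closed_semibounded_form Q1 q1" and 2: "closed_semibounded_form Q2 q2"
    and J: "Vector_Spaces.linear cscale cscale J" and inj: "\<And>\<phi>. J \<phi> = 0 \<Longrightarrow> \<phi> = 0"
    and JQ: "\<And>\<phi>. \<phi> \<in> Q1 \<Longrightarrow> J \<phi> \<in> Q2"
    and le: "\<And>\<phi> l. \<phi> \<in> Q1 \<Longrightarrow> l < 0 \<Longrightarrow> Re (q1 \<phi> \<phi>) \<le> l * (norm \<phi>)\<^sup>2 \<Longrightarrow> Re (q2 (J \<phi>) (J \<phi>)) \<le> l * (norm (J \<phi>))\<^sup>2"
  shows "\<bar>neg_eigenvalue j (form_operator Q1 q1)\<bar> \<le> \<bar>neg_eigenvalue j (form_operator Q2 q2)\<bar>"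
proof -
  have res: "form_resolution Q q (spectral_projection (form_operator Q q))" if "closed_semibounded_form Q q" for Q and q :: "'x::euclidean_space form"
  proof -
    interpret closed_semibounded_form Q q by (rule that)
    have "spectral_resolution (form_operator Q q) (spectral_projection (form_operator Q q))"
      unfolding spectral_projection_def by (rule someI_ex[OF form_operator_has_spectral_resolution])
    then show ?thesis
      by (rule form_resolution.intro[OF sesquilinear_form_axioms form_resolution_axioms.intro[OF bounded_below]])
  qed
  let ?D = "\<lambda>Q q. {l. cdim_ge (range (spectral_projection (form_operator Q q) l)) j}"
  have "neg_eigenvalue j (form_operator Q2 q2) \<le> ereal l" if l: "l \<in> ?D Q1 q1" "l < 0" for l
  proof (rule ereal_le_epsilon2)
    fix e :: real assume e: "0 < e"
    have "l + e \<in> ?D Q2 q2"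
      using cdim_ge_transfer[OF res[OF 1] res[OF 2] J inj JQ le, of l "l + e" j] l e by simp
    then show "neg_eigenvalue j (form_operator Q2 q2) \<le> ereal l + ereal e"
      unfolding neg_eigenvalue_def by (intro min.coboundedI2 INF_lower2) auto
  qed
  moreover have "neg_eigenvalue j (form_operator Q2 q2) \<le> ereal l" if "\<not> l < 0" for l
    using neg_eigenvalue_nonpos[of j "form_operator Q2 q2"] that by (rule_tac order_trans) auto
  ultimately have "neg_eigenvalue j (form_operator Q2 q2) \<le> neg_eigenvalue j (form_operator Q1 q1)"
    unfolding neg_eigenvalue_def[of j "form_operator Q1 q1"]
    using neg_eigenvalue_nonpos[of j "form_operator Q2 q2"]
    by (intro min.boundedI INF_greatest) blast+
  then show ?thesis by (simp add: abs_neg_eigenvalue)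
qed

section \<open>Test functions\<close>

text \<open>Flat extensions by 0 of \<open>p (1 / t) exp (- 1 / t)\<close>. The polynomial factor
  makes the class stable under differentiation: in \<open>s = 1 / t\<close> the derivative replaces
  \<open>p\<close> by \<open>s^2 (p - p')\<close>.\<close>

definition exp_germ :: "real poly \<Rightarrow> real \<Rightarrow> real" where
  "exp_germ p t = (if 0 < t then poly p (1 / t) * exp (- (1 / t)) else 0)"

lemma poly_times_exp_tendsto_0: "((\<lambda>s. poly p s * exp (- s)) \<longlongrightarrow> 0) (at_top :: real filter)"
proof -
  have "((\<lambda>s. \<Sum>i\<le>degree p. coeff p i * (s ^ i / exp s)) \<longlongrightarrow> (\<Sum>i\<le>degree p. coeff p i * 0)) at_top"
    by (intro tendsto_intros tendsto_power_div_exp_0)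
  then show ?thesis by (simp add: poly_altdef exp_minus divide_inverse sum_distrib_right mult.assoc)
qed

lemma DERIV_exp_germ: "(exp_germ p has_real_derivative exp_germ ([:0, 0, 1:] * (p - pderiv p)) t) (at t)"
proof -
  consider "t < 0" | "t = 0" | "t > 0" by linarith
  then show ?thesis
  proof cases
    case 1
    have "((\<lambda>_. 0) has_real_derivative 0) (at t)" by simp
    then have "(exp_germ p has_real_derivative 0) (at t)"
      by (rule has_field_derivative_transform_within_open[of _ _ _ "{..<0}"]) (use 1 in \<open>auto simp: exp_germ_def\<close>)
    then show ?thesis using 1 by (simp add: exp_germ_def)
  next
    case 2
    have right: "((\<lambda>h. exp_germ p h / h) \<longlongrightarrow> 0) (at_right 0)"
    proof -
      \<comment> \<open>With \<open>s = 1 / h\<close> the difference quotient at 0 is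
        \<open>s * p s * exp (- s)\<close>, and \<open>pCons 0 p\<close> is
        \<open>s * p s\<close>.\<close>
      have "((\<lambda>h. poly (pCons 0 p) (inverse h) * exp (- inverse h)) \<longlongrightarrow> 0) (at_right (0::real))"
        by (rule filterlim_compose[OF poly_times_exp_tendsto_0 filterlim_inverse_at_top_right])
      then show ?thesis
      proof (rule Lim_transform_eventually)
        show "\<forall>\<^sub>F h in at_right 0. poly (pCons 0 p) (inverse h) * exp (- inverse h) = exp_germ p h / h"
          using eventually_at_right_less[of 0] by eventually_elim (simp add: exp_germ_def field_simps)
      qed
    qed
    have left: "((\<lambda>h. exp_germ p h / h) \<longlongrightarrow> 0) (at_left 0)"
    proof (rule tendsto_eventually)
      show "\<forall>\<^sub>F h in at_left 0. exp_germ p h / h = 0"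
        by (auto simp: eventually_at_filter exp_germ_def intro!: always_eventually)
    qed
    have "((\<lambda>h. exp_germ p h / h) \<longlongrightarrow> 0) (at 0)" using left right by (rule filterlim_split_at)
    then show ?thesis using 2 by (simp add: DERIV_def exp_germ_def)
  next
    case 3
    have "((\<lambda>t. poly p (1 / t) * exp (- (1 / t))) has_real_derivative
        poly ([:0, 0, 1:] * (p - pderiv p)) (1 / t) * exp (- (1 / t))) (at t)"
      using 3 by (auto intro!: derivative_eq_intros DERIV_chain2[OF poly_DERIV] simp: field_simps power2_eq_square)
    then have "(exp_germ p has_real_derivative poly ([:0, 0, 1:] * (p - pderiv p)) (1 / t) * exp (- (1 / t))) (at t)"
      by (rule has_field_derivative_transform_within_open[of _ _ _ "{0<..}"]) (use 3 in \<open>auto simp: exp_germ_def\<close>)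
    then show ?thesis using 3 by (simp add: exp_germ_def)
  qed
qed

text \<open>A class generated so as to be closed under partial derivatives. Differentiability of its
  members therefore gives \<open>C_k\<close> for all \<open>k\<close> by induction, without formulas
  for higher derivatives.\<close>

inductive smooth_germ :: "('a::euclidean_space \<Rightarrow> real) \<Rightarrow> bool" where
  germ: "smooth_germ (\<lambda>x. exp_germ p (x \<bullet> v + d))"
| const: "smooth_germ (\<lambda>x. k)"
| add: "smooth_germ f \<Longrightarrow> smooth_germ g \<Longrightarrow> smooth_germ (\<lambda>x. f x + g x)"
| mult: "smooth_germ f \<Longrightarrow> smooth_germ g \<Longrightarrow> smooth_germ (\<lambda>x. f x * g x)"

lemma partial_deriv_eq: "(f has_derivative D) (at x) \<Longrightarrow> partial_deriv b f x = D b"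
  unfolding partial_deriv_def using frechet_derivative_at by metis

lemma has_derivative_frechet: "f differentiable at x \<Longrightarrow> (f has_derivative (\<lambda>b. partial_deriv b f x)) (at x)"
  unfolding partial_deriv_def by (simp add: frechet_derivative_works)

lemma smooth_germ_deriv:
  assumes "smooth_germ f"
  shows "(\<forall>x. f differentiable (at x)) \<and> (\<forall>b. smooth_germ (partial_deriv b f))"
  using assms
proof induction
  case (germ p v d)
  have D: "((\<lambda>x. exp_germ p (x \<bullet> v + d)) has_derivative
      (\<lambda>b. (b \<bullet> v) * exp_germ ([:0, 0, 1:] * (p - pderiv p)) (x \<bullet> v + d))) (at x)" for x
    by (rule DERIV_compose_FDERIV[OF DERIV_exp_germ]) (auto intro!: derivative_eq_intros)
  have "partial_deriv b (\<lambda>x. exp_germ p (x \<bullet> v + d)) =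
      (\<lambda>x. (b \<bullet> v) * exp_germ ([:0, 0, 1:] * (p - pderiv p)) (x \<bullet> v + d))" for b
    using partial_deriv_eq[OF D] by auto
  then show ?case using D by (auto simp: differentiable_def intro!: smooth_germ.intros)
next
  case (const k)
  have "partial_deriv b (\<lambda>x::'a. k) = (\<lambda>x. 0)" for b
    using partial_deriv_eq[OF has_derivative_const] by auto
  then show ?case by (auto intro!: smooth_germ.intros)
next
  case (add f g)
  then have D: "((\<lambda>x. f x + g x) has_derivative (\<lambda>b. partial_deriv b f x + partial_deriv b g x)) (at x)" for x
    by (intro has_derivative_add has_derivative_frechet) auto
  have "partial_deriv b (\<lambda>x. f x + g x) = (\<lambda>x. partial_deriv b f x + partial_deriv b g x)" for b
    using partial_deriv_eq[OF D] by auto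
  then show ?case using add D by (auto simp: differentiable_def intro!: smooth_germ.intros)
next
  case (mult f g)
  then have D: "((\<lambda>x. f x * g x) has_derivative (\<lambda>b. f x * partial_deriv b g x + partial_deriv b f x * g x)) (at x)" for x
    by (intro has_derivative_mult has_derivative_frechet) auto
  have "partial_deriv b (\<lambda>x. f x * g x) = (\<lambda>x. f x * partial_deriv b g x + partial_deriv b f x * g x)" for b
    using partial_deriv_eq[OF D] by auto
  then show ?case using mult D by (auto simp: differentiable_def intro!: smooth_germ.intros)
qed

lemma smooth_germ_C_k: "smooth_germ f \<Longrightarrow> C_k k f"
proof (induction k arbitrary: f)
  case 0
  then show ?case using smooth_germ_deriv[of f]
    by (auto intro!: continuous_at_imp_continuous_on differentiable_imp_continuous_within)
next
  case (Suc k)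
  then show ?case using smooth_germ_deriv[of f] by auto
qed

lemma smooth_germ_prod: "finite I \<Longrightarrow> (\<And>i. i \<in> I \<Longrightarrow> smooth_germ (f i)) \<Longrightarrow> smooth_germ (\<lambda>x. \<Prod>i\<in>I. f i x)"
  by (induction I rule: finite_induct) (auto intro: smooth_germ.intros)

text \<open>Positive exactly on \<open>box a b\<close>. The factor \<open>Suc n\<close> steepens the
  flanks, so that the functions tend to the indicator of the box while staying in
  \<open>[0, 1]\<close>.\<close>

definition bump :: "'a::euclidean_space \<Rightarrow> 'a \<Rightarrow> nat \<Rightarrow> 'a \<Rightarrow> real" where
  "bump a b n x = (\<Prod>i\<in>Basis. exp_germ 1 (real (Suc n) * (x \<bullet> i - a \<bullet> i)) * exp_germ 1 (real (Suc n) * (b \<bullet> i - x \<bullet> i)))"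

lemma smooth_bump: "smooth_germ (bump a b n)"
proof -
  have "smooth_germ (\<lambda>x. exp_germ 1 (x \<bullet> (real (Suc n) *\<^sub>R i) + - (real (Suc n) * (a \<bullet> i))) *
      exp_germ 1 (x \<bullet> (- real (Suc n) *\<^sub>R i) + real (Suc n) * (b \<bullet> i)))" for i
    by (intro smooth_germ.mult smooth_germ.germ)
  then have "smooth_germ (\<lambda>x. exp_germ 1 (real (Suc n) * (x \<bullet> i - a \<bullet> i)) * exp_germ 1 (real (Suc n) * (b \<bullet> i - x \<bullet> i)))" for i
    by (simp add: algebra_simps)
  then show ?thesis unfolding bump_def by (intro smooth_germ_prod) auto
qed

lemma exp_germ_1_bounds: "0 \<le> exp_germ 1 t" "exp_germ 1 t \<le> 1"
  by (auto simp: exp_germ_def)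

lemma bump_bounds: "0 \<le> bump a b n x" "bump a b n x \<le> 1"
  unfolding bump_def by (auto intro!: prod_nonneg prod_le_1 mult_nonneg_nonneg mult_le_one exp_germ_1_bounds)

lemma bump_eq_0: "x \<notin> box a b \<Longrightarrow> bump a b n x = 0"
proof -
  assume "x \<notin> box a b"
  then obtain i where i: "i \<in> Basis" and "x \<bullet> i \<le> a \<bullet> i \<or> b \<bullet> i \<le> x \<bullet> i" by (auto simp: mem_box not_less)
  then have "exp_germ 1 (real (Suc n) * (x \<bullet> i - a \<bullet> i)) * exp_germ 1 (real (Suc n) * (b \<bullet> i - x \<bullet> i)) = 0"
    by (auto simp: exp_germ_def zero_less_mult_iff)
  with i show ?thesis unfolding bump_def by (intro prod_zero) auto
qed

lemma exp_germ_scale_tendsto: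
  assumes "0 < s" shows "(\<lambda>n. exp_germ 1 (real (Suc n) * s)) \<longlonglongrightarrow> 1"
proof -
  have "(\<lambda>n. exp (- (inverse (real (Suc n)) * (1 / s)))) \<longlonglongrightarrow> exp (- (0 * (1 / s)))"
    by (intro tendsto_intros LIMSEQ_inverse_real_of_nat)
  moreover have "exp_germ 1 (real (Suc n) * s) = exp (- (inverse (real (Suc n)) * (1 / s)))" for n
    using assms by (simp add: exp_germ_def divide_inverse zero_less_mult_iff)
  ultimately show ?thesis by simp
qed

lemma bump_tendsto: "(\<lambda>n. bump a b n x) \<longlonglongrightarrow> indicator (box a b) x"
proof (cases "x \<in> box a b")
  case True
  have "(\<lambda>n. bump a b n x) \<longlonglongrightarrow> (\<Prod>i\<in>(Basis :: 'a set). 1 * 1)"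
    unfolding bump_def
  proof (rule tendsto_prod)
    fix i :: 'a assume "i \<in> Basis"
    then show "(\<lambda>n. exp_germ 1 (real (Suc n) * (x \<bullet> i - a \<bullet> i)) * exp_germ 1 (real (Suc n) * (b \<bullet> i - x \<bullet> i))) \<longlonglongrightarrow> 1 * 1"
      using True by (intro tendsto_mult exp_germ_scale_tendsto) (auto simp: mem_box)
  qed
  with True show ?thesis by simp
qed (simp add: bump_eq_0)

lemma test_function_bump: "test_function (bump a b n)"
  unfolding test_function_def
proof (intro conjI allI exI[of _ "cbox a b"])
  show "C_k k (bump a b n)" for k by (rule smooth_germ_C_k[OF smooth_bump])
  show "compact (cbox a b)" by simp
  show "x \<notin> cbox a b \<longrightarrow> bump a b n x = 0" for x using bump_eq_0[of x a b n] box_subset_cbox[of a b] by blast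
qed

lemma test_function_continuous: "test_function \<phi> \<Longrightarrow> continuous_on UNIV \<phi>"
  unfolding test_function_def by (metis C_k.simps(1))

lemma test_function_differentiable: "test_function \<phi> \<Longrightarrow> \<phi> differentiable (at x)"
  unfolding test_function_def using C_k.simps(2) by blast

lemma test_function_continuous_partial: "test_function \<phi> \<Longrightarrow> b \<in> Basis \<Longrightarrow> continuous_on UNIV (partial_deriv b \<phi>)"
  unfolding test_function_def using C_k.simps by blast

lemma partial_deriv_support:
  assumes "compact K" "\<And>x. x \<notin> K \<Longrightarrow> f x = (0::real)" "x \<notin> K"
  shows "partial_deriv b f x = 0"
proof -
  have "(f has_derivative (\<lambda>_. 0)) (at x)"
  proof (rule has_derivative_transform_within_open[OF has_derivative_const[of 0]])
    show "open (- K)" using assms(1) by (simp add: compact_imp_closed open_Compl)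
  qed (use assms in auto)
  then show ?thesis by (rule partial_deriv_eq)
qed

lemma bounded_if_compact_support:
  fixes f :: "'a::euclidean_space \<Rightarrow> real"
  assumes "continuous_on UNIV f" "compact K" "\<And>x. x \<notin> K \<Longrightarrow> f x = 0"
  obtains M where "0 \<le> M" "\<And>x. \<bar>f x\<bar> \<le> M"
proof -
  have "compact (f ` K)" using assms by (intro compact_continuous_image) (auto intro: continuous_on_subset)
  then obtain M where M: "\<And>x. x \<in> K \<Longrightarrow> \<bar>f x\<bar> \<le> M" by (metis bounded_iff compact_imp_bounded imageI real_norm_def)
  show ?thesis
  proof (rule that[of "max 0 M"])
    show "\<bar>f x\<bar> \<le> max 0 M" for x using M[of x] assms(3)[of x] by (cases "x \<in> K") auto
  qed simp
qed

section \<open>Integration by parts and local integrability\<close>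

lemma integrable_cball: "integrable lborel (indicat_real (cball (c::'a::euclidean_space) r))"
  using emeasure_lborel_cball_finite[of c r] by (intro integrable_real_indicator) auto

text \<open>By translation invariance the difference quotients in direction \<open>b\<close> have integral \<open>0\<close>.\<close>

lemma integral_partial_deriv_eq_0:
  fixes f :: "'a::euclidean_space \<Rightarrow> real"
  assumes diff: "\<And>x. f differentiable (at x)" and cont: "continuous_on UNIV (partial_deriv b f)"
    and K: "compact K" "\<And>x. x \<notin> K \<Longrightarrow> f x = 0" and b: "b \<in> Basis"
  shows "(LINT x|lebesgue. partial_deriv b f x) = 0"
proof -
  have contf: "continuous_on UNIV f"
    using diff by (auto intro!: continuous_at_imp_continuous_on differentiable_imp_continuous_within)
  note [measurable] = borel_measurable_continuous_onI[OF contf] borel_measurable_continuous_onI[OF cont]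
  obtain M where M: "0 \<le> M" "\<And>x. \<bar>partial_deriv b f x\<bar> \<le> M"
    using bounded_if_compact_support[OF cont K(1) partial_deriv_support[OF K]] by blast
  obtain B where B: "0 \<le> B" "\<And>x. \<bar>f x\<bar> \<le> B"
    using bounded_if_compact_support[OF contf K] by blast
  obtain r where r: "0 \<le> r" "K \<subseteq> cball 0 r"
    using compact_imp_bounded[OF K(1)] by (metis bounded_subset_ballD ball_subset_cball order_trans less_imp_le)
  define h where "h n = inverse (real (Suc n))" for n
  have h: "0 < h n" "h n \<le> 1" for n by (auto simp: h_def divide_simps)
  have h0: "h \<longlonglongrightarrow> 0" unfolding h_def by (rule LIMSEQ_inverse_real_of_nat)
  have nb: "norm b = 1" using b by simp
  have line: "((\<lambda>t. f (x + t *\<^sub>R b)) has_real_derivative partial_deriv b f (x + t *\<^sub>R b)) (at t)" for x t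
  proof -
    have "((\<lambda>t. f (x + t *\<^sub>R b)) has_derivative (\<lambda>s. partial_deriv (s *\<^sub>R b) f (x + t *\<^sub>R b))) (at t)"
      by (rule has_derivative_compose[where g = f, of "\<lambda>t. x + t *\<^sub>R b" "\<lambda>t. t *\<^sub>R b"])
         (use has_derivative_frechet[OF diff] in \<open>auto intro!: derivative_eq_intros\<close>)
    moreover have "(\<lambda>s. partial_deriv (s *\<^sub>R b) f (x + t *\<^sub>R b)) = (*) (partial_deriv b f (x + t *\<^sub>R b))"
      using linear_scale[OF linear_frechet_derivative[OF diff]] by (auto simp: partial_deriv_def)
    ultimately show ?thesis by (simp add: has_field_derivative_def)
  qed
  define g where "g n x = (f (x + h n *\<^sub>R b) - f x) / h n" for n x
  have fin: "integrable lborel f"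
  proof (rule Bochner_Integration.integrable_bound)
    show "integrable lborel (\<lambda>x. B * indicator (cball 0 r) x)" by (intro integrable_mult_right integrable_cball)
    show "AE x in lborel. norm (f x) \<le> norm (B * indicator (cball 0 r) x)"
    proof (intro always_eventually allI)
      fix x show "norm (f x) \<le> norm (B * indicator (cball 0 r) x)"
      proof (cases "x \<in> cball 0 r")
        case True
        then show ?thesis using B by simp
      next
        case False
        then have "x \<notin> K" using r(2) by blast
        then show ?thesis using K(2) by simp
      qed
    qed
  qed simp
  have shift: "integrable lborel (\<lambda>x. f (x + v)) \<and> (LINT x|lborel. f (x + v)) = (LINT x|lborel. f x)" for v
  proof -
    have "lborel = distr lborel borel ((+) v)" by (rule lborel_distr_plus[symmetric])
    then have "integrable (distr lborel borel ((+) v)) f" "(LINT x|lborel. f x) = (LINT x|distr lborel borel ((+) v). f x)"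
      using fin by simp_all
    then show ?thesis by (simp add: integrable_distr_eq integral_distr add.commute)
  qed
  have "(\<lambda>n. LINT x|lborel. g n x) \<longlonglongrightarrow> (LINT x|lborel. partial_deriv b f x)"
  proof (rule integral_dominated_convergence)
    \<comment> \<open>The steps satisfy \<open>h n \<le> 1\<close>, so all difference quotients
      vanish outside the ball enlarged by 1; inside it the mean value inequality bounds them by
      \<open>M\<close>.\<close>
    show "integrable lborel (\<lambda>x. M * indicator (cball (0::'a) (r + 1)) x)" by (intro integrable_mult_right integrable_cball)
    show "AE x in lborel. (\<lambda>n. g n x) \<longlonglongrightarrow> partial_deriv b f x"
    proof (intro always_eventually allI)
      fix x
      have "((\<lambda>t. (f (x + t *\<^sub>R b) - f x) / t) \<longlongrightarrow> partial_deriv b f x) (at 0)"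
        using line[of x 0] by (simp add: DERIV_def)
      moreover have "filterlim h (at 0) sequentially"
        unfolding filterlim_at using h h0 by (auto intro!: always_eventually simp: less_imp_neq[symmetric])
      ultimately show "(\<lambda>n. g n x) \<longlonglongrightarrow> partial_deriv b f x"
        unfolding g_def by (rule filterlim_compose)
    qed
    show "AE x in lborel. norm (g n x) \<le> M * indicator (cball 0 (r + 1)) x" for n
    proof (intro always_eventually allI)
      fix x
      show "norm (g n x) \<le> M * indicator (cball 0 (r + 1)) x"
      proof (cases "x \<in> cball 0 (r + 1)")
        case True
        have "norm (f (x + h n *\<^sub>R b) - f (x + 0 *\<^sub>R b)) \<le> M * norm (h n - 0)"
          by (rule field_differentiable_bound[OF convex_UNIV has_field_derivative_at_within[OF line]]) (auto simp: M)
        then show ?thesis using True h(1)[of n] by (simp add: g_def divide_simps)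
      next
        case False
        then have 1: "norm x > r + 1" by simp
        have "norm (h n *\<^sub>R b) \<le> 1" using h[of n] nb by simp
        then have "norm (x + h n *\<^sub>R b) > r" using 1 norm_diff_ineq[of x "h n *\<^sub>R b"] by linarith
        then have "x + h n *\<^sub>R b \<notin> K" "x \<notin> K" using r 1 by auto
        then show ?thesis using False K(2) by (simp add: g_def)
      qed
    qed
  qed (auto simp: g_def)
  moreover have "(LINT x|lborel. g n x) = 0" for n
    unfolding g_def using shift fin by simp
  ultimately have "(LINT x|lborel. partial_deriv b f x) = 0" by (simp add: LIMSEQ_const_iff)
  then show ?thesis by (subst integral_completion) auto
qed

lemma integral_by_parts:
  fixes f g :: "'a::euclidean_space \<Rightarrow> real"
  assumes f: "\<And>x. f differentiable (at x)" "continuous_on UNIV (partial_deriv b f)"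
    and g: "\<And>x. g differentiable (at x)" "continuous_on UNIV (partial_deriv b g)"
    and K: "compact K" "\<And>x. x \<notin> K \<Longrightarrow> f x = 0" and b: "b \<in> Basis"
  shows "(LINT x|lebesgue. partial_deriv b f x * g x) = - (LINT x|lebesgue. f x * partial_deriv b g x)"
proof -
  have contf: "continuous_on UNIV f" and contg: "continuous_on UNIV g"
    using f g by (auto intro!: continuous_at_imp_continuous_on differentiable_imp_continuous_within)
  have int: "integrable lebesgue k" if k: "continuous_on UNIV k" "\<And>x. x \<notin> K \<Longrightarrow> k x = 0" for k :: "'a \<Rightarrow> real"
  proof -
    have "integrable lborel (\<lambda>x. indicator K x *\<^sub>R k x)"
      by (intro borel_integrable_compact K continuous_on_subset[OF k(1)]) auto
    moreover have "(\<lambda>x. indicator K x *\<^sub>R k x) = k"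
    proof
      show "indicator K x *\<^sub>R k x = k x" for x using k(2)[of x] by (cases "x \<in> K") auto
    qed
    ultimately show ?thesis by (simp add: integrable_completion borel_measurable_integrable)
  qed
  have D: "((\<lambda>x. f x * g x) has_derivative (\<lambda>b. f x * partial_deriv b g x + partial_deriv b f x * g x)) (at x)" for x
    by (intro has_derivative_mult has_derivative_frechet f g)
  have eq: "partial_deriv b (\<lambda>x. f x * g x) = (\<lambda>x. f x * partial_deriv b g x + partial_deriv b f x * g x)"
    using partial_deriv_eq[OF D] by auto
  have "(LINT x|lebesgue. partial_deriv b (\<lambda>x. f x * g x) x) = 0"
  proof (rule integral_partial_deriv_eq_0[OF _ _ K(1) _ b])
    show "(\<lambda>x. f x * g x) differentiable (at x)" for x using D by (auto simp: differentiable_def)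
    show "continuous_on UNIV (partial_deriv b (\<lambda>x. f x * g x))"
      unfolding eq by (intro continuous_intros contf contg f g)
  qed (simp add: K)
  also have "(LINT x|lebesgue. partial_deriv b (\<lambda>x. f x * g x) x) =
      (LINT x|lebesgue. f x * partial_deriv b g x) + (LINT x|lebesgue. partial_deriv b f x * g x)"
    unfolding eq
    by (intro Bochner_Integration.integral_add int continuous_intros contf contg f g)
       (simp_all add: K partial_deriv_support[OF K])
  finally show ?thesis by simp
qed


lemma locally_integrable_measurable:
  fixes h :: "'a::euclidean_space \<Rightarrow> 'b::euclidean_space"
  assumes "locally_integrable h" shows "h \<in> borel_measurable lebesgue"
proof (rule borel_measurable_LIMSEQ_metric)
  fix n :: nat
  show "(\<lambda>x. indicator (cball 0 (real n)) x *\<^sub>R h x) \<in> borel_measurable lebesgue"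
    using assms unfolding locally_integrable_def set_integrable_def by (auto intro: borel_measurable_integrable)
next
  fix x :: 'a
  obtain N where N: "norm x \<le> real N" using real_arch_simple by blast
  show "(\<lambda>n. indicator (cball 0 (real n)) x *\<^sub>R h x) \<longlonglongrightarrow> h x"
  proof (rule tendsto_eventually)
    have "indicator (cball 0 (real n)) x *\<^sub>R h x = h x" if "n \<ge> N" for n
    proof -
      have "norm x \<le> real n" using N that by (meson of_nat_mono order_trans)
      then show ?thesis by simp
    qed
    then show "\<forall>\<^sub>F n in sequentially. indicator (cball 0 (real n)) x *\<^sub>R h x = h x"
      by (auto simp: eventually_sequentially)
  qed
qed

lemma integrable_test_times:
 fixes h :: "'a::euclidean_space \<Rightarrow> 'b::euclidean_space" and \<phi> :: "'a \<Rightarrow> real"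
  assumes h: "locally_integrable h" and \<phi>: "continuous_on UNIV \<phi>" and K: "compact K" "\<And>x. x \<notin> K \<Longrightarrow> \<phi> x = (0::real)"
  shows "integrable lebesgue (\<lambda>x. \<phi> x *\<^sub>R h x)"
proof -
  obtain M where M: "0 \<le> M" "\<And>x. \<bar>\<phi> x\<bar> \<le> M" using bounded_if_compact_support[OF \<phi> K] by blast
  have [measurable]: "h \<in> borel_measurable lebesgue" by (rule locally_integrable_measurable[OF h])
  have [measurable]: "\<phi> \<in> borel_measurable lebesgue"
    by (intro measurable_completion) (simp add: borel_measurable_continuous_onI[OF \<phi>])
  have "integrable lebesgue (\<lambda>x. indicator K x *\<^sub>R h x)"
    using h K unfolding locally_integrable_def set_integrable_def by blast
  then have "integrable lebesgue (\<lambda>x. M *\<^sub>R (indicator K x *\<^sub>R h x))" by (rule integrable_scaleR_right)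
  then show ?thesis
  proof (rule Bochner_Integration.integrable_bound)
    show "AE x in lebesgue. norm (\<phi> x *\<^sub>R h x) \<le> norm (M *\<^sub>R (indicator K x *\<^sub>R h x))"
    proof (intro always_eventually allI)
      fix x show "norm (\<phi> x *\<^sub>R h x) \<le> norm (M *\<^sub>R (indicator K x *\<^sub>R h x))"
        using M K(2)[of x] by (cases "x \<in> K") (auto intro!: mult_right_mono)
    qed
  qed measurable
qed

lemma test_function_support:
  assumes "test_function \<phi>" obtains K where "compact K" "\<And>x. x \<notin> K \<Longrightarrow> \<phi> x = 0"
  using assms unfolding test_function_def by blast

lemma integrable_test_function:
  fixes h :: "'a::euclidean_space \<Rightarrow> 'b::euclidean_space" and \<phi> :: "'a \<Rightarrow> real"
  assumes h: "locally_integrable h" and \<phi>: "test_function \<phi>"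
  shows "integrable lebesgue (\<lambda>x. \<phi> x *\<^sub>R h x)"
    and "b \<in> Basis \<Longrightarrow> integrable lebesgue (\<lambda>x. partial_deriv b \<phi> x *\<^sub>R h x)"
proof -
  obtain K where K: "compact K" "\<And>x. x \<notin> K \<Longrightarrow> \<phi> x = 0" using test_function_support[OF \<phi>] by blast
  show "integrable lebesgue (\<lambda>x. \<phi> x *\<^sub>R h x)"
    by (rule integrable_test_times[OF h test_function_continuous[OF \<phi>] K])
  show "integrable lebesgue (\<lambda>x. partial_deriv b \<phi> x *\<^sub>R h x)" if "b \<in> Basis"
    by (rule integrable_test_times[OF h test_function_continuous_partial[OF \<phi> that] K(1) partial_deriv_support[OF K]])
qed

section \<open>The fundamental lemma of the calculus of variations\<close>

lemma AE_0_if_box_integrals_0: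
  fixes h :: "'a::euclidean_space \<Rightarrow> real"
  assumes int: "integrable lborel h" and 0: "\<And>a b. (LINT x|lborel. indicator (box a b) x * h x) = 0"
  shows "AE x in lborel. h x = 0"
proof -
  have [measurable]: "h \<in> borel_measurable borel" using borel_measurable_integrable[OF int] by simp
  \<comment> \<open>Since \<open>ennreal\<close> sends negative numbers to 0, these are the measures
    with the positive and the negative part of \<open>h\<close> as densities.\<close>
  let ?P = "density lborel (\<lambda>x. ennreal (h x))" and ?N = "density lborel (\<lambda>x. ennreal (- h x))"
  have box: "emeasure ?P (box a b) = emeasure ?N (box a b) \<and> emeasure ?P (box a b) \<noteq> \<infinity> \<and> emeasure ?N (box a b) \<noteq> \<infinity>" for a b
  proof -
    let ?k = "\<lambda>x. indicator (box a b) x * h x"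
    have intk: "integrable lborel ?k" using integrable_mult_indicator[OF _ int, of "box a b"] by simp
    have P: "emeasure ?P (box a b) = (\<integral>\<^sup>+x. ennreal (?k x) \<partial>lborel)"
      by (subst emeasure_density) (auto intro!: nn_integral_cong simp: indicator_def)
    have N: "emeasure ?N (box a b) = (\<integral>\<^sup>+x. ennreal (- ?k x) \<partial>lborel)"
      by (subst emeasure_density) (auto intro!: nn_integral_cong simp: indicator_def)
    have fin: "(\<integral>\<^sup>+x. ennreal (?k x) \<partial>lborel) \<noteq> \<infinity>" "(\<integral>\<^sup>+x. ennreal (- ?k x) \<partial>lborel) \<noteq> \<infinity>"
      using intk by (auto simp: real_integrable_def)
    have "enn2real (\<integral>\<^sup>+x. ennreal (?k x) \<partial>lborel) = enn2real (\<integral>\<^sup>+x. ennreal (- ?k x) \<partial>lborel)"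
      using real_lebesgue_integral_def[OF intk] 0[of a b] by simp
    then have "(\<integral>\<^sup>+x. ennreal (?k x) \<partial>lborel) = (\<integral>\<^sup>+x. ennreal (- ?k x) \<partial>lborel)"
      using fin by (auto simp: less_top[symmetric] dest!: arg_cong[where f = ennreal])
    then show ?thesis using fin by (simp add: P N)
  qed
  \<comment> \<open>Boxes form an intersection-stable generator of the Borel sets, and growing cubes
    of finite measure exhaust the space.\<close>
  have "?P = ?N"
  proof (rule measure_eqI_generator_eq[where \<Omega> = UNIV and E = "range (\<lambda>(a, b). box a b)" and A = "\<lambda>n. box (- (real n *\<^sub>R One)) (real n *\<^sub>R One)"])
    show "Int_stable (range (\<lambda>(a, b). box a b :: 'a set))"
      by (auto simp: Int_stable_def box_Int_box)
    show "(\<Union>n. box (- (real n *\<^sub>R One)) (real n *\<^sub>R One)) = (UNIV :: 'a set)" by (rule UN_box_eq_UNIV)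
    show "sets ?P = sigma_sets UNIV (range (\<lambda>(a, b). box a b))" "sets ?N = sigma_sets UNIV (range (\<lambda>(a, b). box a b))"
      by (simp_all add: borel_eq_box)
  qed (use box in auto)
  then have "AE x in lborel. ennreal (h x) = ennreal (- h x)"
    by (subst (asm) sigma_finite_measure.density_unique_iff[OF sigma_finite_lborel]) auto
  then show ?thesis
  proof eventually_elim
    case (elim x)
    show ?case
    proof (cases "0 \<le> h x")
      case True
      then have "ennreal (h x) = 0" using elim by (simp add: ennreal_neg)
      then show ?thesis using True by (simp add: ennreal_eq_0_iff)
    next
      case False
      then have "ennreal (- h x) = 0" using elim by (simp add: ennreal_neg)
      then show ?thesis using False by (simp add: ennreal_eq_0_iff)
    qed
  qed
qed

text \<open>Bump functions approximate indicators of boxes, so all integrals of \<open>h\<close>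
  over boxes vanish. Testing only with \<open>smooth_germ\<close> functions matters for the density
  of \<open>H1\<close>, where membership of exactly these functions is established.\<close>

lemma fundamental_lemma_real:
  fixes h :: "'a::euclidean_space \<Rightarrow> real"
  assumes h: "locally_integrable h" and 0: "\<And>\<phi>. test_function \<phi> \<Longrightarrow> smooth_germ \<phi> \<Longrightarrow> (LINT x|lebesgue. \<phi> x * h x) = 0"
  shows "AE x in lebesgue. h x = 0"
proof -
  have hm: "h \<in> borel_measurable lebesgue" by (rule locally_integrable_measurable[OF h])
  have im: "(\<lambda>x. indicator (box a b) x * h x) \<in> borel_measurable lebesgue" for a b
    by (intro borel_measurable_times borel_measurable_indicator hm) simp
  have intc: "integrable lebesgue (\<lambda>x. indicator (cbox a b) x * h x)" for a b
    using h unfolding locally_integrable_def set_integrable_def by simp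
  have box0: "(LINT x|lebesgue. indicator (box a b) x * h x) = 0" for a b
  proof -
    have "(\<lambda>n. LINT x|lebesgue. bump a b n x * h x) \<longlonglongrightarrow> (LINT x|lebesgue. indicator (box a b) x * h x)"
    proof (rule integral_dominated_convergence[where w = "\<lambda>x. \<bar>indicator (cbox a b) x * h x\<bar>"])
      show "integrable lebesgue (\<lambda>x. \<bar>indicator (cbox a b) x * h x\<bar>)" by (rule integrable_abs[OF intc])
      show "AE x in lebesgue. (\<lambda>n. bump a b n x * h x) \<longlonglongrightarrow> indicator (box a b) x * h x"
        by (intro always_eventually allI tendsto_intros bump_tendsto)
      show "AE x in lebesgue. norm (bump a b n x * h x) \<le> \<bar>indicator (cbox a b) x * h x\<bar>" for n
      proof (intro always_eventually allI)
        fix x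
        show "norm (bump a b n x * h x) \<le> \<bar>indicator (cbox a b) x * h x\<bar>"
        proof (cases "x \<in> cbox a b")
          case True
          then show ?thesis using bump_bounds[of a b n x] by (simp add: abs_mult mult_left_le_one_le)
        next
          case False
          then have "bump a b n x = 0" using box_subset_cbox[of a b] by (intro bump_eq_0) blast
          then show ?thesis by simp
        qed
      qed
      show "(\<lambda>x. bump a b n x * h x) \<in> borel_measurable lebesgue" for n
        using integrable_test_function(1)[OF h test_function_bump, of a b n] by (auto dest: borel_measurable_integrable)
    qed (rule im)
    then show ?thesis by (simp add: 0[OF test_function_bump smooth_bump] LIMSEQ_const_iff)
  qed
  have main: "AE x in lebesgue. x \<in> box a b \<longrightarrow> h x = 0" for a b
  proof -
    let ?g = "\<lambda>x. indicator (box a b) x * h x"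
    have g: "integrable lebesgue ?g"
    proof (rule Bochner_Integration.integrable_bound[OF intc[of a b]])
      show "AE x in lebesgue. norm (?g x) \<le> norm (indicator (cbox a b) x * h x)"
        using box_subset_cbox[of a b] by (intro always_eventually allI) (auto simp: indicator_def)
    qed (rule im)
    \<comment> \<open>The argument with generators concerns Borel functions, whereas
      \<open>h\<close> is only Lebesgue measurable; cutting off to a box also makes it
      integrable.\<close>
    obtain k where k: "k \<in> borel_measurable lborel" and AE: "AE x in lborel. ?g x = k x"
      using completion_ex_borel_measurable_real[OF borel_measurable_integrable[OF g]] by blast
    have AE': "AE x in lebesgue. ?g x = k x" by (rule AE_completion[OF AE])
    have [measurable]: "k \<in> borel_measurable borel" using k by simp
    have "integrable lebesgue k"
      using g AE' k by (subst integrable_cong_AE[of _ _ ?g]) (auto intro: measurable_completion elim: eventually_mono)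
    then have intk: "integrable lborel k" by (simp add: integrable_completion)
    have "(LINT x|lborel. indicator (box c d) x * k x) = 0" for c d
    proof -
      have "(LINT x|lborel. indicator (box c d) x * k x) = (LINT x|lebesgue. indicator (box c d) x * k x)"
        by (subst integral_completion) auto
      also have "\<dots> = (LINT x|lebesgue. indicator (box c d) x * ?g x)"
      proof (rule integral_cong_AE)
        show "(\<lambda>x. indicator (box c d) x * k x) \<in> borel_measurable lebesgue" by (intro measurable_completion) simp
        show "(\<lambda>x. indicator (box c d) x * ?g x) \<in> borel_measurable lebesgue"
          by (intro borel_measurable_times borel_measurable_indicator hm) simp_all
        show "AE x in lebesgue. indicator (box c d) x * k x = indicator (box c d) x * ?g x"
          using AE' by eventually_elim simp
      qed
      also have "\<dots> = (LINT x|lebesgue. indicator (box c d \<inter> box a b) x * h x)"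
        by (simp add: indicator_inter_arith mult.assoc)
      also have "\<dots> = 0" unfolding box_Int_box by (rule box0)
      finally show ?thesis .
    qed
    from AE_completion[OF AE_0_if_box_integrals_0[OF intk this]] AE' show ?thesis
      by eventually_elim (auto simp: indicator_def)
  qed
  have "AE x in lebesgue. \<forall>n::nat. x \<in> box (- (real n *\<^sub>R One)) (real n *\<^sub>R One) \<longrightarrow> h x = 0"
    by (intro AE_all_countable[THEN iffD2] allI main)
  then show ?thesis
  proof eventually_elim
    case (elim x)
    have "x \<in> (\<Union>n. box (- (real n *\<^sub>R One)) (real n *\<^sub>R One))" by (simp add: UN_box_eq_UNIV)
    with elim show ?case by blast
  qed
qed

lemma fundamental_lemma:
  fixes h :: "'a::euclidean_space \<Rightarrow> complex"
  assumes h: "locally_integrable h" and 0: "\<And>\<phi>. test_function \<phi> \<Longrightarrow> smooth_germ \<phi> \<Longrightarrow> (LINT x|lebesgue. \<phi> x *\<^sub>R h x) = 0"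
  shows "AE x in lebesgue. h x = 0"
proof -
  have int: "integrable lebesgue (\<lambda>x. indicator K x *\<^sub>R h x)" if "compact K" for K
    using h that unfolding locally_integrable_def set_integrable_def by blast
  have "locally_integrable (\<lambda>x. Re (h x))" "locally_integrable (\<lambda>x. Im (h x))"
    unfolding locally_integrable_def set_integrable_def
    using integrable_Re[OF int] integrable_Im[OF int] by simp_all
  moreover have "(LINT x|lebesgue. \<phi> x * Re (h x)) = 0" "(LINT x|lebesgue. \<phi> x * Im (h x)) = 0"
    if \<phi>: "test_function \<phi>" "smooth_germ \<phi>" for \<phi>
    using 0[OF \<phi>] integral_Re[OF integrable_test_function(1)[OF h \<phi>(1)]] integral_Im[OF integrable_test_function(1)[OF h \<phi>(1)]]
    by simp_all
  ultimately have "AE x in lebesgue. Re (h x) = 0" "AE x in lebesgue. Im (h x) = 0"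
    using fundamental_lemma_real by blast+
  then show ?thesis by eventually_elim (simp add: complex_eq_iff)
qed

section \<open>Weak derivatives\<close>

lemma locally_integrable_add:
  "locally_integrable g \<Longrightarrow> locally_integrable h \<Longrightarrow> locally_integrable (\<lambda>x. g x + h x)"
  unfolding locally_integrable_def by (simp add: set_integral_add(1))

lemma locally_integrable_cmult:
  assumes "locally_integrable (g :: 'a::euclidean_space \<Rightarrow> complex)" shows "locally_integrable (\<lambda>x. z * g x)"
  using assms unfolding locally_integrable_def set_integrable_def
  by (simp flip: mult_scaleR_right)

lemma locally_integrable_cong:
  assumes g: "locally_integrable g" and eq: "AE x in lebesgue. g x = g' x" and m: "g' \<in> borel_measurable lebesgue"
  shows "locally_integrable g'"
  unfolding locally_integrable_def set_integrable_def
proof (intro allI impI)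
  fix K :: "'a set" assume K: "compact K"
  then have i: "integrable lebesgue (\<lambda>x. indicator K x *\<^sub>R g x)"
    using g unfolding locally_integrable_def set_integrable_def by blast
  show "integrable lebesgue (\<lambda>x. indicator K x *\<^sub>R g' x)"
  proof (rule integrable_cong_AE_imp[OF i])
    show "(\<lambda>x. indicator K x *\<^sub>R g' x) \<in> borel_measurable lebesgue"
      by (intro borel_measurable_scaleR borel_measurable_indicator m) (rule fmeasurableD[OF lmeasurable_compact[OF K]])
    show "AE x in lebesgue. indicator K x *\<^sub>R g x = indicator K x *\<^sub>R g' x" using eq by eventually_elim simp
  qed
qed

lemma sq_integrable_locally:
  fixes f :: "'a::euclidean_space \<Rightarrow> complex"
  assumes f: "sq_integrable lebesgue f" shows "locally_integrable f"
  unfolding locally_integrable_def set_integrable_def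
proof (intro allI impI)
  fix K :: "'a set" assume K: "compact K"
  have fm: "f \<in> borel_measurable lebesgue" using f by (simp add: sq_integrable_def)
  have "K \<in> lmeasurable" using K by (rule lmeasurable_compact)
  then have iK: "integrable lebesgue (indicat_real K)" by (intro integrable_real_indicator) (auto simp: fmeasurable_def)
  show "integrable lebesgue (\<lambda>x. indicator K x *\<^sub>R f x)"
  proof (rule Bochner_Integration.integrable_bound)
    show "integrable lebesgue (\<lambda>x. indicat_real K x + (cmod (f x))\<^sup>2)"
      using iK f by (simp add: sq_integrable_def)
    show "(\<lambda>x. indicator K x *\<^sub>R f x) \<in> borel_measurable lebesgue"
      by (intro borel_measurable_scaleR borel_measurable_indicator fm) (rule fmeasurableD[OF lmeasurable_compact[OF K]])
    have "r \<le> 1 + r\<^sup>2" for r :: real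
    proof -
      have "0 \<le> (r - 1/2)\<^sup>2" by simp
      then show ?thesis by (simp add: power2_eq_square algebra_simps)
    qed
    then show "AE x in lebesgue. norm (indicator K x *\<^sub>R f x) \<le> norm (indicat_real K x + (cmod (f x))\<^sup>2)"
      by (intro always_eventually allI) (auto simp: indicator_def)
  qed
qed

lemma has_weak_deriv_add:
  assumes "has_weak_deriv b g h" "has_weak_deriv b g' h'" "b \<in> Basis"
  shows "has_weak_deriv b (\<lambda>x. g x + g' x) (\<lambda>x. h x + h' x)"
  using assms unfolding has_weak_deriv_def
  by (auto simp: scaleR_right_distrib integrable_test_function locally_integrable_add)

lemma has_weak_deriv_cmult:
  assumes "has_weak_deriv b g h"
  shows "has_weak_deriv b (\<lambda>x. z * g x) (\<lambda>x. z * h x)"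
  using assms unfolding has_weak_deriv_def
  by (auto simp: locally_integrable_cmult simp flip: mult_scaleR_right)

lemma has_weak_deriv_cong:
  assumes g: "has_weak_deriv b g h" and eq: "AE x in lebesgue. g x = g' x" "AE x in lebesgue. h x = h' x"
    and m: "g' \<in> borel_measurable lebesgue" "h' \<in> borel_measurable lebesgue" and b: "b \<in> Basis"
  shows "has_weak_deriv b g' h'"
  unfolding has_weak_deriv_def
proof (intro conjI allI impI)
  have lg: "locally_integrable g" and lh: "locally_integrable h" using g unfolding has_weak_deriv_def by auto
  show lg': "locally_integrable g'" by (rule locally_integrable_cong[OF lg eq(1) m(1)])
  show lh': "locally_integrable h'" by (rule locally_integrable_cong[OF lh eq(2) m(2)])
  fix \<phi> :: "'a \<Rightarrow> real" assume \<phi>: "test_function \<phi>"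
  have "(LINT x|lebesgue. partial_deriv b \<phi> x *\<^sub>R g' x) = (LINT x|lebesgue. partial_deriv b \<phi> x *\<^sub>R g x)"
    using eq(1) integrable_test_function(2)[OF lg \<phi> b] integrable_test_function(2)[OF lg' \<phi> b]
    by (intro integral_cong_AE) (auto elim: eventually_mono)
  moreover have "(LINT x|lebesgue. \<phi> x *\<^sub>R h' x) = (LINT x|lebesgue. \<phi> x *\<^sub>R h x)"
    using eq(2) integrable_test_function(1)[OF lh \<phi>] integrable_test_function(1)[OF lh' \<phi>]
    by (intro integral_cong_AE) (auto elim: eventually_mono)
  ultimately show "(LINT x|lebesgue. partial_deriv b \<phi> x *\<^sub>R g' x) = - (LINT x|lebesgue. \<phi> x *\<^sub>R h' x)"
    using g \<phi> unfolding has_weak_deriv_def by simp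
qed

lemma has_weak_deriv_unique:
  assumes "has_weak_deriv b g h" "has_weak_deriv b g h'"
  shows "AE x in lebesgue. h x = h' x"
proof -
  have l: "locally_integrable h" "locally_integrable h'" using assms unfolding has_weak_deriv_def by auto
  have "locally_integrable (\<lambda>x. h x + (- 1) * h' x)"
    by (intro locally_integrable_add locally_integrable_cmult l)
  moreover have "(LINT x|lebesgue. \<phi> x *\<^sub>R (h x + (- 1) * h' x)) = 0" if \<phi>: "test_function \<phi>" for \<phi>
  proof -
    have "(LINT x|lebesgue. \<phi> x *\<^sub>R (h x + (- 1) * h' x)) = (LINT x|lebesgue. \<phi> x *\<^sub>R h x - \<phi> x *\<^sub>R h' x)"
      by (simp add: scaleR_diff_right)
    also have "\<dots> = (LINT x|lebesgue. \<phi> x *\<^sub>R h x) - (LINT x|lebesgue. \<phi> x *\<^sub>R h' x)"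
      by (intro Bochner_Integration.integral_diff integrable_test_function l \<phi>)
    also have "\<dots> = 0"
      using assms \<phi> unfolding has_weak_deriv_def by (metis diff_self neg_equal_iff_equal)
    finally show ?thesis .
  qed
  ultimately have "AE x in lebesgue. h x + (- 1) * h' x = 0" by (rule fundamental_lemma)
  then show ?thesis by eventually_elim simp
qed

lemma has_weak_deriv_weak_deriv: "has_weak_deriv b g h \<Longrightarrow> has_weak_deriv b g (weak_deriv b g)"
  unfolding weak_deriv_def by (rule someI[of "\<lambda>h. has_weak_deriv b g h"])

lemma weak_deriv_AE: "has_weak_deriv b g h \<Longrightarrow> AE x in lebesgue. weak_deriv b g x = h x"
  using has_weak_deriv_unique[OF has_weak_deriv_weak_deriv] by blast

lemma has_weak_deriv_measurable:
  "has_weak_deriv b g h \<Longrightarrow> g \<in> borel_measurable lebesgue"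
  "has_weak_deriv b g h \<Longrightarrow> h \<in> borel_measurable lebesgue"
  unfolding has_weak_deriv_def by (auto intro: locally_integrable_measurable)

lemma sq_integrable_cong:
  assumes "sq_integrable lebesgue f" "AE x in lebesgue. f x = g x" "g \<in> borel_measurable lebesgue"
  shows "sq_integrable lebesgue g"
proof -
  have "integrable lebesgue (\<lambda>x. (cmod (g x))\<^sup>2)"
  proof (rule integrable_cong_AE_imp)
    show "integrable lebesgue (\<lambda>x. (cmod (f x))\<^sup>2)" using assms by (simp add: sq_integrable_def)
    show "AE x in lebesgue. (cmod (f x))\<^sup>2 = (cmod (g x))\<^sup>2" using assms(2) by eventually_elim simp
    show "(\<lambda>x. (cmod (g x))\<^sup>2) \<in> borel_measurable lebesgue" using assms(3) by simp
  qed
  with assms(3) show ?thesis by (simp add: sq_integrable_def)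
qed

section \<open>The Sobolev space \<open>H1\<close>\<close>

definition wd :: "'a::euclidean_space \<Rightarrow> 'a L2 \<Rightarrow> 'a \<Rightarrow> complex" where
  "wd b \<psi> = weak_deriv b (rep_L2 \<psi>)"

lemma H1D:
  assumes "\<psi> \<in> H1" "b \<in> Basis"
  shows "has_weak_deriv b (rep_L2 \<psi>) (wd b \<psi>)" "sq_integrable lebesgue (wd b \<psi>)"
proof -
  obtain h where h: "has_weak_deriv b (rep_L2 \<psi>) h" "sq_integrable lebesgue h"
    using assms unfolding H1_def by blast
  show *: "has_weak_deriv b (rep_L2 \<psi>) (wd b \<psi>)"
    unfolding wd_def by (rule has_weak_deriv_weak_deriv[OF h(1)])
  show "sq_integrable lebesgue (wd b \<psi>)"
    by (rule sq_integrable_cong[OF h(2) has_weak_deriv_unique[OF h(1) *] has_weak_deriv_measurable(2)[OF *]])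
qed

text \<open>\<open>rep_L2\<close> yields an arbitrary representative. Weak derivatives are
  insensitive to null sets, so a convenient function \<open>g\<close> may be used instead.\<close>

lemma H1I:
  assumes eq: "AE x in lebesgue. rep_L2 \<psi> x = g x"
    and ex: "\<And>b. b \<in> Basis \<Longrightarrow> \<exists>h. has_weak_deriv b g h \<and> sq_integrable lebesgue h"
  shows "\<psi> \<in> H1"
  unfolding H1_def
proof (intro CollectI ballI)
  fix b :: 'a assume b: "b \<in> Basis"
  then obtain h where h: "has_weak_deriv b g h" "sq_integrable lebesgue h" using ex by blast
  have "AE x in lebesgue. g x = rep_L2 \<psi> x" using eq by eventually_elim simp
  then have "has_weak_deriv b (rep_L2 \<psi>) h"
    by (intro has_weak_deriv_cong[OF h(1)]) (use h b in \<open>auto simp: sq_integrable_def\<close>)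
  with h show "\<exists>h. has_weak_deriv b (rep_L2 \<psi>) h \<and> sq_integrable lebesgue h" by blast
qed

lemma wd_AE:
  assumes eq: "AE x in lebesgue. rep_L2 \<psi> x = g x" and h: "has_weak_deriv b g h" and b: "b \<in> Basis"
  shows "AE x in lebesgue. wd b \<psi> x = h x"
proof -
  have "AE x in lebesgue. g x = rep_L2 \<psi> x" using eq by eventually_elim simp
  then have "has_weak_deriv b (rep_L2 \<psi>) h"
    by (intro has_weak_deriv_cong[OF h]) (use has_weak_deriv_measurable[OF h] b in auto)
  then show ?thesis unfolding wd_def by (rule weak_deriv_AE)
qed

lemma H1_add: "\<phi> \<in> H1 \<Longrightarrow> \<psi> \<in> H1 \<Longrightarrow> \<phi> + \<psi> \<in> H1"
  by (rule H1I[OF rep_plus]) (blast intro: has_weak_deriv_add sq_integrable_add H1D)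

lemma H1_cscale: "\<psi> \<in> H1 \<Longrightarrow> z *\<^sub>C \<psi> \<in> H1"
  by (rule H1I[OF rep_cscale]) (blast intro: has_weak_deriv_cmult sq_integrable_cmult H1D)

lemma wd_add:
  "\<phi> \<in> H1 \<Longrightarrow> \<psi> \<in> H1 \<Longrightarrow> b \<in> Basis \<Longrightarrow> AE x in lebesgue. wd b (\<phi> + \<psi>) x = wd b \<phi> x + wd b \<psi> x"
  by (rule wd_AE[OF rep_plus]) (auto intro: has_weak_deriv_add H1D)

lemma wd_cscale:
  "\<psi> \<in> H1 \<Longrightarrow> b \<in> Basis \<Longrightarrow> AE x in lebesgue. wd b (z *\<^sub>C \<psi>) x = z * wd b \<psi> x"
  by (rule wd_AE[OF rep_cscale]) (auto intro: has_weak_deriv_cmult H1D)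

lemma has_weak_deriv_zero: "has_weak_deriv b (\<lambda>x. 0) (\<lambda>x. 0)"
  unfolding has_weak_deriv_def locally_integrable_def set_integrable_def by simp

lemma H1_zero: "0 \<in> H1"
  by (rule H1I[OF rep_zero]) (blast intro: has_weak_deriv_zero sq_integrable_zero)

lemma has_weak_deriv_of_smooth:
  assumes g: "smooth_germ g" and b: "b \<in> Basis"
  shows "has_weak_deriv b (\<lambda>x. complex_of_real (g x)) (\<lambda>x. complex_of_real (partial_deriv b g x))"
proof -
  have smooth: "smooth_germ (partial_deriv b g)" using smooth_germ_deriv[OF g] by blast
  have cont: "continuous_on UNIV f" if "smooth_germ f" for f :: "'a \<Rightarrow> real"
    using smooth_germ_C_k[OF that, of 0] by simp
  have loc: "locally_integrable (\<lambda>x. complex_of_real (f x))" if "continuous_on UNIV f" for f :: "'a \<Rightarrow> real"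
    unfolding locally_integrable_def set_integrable_def
  proof (intro allI impI)
    fix K :: "'a set" assume "compact K"
    then have "integrable lborel (\<lambda>x. indicator K x *\<^sub>R complex_of_real (f x))"
      by (intro borel_integrable_compact continuous_intros continuous_on_subset[OF that]) auto
    then show "integrable lebesgue (\<lambda>x. indicator K x *\<^sub>R complex_of_real (f x))"
      by (subst integrable_completion) (auto dest: borel_measurable_integrable)
  qed
  show ?thesis
    unfolding has_weak_deriv_def
  proof (intro conjI allI impI loc cont g smooth)
    fix \<phi> :: "'a \<Rightarrow> real" assume \<phi>: "test_function \<phi>"
    obtain K where K: "compact K" "\<And>x. x \<notin> K \<Longrightarrow> \<phi> x = 0" using test_function_support[OF \<phi>] by blast
    have "(LINT x|lebesgue. partial_deriv b \<phi> x * g x) = - (LINT x|lebesgue. \<phi> x * partial_deriv b g x)"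
      using smooth_germ_deriv[OF g]
      by (intro integral_by_parts[OF test_function_differentiable[OF \<phi>] test_function_continuous_partial[OF \<phi> b] _ cont[OF smooth] K b]) blast
    then show "(LINT x|lebesgue. partial_deriv b \<phi> x *\<^sub>R complex_of_real (g x)) =
        - (LINT x|lebesgue. \<phi> x *\<^sub>R complex_of_real (partial_deriv b g x))"
      by (simp add: scaleR_conv_of_real flip: of_real_mult)
  qed
qed

lemma H1_test_function:
  assumes \<phi>: "test_function \<phi>" "smooth_germ \<phi>"
  shows "abs_L2 (\<lambda>x. complex_of_real (\<phi> x)) \<in> H1"
    and "AE x in lebesgue. rep_L2 (abs_L2 (\<lambda>x. complex_of_real (\<phi> x))) x = complex_of_real (\<phi> x)"
proof -
  obtain K where K: "compact K" "\<And>x. x \<notin> K \<Longrightarrow> \<phi> x = 0" using test_function_support[OF \<phi>(1)] by blast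
  have sq: "sq_integrable lebesgue (\<lambda>x. complex_of_real (f x))"
    if f: "continuous_on UNIV f" "\<And>x. x \<notin> K \<Longrightarrow> f x = 0" for f :: "'a \<Rightarrow> real"
  proof -
    have "integrable lborel (\<lambda>x. indicator K x *\<^sub>R (f x)\<^sup>2)"
      by (intro borel_integrable_compact continuous_intros K continuous_on_subset[OF f(1)]) auto
    moreover have "(\<lambda>x. indicator K x *\<^sub>R (f x)\<^sup>2) = (\<lambda>x. (f x)\<^sup>2)"
    proof
      show "indicator K x *\<^sub>R (f x)\<^sup>2 = (f x)\<^sup>2" for x using f(2)[of x] by (cases "x \<in> K") auto
    qed
    moreover have "f \<in> borel_measurable lborel" by (simp add: borel_measurable_continuous_onI[OF f(1)])
    ultimately show ?thesis
      unfolding sq_integrable_def by (auto simp: integrable_completion intro!: measurable_completion)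
  qed
  have cont: "continuous_on UNIV f" if "smooth_germ f" for f :: "'a \<Rightarrow> real"
    using smooth_germ_C_k[OF that, of 0] by simp
  show rep: "AE x in lebesgue. rep_L2 (abs_L2 (\<lambda>x. complex_of_real (\<phi> x))) x = complex_of_real (\<phi> x)"
    by (intro rep_abs_L2 sq cont \<phi> K)
  show "abs_L2 (\<lambda>x. complex_of_real (\<phi> x)) \<in> H1"
  proof (rule H1I[OF rep])
    fix b :: 'a assume b: "b \<in> Basis"
    have "sq_integrable lebesgue (\<lambda>x. complex_of_real (partial_deriv b \<phi> x))"
      by (intro sq test_function_continuous_partial \<phi> b partial_deriv_support[OF K])
    with has_weak_deriv_of_smooth[OF \<phi>(2) b]
    show "\<exists>h. has_weak_deriv b (\<lambda>x. complex_of_real (\<phi> x)) h \<and> sq_integrable lebesgue h" by blast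
  qed
qed

text \<open>Density of \<open>H1\<close> in \<open>L2\<close>: smooth functions with compact support
  belong to \<open>H1\<close>, and the fundamental lemma applies to \<open>rep_L2 f\<close>.\<close>

lemma H1_total:
  assumes "\<And>\<phi>. \<phi> \<in> H1 \<Longrightarrow> cinner \<phi> f = 0" shows "f = 0"
proof -
  have "AE x in lebesgue. rep_L2 f x = 0"
  proof (rule fundamental_lemma[OF sq_integrable_locally[OF sq_integrable_rep]])
    fix \<phi> :: "'a \<Rightarrow> real" assume \<phi>: "test_function \<phi>" "smooth_germ \<phi>"
    let ?\<Phi> = "abs_L2 (\<lambda>x. complex_of_real (\<phi> x))"
    have "(LINT x|lebesgue. \<phi> x *\<^sub>R rep_L2 f x) = (LINT x|lebesgue. cnj (rep_L2 ?\<Phi> x) * rep_L2 f x)"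
    proof (rule integral_cong_AE)
      show "(\<lambda>x. \<phi> x *\<^sub>R rep_L2 f x) \<in> borel_measurable lebesgue"
        by (rule borel_measurable_integrable[OF integrable_test_function(1)[OF sq_integrable_locally[OF sq_integrable_rep] \<phi>(1)]])
      show "(\<lambda>x. cnj (rep_L2 ?\<Phi> x) * rep_L2 f x) \<in> borel_measurable lebesgue"
        by (rule borel_measurable_integrable[OF sq_integrable_inner[OF sq_integrable_rep sq_integrable_rep]])
      show "AE x in lebesgue. \<phi> x *\<^sub>R rep_L2 f x = cnj (rep_L2 ?\<Phi> x) * rep_L2 f x"
        using H1_test_function(2)[OF \<phi>] by eventually_elim (simp add: scaleR_conv_of_real)
    qed
    also have "\<dots> = 0" using assms[OF H1_test_function(1)[OF \<phi>]] by (simp add: cinner_eq)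
    finally show "(LINT x|lebesgue. \<phi> x *\<^sub>R rep_L2 f x) = 0" .
  qed
  with rep_zero have "AE x in lebesgue. rep_L2 f x = rep_L2 0 x" by eventually_elim simp
  then show ?thesis by (rule L2_eqI)
qed

section \<open>Comparison of the forms\<close>

lemma integrable_weighted_inner:
  fixes w :: "'a \<Rightarrow> real"
  assumes f: "sq_integrable M f" and g: "sq_integrable M g" and w: "w \<in> borel_measurable M" "\<And>x. \<bar>w x\<bar> \<le> C"
  shows "integrable M (\<lambda>x. complex_of_real (w x) * (cnj (f x) * g x))"
proof (rule Bochner_Integration.integrable_bound)
  show "integrable M (\<lambda>x. C *\<^sub>R (cnj (f x) * g x))" by (intro integrable_scaleR_right sq_integrable_inner f g)
  show "(\<lambda>x. complex_of_real (w x) * (cnj (f x) * g x)) \<in> borel_measurable M"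
    by (rule borel_measurable_times[OF _ borel_measurable_integrable[OF sq_integrable_inner[OF f g]]]) (use w in simp)
  have "0 \<le> C" using w(2) abs_ge_zero order_trans by blast
  then show "AE x in M. norm (complex_of_real (w x) * (cnj (f x) * g x)) \<le> norm (C *\<^sub>R (cnj (f x) * g x))"
    using w(2) by (intro always_eventually allI) (auto simp: norm_mult intro!: mult_right_mono)
qed

text \<open>Covers the kinetic terms, with \<open>D\<close> a weak partial derivative, and the
  potential term, with \<open>D = rep_L2\<close>. Both are linear only almost everywhere, as both
  depend on chosen representatives.\<close>

lemma sesquilinear_integral:
  fixes D :: "'a::euclidean_space L2 \<Rightarrow> 'b \<Rightarrow> complex" and w :: "'b \<Rightarrow> real"
  defines "k \<equiv> \<lambda>\<phi> \<psi> x. complex_of_real (w x) * (cnj (D \<phi> x) * D \<psi> x)"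
  assumes zero: "0 \<in> Q" and add: "\<And>\<phi> \<psi>. \<phi> \<in> Q \<Longrightarrow> \<psi> \<in> Q \<Longrightarrow> \<phi> + \<psi> \<in> Q"
    and scale: "\<And>z \<phi>. \<phi> \<in> Q \<Longrightarrow> z *\<^sub>C \<phi> \<in> Q"
    and D_add: "\<And>\<phi> \<psi>. \<phi> \<in> Q \<Longrightarrow> \<psi> \<in> Q \<Longrightarrow> AE x in M. D (\<phi> + \<psi>) x = D \<phi> x + D \<psi> x"
    and D_scale: "\<And>z \<phi>. \<phi> \<in> Q \<Longrightarrow> AE x in M. D (z *\<^sub>C \<phi>) x = z * D \<phi> x"
    and int: "\<And>\<phi> \<psi>. \<phi> \<in> Q \<Longrightarrow> \<psi> \<in> Q \<Longrightarrow> integrable M (k \<phi> \<psi>)"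
  shows "sesquilinear_form Q (\<lambda>\<phi> \<psi>. integral\<^sup>L M (k \<phi> \<psi>))"
proof
  note meas = borel_measurable_integrable[OF int]
  fix \<xi> \<phi> \<psi> assume Q: "\<xi> \<in> Q" "\<phi> \<in> Q" "\<psi> \<in> Q"
  have "integral\<^sup>L M (k \<xi> (\<phi> + \<psi>)) = (LINT x|M. k \<xi> \<phi> x + k \<xi> \<psi> x)"
  proof (rule integral_cong_AE)
    show "AE x in M. k \<xi> (\<phi> + \<psi>) x = k \<xi> \<phi> x + k \<xi> \<psi> x"
      using D_add[OF Q(2,3)] by eventually_elim (simp add: k_def distrib_left)
  qed (intro meas borel_measurable_add Q add)+
  then show "integral\<^sup>L M (k \<xi> (\<phi> + \<psi>)) = integral\<^sup>L M (k \<xi> \<phi>) + integral\<^sup>L M (k \<xi> \<psi>)"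
    using int Q by simp
next
  note meas = borel_measurable_integrable[OF int]
  fix \<xi> \<phi> z assume Q: "\<xi> \<in> Q" "\<phi> \<in> Q"
  have "integral\<^sup>L M (k \<xi> (z *\<^sub>C \<phi>)) = (LINT x|M. z * k \<xi> \<phi> x)"
  proof (rule integral_cong_AE)
    show "AE x in M. k \<xi> (z *\<^sub>C \<phi>) x = z * k \<xi> \<phi> x"
      using D_scale[OF Q(2), of z] by eventually_elim (simp add: k_def)
  qed (intro meas borel_measurable_times borel_measurable_const Q scale)+
  then show "integral\<^sup>L M (k \<xi> (z *\<^sub>C \<phi>)) = z * integral\<^sup>L M (k \<xi> \<phi>)" by simp
next
  show "integral\<^sup>L M (k \<psi> \<phi>) = cnj (integral\<^sup>L M (k \<phi> \<psi>))" for \<phi> \<psi>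
    unfolding Bochner_Integration.integral_cnj[symmetric] by (simp add: k_def mult.commute)
qed (auto intro: zero add scale)

text \<open>A summand is required to supply the closure properties of \<open>Q\<close>, which are
  part of the notion of a sesquilinear form.\<close>

lemma sesquilinear_sum:
  assumes "I \<noteq> {}" and q: "\<And>i. i \<in> I \<Longrightarrow> sesquilinear_form Q (q i)"
  shows "sesquilinear_form Q (\<lambda>\<phi> \<psi>. \<Sum>i\<in>I. q i \<phi> \<psi>)"
proof -
  obtain i where "i \<in> I" using assms(1) by blast
  then interpret i: sesquilinear_form Q "q i" by (rule q)
  note q' = q[THEN sesquilinear_form.q_add_right] q[THEN sesquilinear_form.q_scale_right]
  show ?thesis
    by unfold_locales
      (auto simp: i.zero_Q i.add_Q i.scale_Q q' sum.distrib sum_distrib_left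
        intro!: sum.cong sesquilinear_form.q_commute[OF q])
qed

lemma sesquilinear_add_potential:
  assumes q: "sesquilinear_form Q q" and V: "V \<in> borel_measurable lebesgue"
    and int: "\<And>\<psi>. \<psi> \<in> Q \<Longrightarrow> integrable lebesgue (\<lambda>x. V x * (cmod (rep_L2 \<psi> x))\<^sup>2)"
  shows "sesquilinear_form Q (add_potential q V)"
proof -
  interpret q: sesquilinear_form Q q by (rule q)
  let ?k = "\<lambda>\<phi> \<psi> x. complex_of_real (V x) * (cnj (rep_L2 \<phi> x) * rep_L2 \<psi> x)"
  interpret p: sesquilinear_form Q "\<lambda>\<phi> \<psi>. integral\<^sup>L lebesgue (?k \<phi> \<psi>)"
  proof (rule sesquilinear_integral[OF q.zero_Q q.add_Q q.scale_Q rep_plus rep_cscale])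
    fix \<phi> \<psi> assume Q: "\<phi> \<in> Q" "\<psi> \<in> Q"
    show "integrable lebesgue (?k \<phi> \<psi>)"
    proof (rule Bochner_Integration.integrable_bound)
      show "integrable lebesgue (\<lambda>x. \<bar>V x * (cmod (rep_L2 \<phi> x))\<^sup>2\<bar> + \<bar>V x * (cmod (rep_L2 \<psi> x))\<^sup>2\<bar>)"
        by (intro Bochner_Integration.integrable_add integrable_abs int Q)
      have "r * s \<le> r\<^sup>2 + s\<^sup>2" for r s :: real
      proof -
        have "0 \<le> (r - s)\<^sup>2 + r\<^sup>2 + s\<^sup>2" by simp
        then show ?thesis by (simp add: power2_eq_square algebra_simps)
      qed
      then have "\<bar>v\<bar> * (r * s) \<le> \<bar>v\<bar> * r\<^sup>2 + \<bar>v\<bar> * s\<^sup>2" for v r s :: real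
        by (metis abs_ge_zero distrib_left mult_left_mono)
      then show "AE x in lebesgue. norm (?k \<phi> \<psi> x) \<le> norm (\<bar>V x * (cmod (rep_L2 \<phi> x))\<^sup>2\<bar> + \<bar>V x * (cmod (rep_L2 \<psi> x))\<^sup>2\<bar>)"
        by (intro always_eventually allI) (simp add: norm_mult abs_mult)
      show "?k \<phi> \<psi> \<in> borel_measurable lebesgue"
        by (rule borel_measurable_times[OF _ borel_measurable_integrable[OF sq_integrable_inner[OF sq_integrable_rep sq_integrable_rep]]])
          (use V in simp)
    qed
  qed auto
  show ?thesis
    by unfold_locales
      (auto simp: add_potential_def q.zero_Q q.add_Q q.scale_Q q.q_add_right p.q_add_right q.q_scale_right
        p.q_scale_right distrib_left q.q_commute[symmetric] p.q_commute[symmetric] simp del: of_real_mult)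
qed

lemma cnj_mult_self: "cnj z * z = complex_of_real ((cmod z)\<^sup>2)"
  by (simp add: complex_norm_square mult.commute del: of_real_power)

lemma Re_add_potential:
  "Re (add_potential q V \<psi> \<psi>) = Re (q \<psi> \<psi>) + (LINT x|lebesgue. V x * (cmod (rep_L2 \<psi> x))\<^sup>2)"
  unfolding add_potential_def cnj_mult_self of_real_mult[symmetric] integral_complex_of_real by simp

text \<open>A common frame on \<open>H1\<close> for both kinetic forms: \<open>w = 1\<close> is the
  Dirichlet form, and \<open>w = u^2\<close> is the ground state form pulled back by multiplication
  with \<open>u\<close>.\<close>

definition gradient_form :: "('a::euclidean_space \<Rightarrow> real) \<Rightarrow> 'a form" where
  "gradient_form w \<phi> \<psi> = (\<Sum>b\<in>Basis. LINT x|lebesgue. complex_of_real (w x) * (cnj (wd b \<phi> x) * wd b \<psi> x))"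

lemma dirichlet_form_eq: "dirichlet_form = gradient_form (\<lambda>x. 1)"
  by (simp add: dirichlet_form_def gradient_form_def wd_def fun_eq_iff)

lemma Re_gradient_form:
  "Re (gradient_form w \<psi> \<psi>) = (\<Sum>b\<in>Basis. LINT x|lebesgue. w x * (cmod (wd b \<psi> x))\<^sup>2)"
  unfolding gradient_form_def cnj_mult_self of_real_mult[symmetric] integral_complex_of_real by simp

lemma integrable_weighted_sq:
  fixes w :: "'a \<Rightarrow> real"
  assumes "sq_integrable M f" "w \<in> borel_measurable M" "\<And>x. \<bar>w x\<bar> \<le> C"
  shows "integrable M (\<lambda>x. w x * (cmod (f x))\<^sup>2)"
  using integrable_Re[OF integrable_weighted_inner[OF assms(1) assms(1) assms(2,3)]]
  unfolding cnj_mult_self of_real_mult[symmetric] by simp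

lemma sesquilinear_gradient_form:
  assumes w: "w \<in> borel_measurable lebesgue" "\<And>x. \<bar>w x\<bar> \<le> C"
  shows "sesquilinear_form H1 (gradient_form w)"
proof -
  have "sesquilinear_form H1 (\<lambda>\<phi> \<psi>. LINT x|lebesgue. complex_of_real (w x) * (cnj (wd b \<phi> x) * wd b \<psi> x))"
    if b: "b \<in> Basis" for b
    by (rule sesquilinear_integral[OF H1_zero H1_add H1_cscale wd_add wd_cscale])
      (use b in \<open>auto intro!: integrable_weighted_inner[OF H1D(2) H1D(2) w]\<close>)
  then show ?thesis
    unfolding gradient_form_def[abs_def] by (intro sesquilinear_sum) auto
qed

lemma closed_semibounded_add_potential:
  assumes "sesquilinear_form Q q" "V \<in> borel_measurable lebesgue" "form_sum_well_defined Q q V"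
    and "\<And>f. (\<And>\<phi>. \<phi> \<in> Q \<Longrightarrow> cinner \<phi> f = 0) \<Longrightarrow> f = 0"
  shows "closed_semibounded_form Q (add_potential q V)"
proof (intro closed_semibounded_form.intro closed_semibounded_form_axioms.intro)
  show "sesquilinear_form Q (add_potential q V)"
    using assms(3) by (intro sesquilinear_add_potential assms(1,2)) (simp add: form_sum_well_defined_def)
qed (use assms(3,4) in \<open>auto simp: form_sum_well_defined_def\<close>)

section \<open>Multiplication operators by bounded functions\<close>

definition mulL2 :: "('a::euclidean_space \<Rightarrow> real) \<Rightarrow> 'a L2 \<Rightarrow> 'a L2" where
  "mulL2 w \<psi> = abs_L2 (\<lambda>x. complex_of_real (w x) * rep_L2 \<psi> x)"

lemma sq_integrable_mult:
  assumes f: "sq_integrable M f" and w: "w \<in> borel_measurable M" "\<And>x. \<bar>w x\<bar> \<le> C"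
  shows "sq_integrable M (\<lambda>x. complex_of_real (w x) * f x)"
proof -
  have "\<bar>(w x)\<^sup>2\<bar> \<le> C\<^sup>2" for x using power_mono[OF w(2)[of x], of 2] by simp
  then have "integrable M (\<lambda>x. (w x)\<^sup>2 * (cmod (f x))\<^sup>2)"
    using w(1) by (intro integrable_weighted_sq[OF f]) auto
  then show ?thesis using f w(1) by (auto simp: sq_integrable_def norm_mult power_mult_distrib)
qed

context
  fixes w :: "'a::euclidean_space \<Rightarrow> real" and C
  assumes w: "w \<in> borel_measurable lebesgue" "\<And>x. \<bar>w x\<bar> \<le> C"
begin

lemma rep_mulL2: "AE x in lebesgue. rep_L2 (mulL2 w \<psi>) x = complex_of_real (w x) * rep_L2 \<psi> x"
  unfolding mulL2_def by (intro rep_abs_L2 sq_integrable_mult[OF _ w] sq_integrable_rep)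

lemma linear_mulL2: "Vector_Spaces.linear cscale cscale (mulL2 w)"
proof (rule linear_cscaleI)
  show "mulL2 w (\<phi> + \<psi>) = mulL2 w \<phi> + mulL2 w \<psi>" for \<phi> \<psi>
  proof (rule L2_eqI)
    show "AE x in lebesgue. rep_L2 (mulL2 w (\<phi> + \<psi>)) x = rep_L2 (mulL2 w \<phi> + mulL2 w \<psi>) x"
      using rep_mulL2[of "\<phi> + \<psi>"] rep_mulL2[of \<phi>] rep_mulL2[of \<psi>] rep_plus[of \<phi> \<psi>] rep_plus[of "mulL2 w \<phi>" "mulL2 w \<psi>"]
      by eventually_elim (simp add: distrib_left)
  qed
  show "mulL2 w (z *\<^sub>C \<phi>) = z *\<^sub>C mulL2 w \<phi>" for z \<phi>
  proof (rule L2_eqI)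
    show "AE x in lebesgue. rep_L2 (mulL2 w (z *\<^sub>C \<phi>)) x = rep_L2 (z *\<^sub>C mulL2 w \<phi>) x"
      using rep_mulL2[of "z *\<^sub>C \<phi>"] rep_mulL2[of \<phi>] rep_cscale[of z \<phi>] rep_cscale[of z "mulL2 w \<phi>"]
      by eventually_elim simp
  qed
qed

lemma norm_mulL2: "(norm (mulL2 w \<psi>))\<^sup>2 = (LINT x|lebesgue. (w x)\<^sup>2 * (cmod (rep_L2 \<psi> x))\<^sup>2)"
  using norm_L2_eq[OF rep_mulL2, of \<psi>] w(1) by (simp add: norm_mult power_mult_distrib)

lemma cinner_mulL2: "cinner (mulL2 w \<phi>) f = cinner \<phi> (mulL2 w f)"
  unfolding cinner_eq
proof (rule integral_cong_AE)
  show "AE x in lebesgue. cnj (rep_L2 (mulL2 w \<phi>) x) * rep_L2 f x = cnj (rep_L2 \<phi> x) * rep_L2 (mulL2 w f) x"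
    using rep_mulL2[of \<phi>] rep_mulL2[of f] by eventually_elim simp
qed (rule borel_measurable_integrable[OF sq_integrable_inner[OF sq_integrable_rep sq_integrable_rep]])+

end

section \<open>Forms and norms under multiplication by a weight between two positive
  constants\<close>

locale regular_weight =
  fixes u :: "'a::euclidean_space \<Rightarrow> real" and c1 c2 :: real
  assumes cont: "continuous_on UNIV u" and c1_pos: "0 < c1" and lower: "c1 \<le> u x" and upper: "u x \<le> c2"
begin

lemma u_pos: "0 < u x" using c1_pos lower[of x] by linarith

lemma c2_pos: "0 < c2" using u_pos upper order_less_le_trans by blast

lemma u_meas [measurable]: "u \<in> borel_measurable lebesgue"
  by (intro measurable_completion) (simp add: borel_measurable_continuous_onI[OF cont])

lemma u_bound: "\<bar>u x\<bar> \<le> c2" using u_pos[of x] upper[of x] by simp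

lemma inv_meas: "(\<lambda>x. 1 / u x) \<in> borel_measurable lebesgue" by simp

lemma inv_bound: "\<bar>1 / u x\<bar> \<le> 1 / c1"
  using u_pos[of x] lower[of x] c1_pos by (simp add: frac_le)

lemma sq_bounds: "c1\<^sup>2 \<le> (u x)\<^sup>2" "(u x)\<^sup>2 \<le> c2\<^sup>2"
  using c1_pos lower[of x] upper[of x] u_pos[of x] by (auto intro!: power_mono)

lemma sq_meas: "(\<lambda>x. (u x)\<^sup>2) \<in> borel_measurable lebesgue" by simp

lemma sq_bound: "\<bar>(u x)\<^sup>2\<bar> \<le> c2\<^sup>2" using sq_bounds[of x] by simp

abbreviation J :: "'a L2 \<Rightarrow> 'a L2" where "J \<equiv> mulL2 u"
abbreviation K :: "'a L2 \<Rightarrow> 'a L2" where "K \<equiv> mulL2 (\<lambda>x. 1 / u x)"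

lemmas rep_J = rep_mulL2[OF u_meas u_bound] and rep_K = rep_mulL2[OF inv_meas inv_bound]

lemma K_J: "K (J \<psi>) = \<psi>"
proof (rule L2_eqI)
  show "AE x in lebesgue. rep_L2 (K (J \<psi>)) x = rep_L2 \<psi> x"
    using rep_K[of "J \<psi>"] rep_J[of \<psi>]
  proof eventually_elim
    case (elim x)
    then show ?case using u_pos[of x] by simp
  qed
qed

lemma J_K: "J (K \<psi>) = \<psi>"
proof (rule L2_eqI)
  show "AE x in lebesgue. rep_L2 (J (K \<psi>)) x = rep_L2 \<psi> x"
    using rep_J[of "K \<psi>"] rep_K[of \<psi>]
  proof eventually_elim
    case (elim x)
    then show ?case using u_pos[of x] by simp
  qed
qed

lemma linear_J: "Vector_Spaces.linear cscale cscale J" by (rule linear_mulL2[OF u_meas u_bound])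
lemma linear_K: "Vector_Spaces.linear cscale cscale K" by (rule linear_mulL2[OF inv_meas inv_bound])

lemma sq_integrable_weighted: "sq_integrable (weighted u) g \<longleftrightarrow> sq_integrable lebesgue g"
proof -
  have m: "g \<in> borel_measurable (weighted u) \<longleftrightarrow> g \<in> borel_measurable lebesgue"
    unfolding weighted_def by simp
  have "integrable (weighted u) (\<lambda>x. (cmod (g x))\<^sup>2) \<longleftrightarrow> integrable lebesgue (\<lambda>x. (cmod (g x))\<^sup>2)"
    if g: "g \<in> borel_measurable lebesgue"
  proof -
    have "integrable (weighted u) (\<lambda>x. (cmod (g x))\<^sup>2) \<longleftrightarrow> integrable lebesgue (\<lambda>x. (u x)\<^sup>2 * (cmod (g x))\<^sup>2)"
      unfolding weighted_def using g by (subst integrable_density) auto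
    also have "\<dots> \<longleftrightarrow> integrable lebesgue (\<lambda>x. (cmod (g x))\<^sup>2)"
    proof
      assume i: "integrable lebesgue (\<lambda>x. (u x)\<^sup>2 * (cmod (g x))\<^sup>2)"
      have "integrable lebesgue (\<lambda>x. c1\<^sup>2 * (cmod (g x))\<^sup>2)"
        by (rule Bochner_Integration.integrable_bound[OF i])
          (use g sq_bounds in \<open>auto simp: abs_mult intro!: mult_right_mono\<close>)
      then show "integrable lebesgue (\<lambda>x. (cmod (g x))\<^sup>2)" using c1_pos by simp
    next
      assume "integrable lebesgue (\<lambda>x. (cmod (g x))\<^sup>2)"
      then show "integrable lebesgue (\<lambda>x. (u x)\<^sup>2 * (cmod (g x))\<^sup>2)"
        using g by (intro integrable_weighted_sq[OF _ sq_meas sq_bound]) (simp add: sq_integrable_def)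
    qed
    finally show ?thesis .
  qed
  then show ?thesis unfolding sq_integrable_def m by blast
qed

lemma ground_domain_eq: "ground_domain u = J ` H1"
proof (intro equalityI subsetI)
  fix \<psi> assume "\<psi> \<in> ground_domain u"
  then obtain g where \<psi>: "\<psi> = abs_L2 (\<lambda>x. g x * complex_of_real (u x))" and g: "sq_integrable lebesgue g"
    and wd: "\<And>b. b \<in> Basis \<Longrightarrow> \<exists>h. has_weak_deriv b g h \<and> sq_integrable lebesgue h"
    unfolding ground_domain_def sq_integrable_weighted by blast
  note rep = rep_abs_L2[OF g]
  have "abs_L2 g \<in> H1" by (rule H1I[OF rep wd])
  moreover have "\<psi> = J (abs_L2 g)"
  proof (rule L2_eqI)
    have "sq_integrable lebesgue (\<lambda>x. g x * complex_of_real (u x))"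
      using sq_integrable_mult[OF g u_meas u_bound] by (simp add: mult.commute)
    from rep_abs_L2[OF this] rep rep_J[of "abs_L2 g"]
    show "AE x in lebesgue. rep_L2 \<psi> x = rep_L2 (J (abs_L2 g)) x"
      unfolding \<psi> by eventually_elim simp
  qed
  ultimately show "\<psi> \<in> J ` H1" by blast
next
  fix \<psi> assume "\<psi> \<in> J ` H1"
  then obtain \<phi> where \<phi>: "\<phi> \<in> H1" and \<psi>: "\<psi> = J \<phi>" by blast
  have "\<psi> = abs_L2 (\<lambda>x. rep_L2 \<phi> x * complex_of_real (u x))"
    unfolding \<psi> mulL2_def by (simp add: mult.commute)
  then show "\<psi> \<in> ground_domain u"
    unfolding ground_domain_def sq_integrable_weighted using \<phi> sq_integrable_rep[of \<phi>] unfolding H1_def by blast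
qed

text \<open>The quotient of a representative of \<open>J \<phi>\<close> by \<open>u\<close> agrees
  with \<open>rep_L2 \<phi>\<close> only almost everywhere, so the derivative chosen by
  \<open>weak_deriv\<close> need not be \<open>wd b \<phi>\<close> itself. Replacing it under an
  integral takes both equality almost everywhere and measurability.\<close>

lemma weak_deriv_J:
  assumes "\<phi> \<in> H1" "b \<in> Basis"
  shows "AE x in lebesgue. weak_deriv b (\<lambda>y. rep_L2 (J \<phi>) y / complex_of_real (u y)) x = wd b \<phi> x"
    and "weak_deriv b (\<lambda>y. rep_L2 (J \<phi>) y / complex_of_real (u y)) \<in> borel_measurable lebesgue"
proof -
  note h = H1D(1)[OF assms]
  have "has_weak_deriv b (\<lambda>y. rep_L2 (J \<phi>) y / complex_of_real (u y)) (wd b \<phi>)"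
  proof (rule has_weak_deriv_cong[OF h])
    show "AE x in lebesgue. rep_L2 \<phi> x = rep_L2 (J \<phi>) x / complex_of_real (u x)"
      using rep_J[of \<phi>]
    proof eventually_elim
      case (elim x)
      then show ?case using u_pos[of x] by simp
    qed
  qed (use has_weak_deriv_measurable(2)[OF h] assms in auto)
  then show "AE x in lebesgue. weak_deriv b (\<lambda>y. rep_L2 (J \<phi>) y / complex_of_real (u y)) x = wd b \<phi> x"
    and "weak_deriv b (\<lambda>y. rep_L2 (J \<phi>) y / complex_of_real (u y)) \<in> borel_measurable lebesgue"
    by (rule weak_deriv_AE, rule has_weak_deriv_measurable(2)[OF has_weak_deriv_weak_deriv])
qed

lemma ground_form_J:
  assumes "\<phi> \<in> H1" "\<psi> \<in> H1"
  shows "ground_form u (J \<phi>) (J \<psi>) = gradient_form (\<lambda>x. (u x)\<^sup>2) \<phi> \<psi>"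
  unfolding ground_form_def gradient_form_def
proof (rule sum.cong[OF refl])
  fix b :: 'a assume b: "b \<in> Basis"
  let ?d = "\<lambda>\<phi>. weak_deriv b (\<lambda>y. rep_L2 (J \<phi>) y / complex_of_real (u y))"
  note [measurable] = weak_deriv_J(2)[OF assms(1) b] weak_deriv_J(2)[OF assms(2) b]
  have cm: "(\<lambda>x. cnj (?d \<phi> x)) \<in> borel_measurable lebesgue"
    by (intro measurable_compose[OF weak_deriv_J(2)[OF assms(1) b]] borel_measurable_continuous_onI continuous_intros)
  have m: "(\<lambda>x. cnj (?d \<phi> x) * ?d \<psi> x) \<in> borel_measurable lebesgue"
    by (intro borel_measurable_times cm weak_deriv_J(2)[OF assms(2) b])
  have "(LINT x|weighted u. cnj (?d \<phi> x) * ?d \<psi> x) = (LINT x|lebesgue. (u x)\<^sup>2 *\<^sub>R (cnj (?d \<phi> x) * ?d \<psi> x))"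
    unfolding weighted_def by (subst integral_density[OF m sq_meas]) auto
  also have "\<dots> = (LINT x|lebesgue. complex_of_real ((u x)\<^sup>2) * (cnj (wd b \<phi> x) * wd b \<psi> x))"
  proof (rule integral_cong_AE)
    show "(\<lambda>x. (u x)\<^sup>2 *\<^sub>R (cnj (?d \<phi> x) * ?d \<psi> x)) \<in> borel_measurable lebesgue"
      by (intro borel_measurable_scaleR sq_meas m)
    show "(\<lambda>x. complex_of_real ((u x)\<^sup>2) * (cnj (wd b \<phi> x) * wd b \<psi> x)) \<in> borel_measurable lebesgue"
      by (rule borel_measurable_integrable[OF integrable_weighted_inner[OF H1D(2)[OF assms(1) b] H1D(2)[OF assms(2) b] sq_meas sq_bound]])
    show "AE x in lebesgue. (u x)\<^sup>2 *\<^sub>R (cnj (?d \<phi> x) * ?d \<psi> x) = complex_of_real ((u x)\<^sup>2) * (cnj (wd b \<phi> x) * wd b \<psi> x)"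
      using weak_deriv_J(1)[OF assms(1) b] weak_deriv_J(1)[OF assms(2) b]
      by eventually_elim (simp add: scaleR_conv_of_real)
  qed
  finally show "(LINT x|weighted u. cnj (?d \<phi> x) * ?d \<psi> x) =
      (LINT x|lebesgue. complex_of_real ((u x)\<^sup>2) * (cnj (wd b \<phi> x) * wd b \<psi> x))" .
qed

lemma sesquilinear_ground_form: "sesquilinear_form (ground_domain u) (ground_form u)"
proof -
  interpret g: sesquilinear_form H1 "gradient_form (\<lambda>x. (u x)\<^sup>2)"
    by (rule sesquilinear_gradient_form[OF sq_meas sq_bound])
  interpret J: Vector_Spaces.linear cscale cscale J by (rule linear_J)
  show ?thesis
    unfolding ground_domain_eq
  proof
    show "0 \<in> J ` H1" using g.zero_Q J.zero by (metis imageI)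
    show "\<phi> + \<psi> \<in> J ` H1" if "\<phi> \<in> J ` H1" "\<psi> \<in> J ` H1" for \<phi> \<psi>
      using that g.add_Q by (auto simp flip: J.add)
    show "z *\<^sub>C \<phi> \<in> J ` H1" if "\<phi> \<in> J ` H1" for z \<phi>
      using that g.scale_Q by (auto simp flip: J.scale)
    show "ground_form u \<xi> (\<phi> + \<psi>) = ground_form u \<xi> \<phi> + ground_form u \<xi> \<psi>"
      if "\<xi> \<in> J ` H1" "\<phi> \<in> J ` H1" "\<psi> \<in> J ` H1" for \<xi> \<phi> \<psi>
      using that by (auto simp: ground_form_J g.q_add_right g.add_Q simp flip: J.add)
    show "ground_form u \<xi> (z *\<^sub>C \<phi>) = z * ground_form u \<xi> \<phi>" if "\<xi> \<in> J ` H1" "\<phi> \<in> J ` H1" for \<xi> \<phi> z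
      using that by (auto simp: ground_form_J g.q_scale_right g.scale_Q simp flip: J.scale)
    show "ground_form u \<psi> \<phi> = cnj (ground_form u \<phi> \<psi>)" if "\<phi> \<in> J ` H1" "\<psi> \<in> J ` H1" for \<phi> \<psi>
      using that by (auto simp: ground_form_J intro: g.q_commute)
  qed
qed

text \<open>\<open>J\<close> is symmetric as multiplication by a real function. Hence
  \<open>J f\<close> is orthogonal to \<open>H1\<close>, so it vanishes, and \<open>K\<close>
  inverts \<open>J\<close>.\<close>

lemma ground_domain_total:
  assumes "\<And>\<phi>. \<phi> \<in> ground_domain u \<Longrightarrow> cinner \<phi> f = 0" shows "f = 0"
proof -
  have "J f = 0"
  proof (rule H1_total)
    fix \<phi> :: "'a L2" assume "\<phi> \<in> H1"
    then have "cinner (J \<phi>) f = 0" by (intro assms) (simp add: ground_domain_eq)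
    then show "cinner \<phi> (J f) = 0" by (simp add: cinner_mulL2[OF u_meas u_bound])
  qed
  then have "K (J f) = 0" using Vector_Spaces.linear.axioms module_hom.zero linear_K by (metis Vector_Spaces.linear_iff_module_hom)
  then show ?thesis by (simp add: K_J)
qed

lemma Re_ground_form_bounds:
  assumes "\<phi> \<in> H1"
  shows "c1\<^sup>2 * Re (dirichlet_form \<phi> \<phi>) \<le> Re (ground_form u (J \<phi>) (J \<phi>))"
    and "Re (ground_form u (J \<phi>) (J \<phi>)) \<le> c2\<^sup>2 * Re (dirichlet_form \<phi> \<phi>)"
proof -
  have i: "integrable lebesgue (\<lambda>x. (u x)\<^sup>2 * (cmod (wd b \<phi> x))\<^sup>2)" "integrable lebesgue (\<lambda>x. (cmod (wd b \<phi> x))\<^sup>2)"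
    if "b \<in> Basis" for b
    using integrable_weighted_sq[OF H1D(2)[OF assms that] sq_meas sq_bound] H1D(2)[OF assms that] by (auto simp: sq_integrable_def)
  have "(\<Sum>b\<in>Basis. LINT x|lebesgue. c1\<^sup>2 * (cmod (wd b \<phi> x))\<^sup>2) \<le> (\<Sum>b\<in>Basis. LINT x|lebesgue. (u x)\<^sup>2 * (cmod (wd b \<phi> x))\<^sup>2)"
    by (intro sum_mono integral_mono integrable_mult_right i mult_right_mono sq_bounds) auto
  then show "c1\<^sup>2 * Re (dirichlet_form \<phi> \<phi>) \<le> Re (ground_form u (J \<phi>) (J \<phi>))"
    by (simp add: ground_form_J assms dirichlet_form_eq Re_gradient_form sum_distrib_left)
  have "(\<Sum>b\<in>Basis. LINT x|lebesgue. (u x)\<^sup>2 * (cmod (wd b \<phi> x))\<^sup>2) \<le> (\<Sum>b\<in>Basis. LINT x|lebesgue. c2\<^sup>2 * (cmod (wd b \<phi> x))\<^sup>2)"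
    by (intro sum_mono integral_mono integrable_mult_right i mult_right_mono sq_bounds) auto
  then show "Re (ground_form u (J \<phi>) (J \<phi>)) \<le> c2\<^sup>2 * Re (dirichlet_form \<phi> \<phi>)"
    by (simp add: ground_form_J assms dirichlet_form_eq Re_gradient_form sum_distrib_left)
qed

lemma norm_J_bounds: "c1\<^sup>2 * (norm \<phi>)\<^sup>2 \<le> (norm (J \<phi>))\<^sup>2" "(norm (J \<phi>))\<^sup>2 \<le> c2\<^sup>2 * (norm \<phi>)\<^sup>2"
proof -
  note i = integrable_weighted_sq[OF sq_integrable_rep sq_meas sq_bound, of \<phi>] integrable_rep_sq[of \<phi>]
  have "(LINT x|lebesgue. c1\<^sup>2 * (cmod (rep_L2 \<phi> x))\<^sup>2) \<le> (LINT x|lebesgue. (u x)\<^sup>2 * (cmod (rep_L2 \<phi> x))\<^sup>2)"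
    by (intro integral_mono integrable_mult_right i mult_right_mono sq_bounds) auto
  then show "c1\<^sup>2 * (norm \<phi>)\<^sup>2 \<le> (norm (J \<phi>))\<^sup>2"
    unfolding norm_mulL2[OF u_meas u_bound] unfolding norm_L2_sq by simp
  have "(LINT x|lebesgue. (u x)\<^sup>2 * (cmod (rep_L2 \<phi> x))\<^sup>2) \<le> (LINT x|lebesgue. c2\<^sup>2 * (cmod (rep_L2 \<phi> x))\<^sup>2)"
    by (intro integral_mono integrable_mult_right i mult_right_mono sq_bounds) auto
  then show "(norm (J \<phi>))\<^sup>2 \<le> c2\<^sup>2 * (norm \<phi>)\<^sup>2"
    unfolding norm_mulL2[OF u_meas u_bound] unfolding norm_L2_sq by simp
qed

lemma potential_J_bounds:
  assumes V: "V \<in> borel_measurable lebesgue" "\<And>x. V x \<le> 0"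
    and int: "integrable lebesgue (\<lambda>x. V x * (cmod (rep_L2 \<phi> x))\<^sup>2)"
  defines "P \<equiv> \<lambda>\<phi>. LINT x|lebesgue. V x * (cmod (rep_L2 \<phi> x))\<^sup>2"
  shows "c2\<^sup>2 * P \<phi> \<le> P (J \<phi>)" and "P (J \<phi>) \<le> c1\<^sup>2 * P \<phi>"
proof -
  let ?v = "\<lambda>x. V x * (cmod (rep_L2 \<phi> x))\<^sup>2"
  have m: "?v \<in> borel_measurable lebesgue" by (rule borel_measurable_integrable[OF int])
  have neg: "?v x \<le> 0" for x using V(2)[of x] by (simp add: mult_nonpos_nonneg)
  have eq: "P (J \<phi>) = (LINT x|lebesgue. (u x)\<^sup>2 * ?v x)"
    unfolding P_def
  proof (rule integral_cong_AE)
    show "AE x in lebesgue. V x * (cmod (rep_L2 (J \<phi>) x))\<^sup>2 = (u x)\<^sup>2 * ?v x"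
      using rep_J[of \<phi>] by eventually_elim (simp add: norm_mult power_mult_distrib)
    show "(\<lambda>x. V x * (cmod (rep_L2 (J \<phi>) x))\<^sup>2) \<in> borel_measurable lebesgue"
      by (intro borel_measurable_times V) simp
    show "(\<lambda>x. (u x)\<^sup>2 * ?v x) \<in> borel_measurable lebesgue" by (intro borel_measurable_times sq_meas m)
  qed
  have i: "integrable lebesgue (\<lambda>x. (u x)\<^sup>2 * ?v x)"
  proof (rule Bochner_Integration.integrable_bound)
    show "integrable lebesgue (\<lambda>x. c2\<^sup>2 * ?v x)" by (intro integrable_mult_right int)
    show "(\<lambda>x. (u x)\<^sup>2 * ?v x) \<in> borel_measurable lebesgue" by (intro borel_measurable_times sq_meas m)
    show "AE x in lebesgue. norm ((u x)\<^sup>2 * ?v x) \<le> norm (c2\<^sup>2 * ?v x)"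
      using sq_bounds by (intro always_eventually allI) (auto simp: abs_mult intro!: mult_right_mono)
  qed
  have "(LINT x|lebesgue. c2\<^sup>2 * ?v x) \<le> (LINT x|lebesgue. (u x)\<^sup>2 * ?v x)"
    by (intro integral_mono i integrable_mult_right int mult_right_mono_neg sq_bounds neg)
  then show "c2\<^sup>2 * P \<phi> \<le> P (J \<phi>)" unfolding eq by (simp add: P_def)
  have "(LINT x|lebesgue. (u x)\<^sup>2 * ?v x) \<le> (LINT x|lebesgue. c1\<^sup>2 * ?v x)"
    by (intro integral_mono i integrable_mult_right int mult_right_mono_neg sq_bounds neg)
  then show "P (J \<phi>) \<le> c1\<^sup>2 * P \<phi>" unfolding eq by (simp add: P_def)
qed

text \<open>Since \<open>c1\<^sup>2 = c2\<^sup>2 / \<beta>\<close>, the upper bounds for both parts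
  of the energy of \<open>J \<phi>\<close> combine to \<open>c2\<^sup>2\<close> times the form of
  \<open>-\<Delta> + V / \<beta>\<close>, and the lower bounds to \<open>c1\<^sup>2\<close> times
  that of \<open>-\<Delta> + \<beta> V\<close>. The trial map is \<open>J\<close> for the first
  inequality and its inverse \<open>K\<close> for the second.\<close>

theorem eigenvalue_comparison:
  fixes V :: "'a \<Rightarrow> real"
  defines "\<beta> \<equiv> (c2 / c1)\<^sup>2"
  assumes V: "V \<in> borel_measurable lebesgue" "\<And>x. V x \<le> 0"
    and g: "form_sum_well_defined (ground_domain u) (ground_form u) V"
    and s1: "form_sum_well_defined H1 dirichlet_form (\<lambda>x. inverse \<beta> * V x)"
    and s2: "form_sum_well_defined H1 dirichlet_form (\<lambda>x. \<beta> * V x)"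
  shows "\<bar>neg_eigenvalue j (schroedinger (\<lambda>x. inverse \<beta> * V x))\<bar> \<le> \<bar>neg_eigenvalue j (perturbed_hamiltonian u V)\<bar>"
    and "\<bar>neg_eigenvalue j (perturbed_hamiltonian u V)\<bar> \<le> \<bar>neg_eigenvalue j (schroedinger (\<lambda>x. \<beta> * V x))\<bar>"
proof -
  have \<beta>: "0 < \<beta>" using c1_pos c2_pos by (simp add: \<beta>_def)
  have \<beta>_eq: "\<beta> * c1\<^sup>2 = c2\<^sup>2" "inverse \<beta> * c2\<^sup>2 = c1\<^sup>2" using c1_pos c2_pos by (simp_all add: \<beta>_def power_divide field_simps)
  have sesq: "sesquilinear_form H1 dirichlet_form"
    unfolding dirichlet_form_eq by (rule sesquilinear_gradient_form[where C = 1]) auto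
  \<comment> \<open>Read off the well-definedness of \<open>-\<Delta> + \<beta> V\<close> by
    cancelling the factor \<open>\<beta>\<close>.\<close>
  have intV: "integrable lebesgue (\<lambda>x. V x * (cmod (rep_L2 \<phi> x))\<^sup>2)" if "\<phi> \<in> H1" for \<phi>
    using s2 that \<beta> by (simp add: form_sum_well_defined_def mult.assoc)
  have P: "(LINT x|lebesgue. t * V x * (cmod (rep_L2 \<phi> x))\<^sup>2) = t * (LINT x|lebesgue. V x * (cmod (rep_L2 \<phi> x))\<^sup>2)" for t \<phi>
    by (simp add: mult.assoc)
  have c1: "closed_semibounded_form H1 (add_potential dirichlet_form (\<lambda>x. inverse \<beta> * V x))"
    by (rule closed_semibounded_add_potential[OF sesq _ s1 H1_total]) (use V in auto)
  have c2: "closed_semibounded_form H1 (add_potential dirichlet_form (\<lambda>x. \<beta> * V x))"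
    by (rule closed_semibounded_add_potential[OF sesq _ s2 H1_total]) (use V in auto)
  have cg: "closed_semibounded_form (ground_domain u) (add_potential (ground_form u) V)"
    by (rule closed_semibounded_add_potential[OF sesquilinear_ground_form V(1) g ground_domain_total])
  have J0: "\<phi> = 0" if "J \<phi> = 0" for \<phi>
  proof -
    interpret K: Vector_Spaces.linear cscale cscale K by (rule linear_K)
    show ?thesis using K_J[of \<phi>] that K.zero by simp
  qed
  have K0: "\<phi> = 0" if "K \<phi> = 0" for \<phi>
  proof -
    interpret J: Vector_Spaces.linear cscale cscale J by (rule linear_J)
    show ?thesis using J_K[of \<phi>] that J.zero by simp
  qed
  show "\<bar>neg_eigenvalue j (schroedinger (\<lambda>x. inverse \<beta> * V x))\<bar> \<le> \<bar>neg_eigenvalue j (perturbed_hamiltonian u V)\<bar>"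
    unfolding schroedinger_def perturbed_hamiltonian_def
  proof (rule neg_eigenvalue_le[OF c1 cg linear_J J0])
    fix \<phi> :: "'a L2" assume \<phi>: "\<phi> \<in> H1"
    then show "J \<phi> \<in> ground_domain u" by (simp add: ground_domain_eq)
    fix l :: real assume l: "l < 0"
      and le: "Re (add_potential dirichlet_form (\<lambda>x. inverse \<beta> * V x) \<phi> \<phi>) \<le> l * (norm \<phi>)\<^sup>2"
    let ?P = "LINT x|lebesgue. V x * (cmod (rep_L2 \<phi> x))\<^sup>2"
    have "Re (add_potential (ground_form u) V (J \<phi>) (J \<phi>)) \<le> c2\<^sup>2 * Re (dirichlet_form \<phi> \<phi>) + c1\<^sup>2 * ?P"
      unfolding Re_add_potential by (intro add_mono Re_ground_form_bounds potential_J_bounds V \<phi> intV)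
    also have "\<dots> = c2\<^sup>2 * Re (add_potential dirichlet_form (\<lambda>x. inverse \<beta> * V x) \<phi> \<phi>)"
      unfolding Re_add_potential P \<beta>_eq(2)[symmetric] by (simp add: algebra_simps)
    also have "\<dots> \<le> c2\<^sup>2 * (l * (norm \<phi>)\<^sup>2)" by (intro mult_left_mono le) simp
    also have "\<dots> = l * (c2\<^sup>2 * (norm \<phi>)\<^sup>2)" by simp
    \<comment> \<open>Multiplication by \<open>l < 0\<close> reverses the upper bound for the norm
      of \<open>J \<phi>\<close>.\<close>
    also have "\<dots> \<le> l * (norm (J \<phi>))\<^sup>2" using l by (intro mult_left_mono_neg norm_J_bounds) simp
    finally show "Re (add_potential (ground_form u) V (J \<phi>) (J \<phi>)) \<le> l * (norm (J \<phi>))\<^sup>2" .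
  qed
  show "\<bar>neg_eigenvalue j (perturbed_hamiltonian u V)\<bar> \<le> \<bar>neg_eigenvalue j (schroedinger (\<lambda>x. \<beta> * V x))\<bar>"
    unfolding schroedinger_def perturbed_hamiltonian_def
  proof (rule neg_eigenvalue_le[OF cg c2 linear_K K0])
    fix \<psi> :: "'a L2" assume "\<psi> \<in> ground_domain u"
    then obtain \<phi> where \<phi>: "\<phi> \<in> H1" and \<psi>: "\<psi> = J \<phi>" by (auto simp: ground_domain_eq)
    show "K \<psi> \<in> H1" by (simp add: \<psi> K_J \<phi>)
    fix l :: real assume l: "l < 0" and le: "Re (add_potential (ground_form u) V \<psi> \<psi>) \<le> l * (norm \<psi>)\<^sup>2"
    let ?P = "LINT x|lebesgue. V x * (cmod (rep_L2 \<phi> x))\<^sup>2"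
    have "c1\<^sup>2 * Re (add_potential dirichlet_form (\<lambda>x. \<beta> * V x) \<phi> \<phi>) = c1\<^sup>2 * Re (dirichlet_form \<phi> \<phi>) + c2\<^sup>2 * ?P"
      unfolding Re_add_potential P \<beta>_eq(1)[symmetric] by (simp add: algebra_simps)
    also have "\<dots> \<le> Re (add_potential (ground_form u) V (J \<phi>) (J \<phi>))"
      unfolding Re_add_potential by (intro add_mono Re_ground_form_bounds potential_J_bounds V \<phi> intV)
    also have "\<dots> \<le> l * (norm (J \<phi>))\<^sup>2" using le by (simp add: \<psi>)
    \<comment> \<open>The mirror image: here the lower bound for the norm is reversed, and the
      factor \<open>c1\<^sup>2\<close> then cancels.\<close>
    also have "\<dots> \<le> l * (c1\<^sup>2 * (norm \<phi>)\<^sup>2)" using l by (intro mult_left_mono_neg norm_J_bounds) simp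
    also have "\<dots> = c1\<^sup>2 * (l * (norm \<phi>)\<^sup>2)" by simp
    finally have "Re (add_potential dirichlet_form (\<lambda>x. \<beta> * V x) \<phi> \<phi>) \<le> l * (norm \<phi>)\<^sup>2"
      using c1_pos by (simp add: mult_le_cancel_left_pos)
    then show "Re (add_potential dirichlet_form (\<lambda>x. \<beta> * V x) (K \<psi>) (K \<psi>)) \<le> l * (norm (K \<psi>))\<^sup>2"
      by (simp add: \<psi> K_J)
  qed
qed

end

theorem theorem1p1:
  fixes V0 V u0 :: "'a::euclidean_space \<Rightarrow> real" and \<beta> :: real and j :: nat
  assumes "regular_ground_state V0 u0"
    and "inf_spec (ground_hamiltonian u0) = 0"
    and "\<beta> = ground_state_ratio u0"
    and "V \<in> borel_measurable lebesgue"
    and "\<And>x. V x \<le> 0"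
    and "form_sum_well_defined (ground_domain u0) (ground_form u0) V"
    and "form_sum_well_defined H1 dirichlet_form (\<lambda>x. inverse \<beta> * V x)"
    and "form_sum_well_defined H1 dirichlet_form (\<lambda>x. \<beta> * V x)"
    and "1 \<le> j"
  shows "\<bar>neg_eigenvalue j (schroedinger (\<lambda>x. inverse \<beta> * V x))\<bar>
           \<le> \<bar>neg_eigenvalue j (perturbed_hamiltonian u0 V)\<bar>
       \<and> \<bar>neg_eigenvalue j (perturbed_hamiltonian u0 V)\<bar>
           \<le> \<bar>neg_eigenvalue j (schroedinger (\<lambda>x. \<beta> * V x))\<bar>"
proof -
  obtain c d where cont: "continuous_on UNIV u0" and c: "0 < c" and bounds: "\<And>x. c \<le> u0 x" "\<And>x. u0 x \<le> d"
    using assms(1) unfolding regular_ground_state_def by blast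
  have "bdd_below (range u0)" "bdd_above (range u0)"
    using bounds by (auto intro: bdd_belowI2[of _ c] bdd_aboveI2[of _ _ d])
  then interpret regular_weight u0 "INF x. u0 x" "SUP x. u0 x"
  proof unfold_locales
    \<comment> \<open>Pointwise positivity alone would allow the infimum to be 0; the uniform lower
      bound \<open>c\<close> excludes this.\<close>
    show "0 < (INF x. u0 x)" by (rule order_less_le_trans[OF c]) (auto intro: cINF_greatest bounds)
  qed (auto intro: cont cINF_lower cSUP_upper)
  show ?thesis
    using eigenvalue_comparison[OF assms(4,5,6)] assms(7,8) unfolding assms(3) ground_state_ratio_def by blast
qed

end
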